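(* Consider the setting described in the context and assume all parameter conditions (i)–(ix) hold (in particular the sparse-unlearnable regime (vii)). Run adversarial training (objective $\mathcal L_{\mathrm{AT}}$) by gradient descent for $T$ iterations on this dataset, in which a fraction $p_{\mathrm{un}}$ of samples is unlearnable. Then, on the event $\mathcal E$: (1) there exists a filter $r\in[m]$ with $w^{(T)}_{r,1}\ge\tilde\Omega(\alpha^{-1})$; (2) there exists an index $i\in\mathcal S_U$ with $\max_{r\in[m],\,j\ne s(\mathbf X_i)}y_i\langle\mathbf w_r^{(T)},\mathbf x_{i,j}\rangle\ge\tilde\Omega(1)$. Consequently, the robust training error is $o(1)$, while the robust test error $\mathcal L^{\mathrm{rob}}_{\mathcal D_L}(f_{\mathbf W^{(T)}})$ is at least $\frac12-o(1)$.
   Context: Data. Fix integers $N,P,d,m$ and reals $\alpha,\sigma_n,\sigma_0,\eta,\epsilon,\Gamma>0$, $\delta\in(0,1)$, and a horizon $T\in\mathbb N$. Let $\mathbf u=\mathbf e_1$, $\mathbf v=\mathbf e_d$ in $\mathbb R^d$ and $\Pi_{\mathcal F}$ the orthogonal projection onto $\mathcal F=\mathrm{span}\{\mathbf u,\mathbf v\}$. Fix a partition $[N]=\mathcal S_L\sqcup\mathcal S_U$ and let $p_{\mathrm{un}}=|\mathcal S_U|/N$. Independently for each $i\in[N]$: $y_i$ is uniform on $\{+1,-1\}$, the signal patch index $s(\mathbf X_i)$ is uniform on $[P]$, $\mathbf X_i=(\mathbf x_{i,1},\dots,\mathbf x_{i,P})\in\mathbb R^{P\times d}$ with $\mathbf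 x_{i,s(\mathbf X_i)}=\alpha y_i\mathbf u$ if $i\in\mathcal S_L$ and $=\alpha y_i\mathbf v$ if $i\in\mathcal S_U$, and for $p\ne s(\mathbf X_i)$ the noise patches $\mathbf x_{i,p}\sim\mathcal N(\mathbf 0,\sigma_n^2(\mathbf I_d-\Pi_{\mathcal F}))$ are independent. The test distribution $\mathcal D_L$ draws $(\mathbf X,y)$ by the same rule with learnable signal patch $\alpha y\mathbf u$ and independent Gaussian noise patches. Student. $f_{\mathbf W}(\mathbf X)=\sum_{r=1}^m\sum_{p=1}^P[\phi(\langle\mathbf w_r,\mathbf x_p\rangle)-\phi(-\langle\mathbf w_r,\mathbf x_p\rangle)]$ with $\phi(z)=(\max\{0,z\})^3$. Initialization: $w^{(0)}_{r,j}\sim\mathcal N(0,\sigma_0^2)$ i.i.d. for $j\le d-1$ and $w^{(0)}_{r,d}=0$; the constraint $\langle\mathbf w_r,\mathbf v\rangle=0$ is kept throughout training. $w_{r,1}=\langle\mathbf w_r,\mathbf e_1\rangle$. Training. $\ell(z)=\log(1+e^{-z})$, $\sigma(z)=(1+e^{-z})^{-1}$, $\psi(z)=\sigma(-z)$. At iteration $t$, $\tilde{\mathbf X}_i^{(t)}$ maximizes $\ell(y_if_{\mathbf W^{(t)}}(\mathbf X'))$ over $\mathbf X'$ with $\|\mathbf X'-\mathbf X_i\|_\infty\le\epsilon$ and $\mathbf X'-\mathbf X_i\in\mathrm{span}(\mathbf x_{i,s(\mathbf X_i)})$ (only the signal patch is perturbed, along its own direction). AT objective: $\mathcal L_{\mathrm{AT}}(\mathbf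 W;\mathbf X,y)=\ell(yf_{\mathbf W}(\tilde{\mathbf X}))$. Gradient descent: $\mathbf W^{(t+1)}=\mathbf W^{(t)}-\frac{\eta}{N}\sum_{i}\nabla_{\mathbf W}\mathcal L(\mathbf W^{(t)};\mathbf X_i,y_i)$ with $\tilde{\mathbf X}_i^{(t)}$ held fixed. Errors. Robust test error $\mathcal L^{\mathrm{rob}}_{\mathcal D_L}(f)=\Pr_{(\mathbf X,y)\sim\mathcal D_L}[\min_{\|\boldsymbol\delta\|_\infty\le\epsilon}yf(\mathbf X+\boldsymbol\delta)<0]$. Robust training error is measured by the average adversarial logistic loss $\frac1N\sum_i\ell(y_if_{\mathbf W^{(T)}}(\tilde{\mathbf X}^{(T)}_i))$. $\tilde O,\tilde\Omega$ hide polylogarithmic factors; $o(1)$ denotes a quantity vanishing in the asymptotic regime of the conditions. Parameter conditions (for a sufficiently large universal constant $C>0$): (i) $T\ge CN/(\eta\sigma_0\sigma_n^3d^{3/2})$; (ii) $d\ge Cm^2P^2N^2\log^4(TNmP/\delta)$; (iii) $\alpha\ge C\sigma_n\sqrt d\log(TNmP/\delta)/(N^{1/3}(1-p_{\mathrm{un}})^{1/3})$; (iv) $\sigma_0\le C^{-1}\min\{\frac{1}{m^{2/3}P^{2/3}\sigma_n\sqrt d},\frac{1}{\alpha m^{2/3}},\frac{1}{\sigma_nm^2P^{1/2}d}\}/\log(TdNmP/\delta)$; (v) $\eta\le C^{-1}\min\{\frac1{\alpha^3\sigma_0},\frac1{\sigma_n^2d},\frac1{\alpha^2}\}/\log(TNmP/\delta)$;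 (vi) $C\sigma_nmP^{1/2}\log(TdNP/\delta)\le\epsilon<C^{-1}\min\{\alpha,\frac1{m\sigma_0d}\}$; (vii) $C/N\le p_{\mathrm{un}}\le C^{-1}\log d/N$ and $N\ge CmP\log(TdNmP/\delta)$; (viii) $C\log(NP/\delta)\le m\le C\log^Cd$, $2\le P\le C$; (ix) $\Gamma\ge Cd$. Event $\mathcal E$: for all $r\in[m]$, $i,k\in[N]$, $j\ne s(\mathbf X_i)$, $q\ne s(\mathbf X_k)$, $(i,j)\ne(k,q)$: $\frac12\sigma_n^2d\le\|\mathbf x_{i,j}\|_2^2\le\frac32\sigma_n^2d$; $|\langle\mathbf x_{i,j},\mathbf x_{k,q}\rangle|\le2\sigma_n^2\sqrt{d\log(16N^2P^2/\delta)}$; $\|\mathbf x_{i,j}\|_\infty\le\sigma_n\sqrt{2\log(16dNP/\delta)}$; $\|\mathbf w_r^{(0)}\|_2\le2\sigma_0\sqrt d$; $|\langle\mathbf w^{(0)}_r,\mathbf e_1\rangle|\le\sigma_0\sqrt{2\log(16m/\delta)}$; $|\langle\mathbf w^{(0)}_r,\mathbf x_{i,j}\rangle|\le2\sigma_0\sigma_n\sqrt{d\log(16NmP/\delta)}$; $\frac12\sigma_0\le\max_r\langle\mathbf w^{(0)}_r,\mathbf e_1\rangle\le\sigma_0\sqrt{2\log(16m/\delta)}$; $\frac14\sigma_0\sigma_n\sqrt d\le\max_ry_i\langle\mathbf w^{(0)}_r,\mathbf x_{i,j}\rangle\le2\sigma_0\sigma_n\sqrt{d\log(16NmP/\delta)}$.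 *)

theory Defs
  imports "HOL-Probability.Probability"
begin

text \<open>Conventions. Vectors in R^d are functions nat => real, coordinate j in {0..<d};
  e_1 is coordinate 0 and e_d is coordinate d-1. A data point X in R^{P x d} is a function
  nat => nat => real, X p j = j-th coordinate of patch p (p < P, j < d).
  Student weights W r j = j-th coordinate of filter w_r (r < m, j < d).
  Samples are indexed by i < N.\<close>

record at_inst =
  iN :: nat
  iP :: nat
  idim :: nat
  im :: nat
  iT :: nat
  ialpha :: real
  isign :: real
  isig0 :: real
  ieta :: real
  ieps :: real
  iGamma :: real
  idelta :: real
  iSU :: "nat set"     \<comment> \<open>unlearnable indices S_U; S_L = [N] - S_U\<close>
  iX :: "nat \<Rightarrow> nat \<Rightarrow> nat \<Rightarrow> real"
  iy :: "nat \<Rightarrow> real"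
  iS :: "nat \<Rightarrow> nat"                 \<comment> \<open>signal patch index s(X_i)\<close>
  iW0 :: "nat \<Rightarrow> nat \<Rightarrow> real"

definition inner_d :: "nat \<Rightarrow> (nat \<Rightarrow> real) \<Rightarrow> (nat \<Rightarrow> real) \<Rightarrow> real" where
  "inner_d d a b = (\<Sum>j<d. a j * b j)"

definition act :: "real \<Rightarrow> real" where
  "act z = (max 0 z) ^ 3"

definition act' :: "real \<Rightarrow> real" where
  "act' z = 3 * (max 0 z) ^ 2"

definition logistic :: "real \<Rightarrow> real" where
  "logistic z = ln (1 + exp (- z))"

definition sigmoid :: "real \<Rightarrow> real" where
  "sigmoid z = 1 / (1 + exp (- z))"

definition psi :: "real \<Rightarrow> real" where
  "psi z = sigmoid (- z)"

definition fnet :: "nat \<Rightarrow> nat \<Rightarrow> nat \<Rightarrow> (nat \<Rightarrow> nat \<Rightarrow> real) \<Rightarrow> (nat \<Rightarrow> nat \<Rightarrow> real) \<Rightarrow> real" where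
  "fnet m P d W X = (\<Sum>r<m. \<Sum>p<P. act (inner_d d (W r) (X p)) - act (- inner_d d (W r) (X p)))"

abbreviation f_of :: "at_inst \<Rightarrow> (nat \<Rightarrow> nat \<Rightarrow> real) \<Rightarrow> (nat \<Rightarrow> nat \<Rightarrow> real) \<Rightarrow> real" where
  "f_of S W X \<equiv> fnet (im S) (iP S) (idim S) W X"

abbreviation p_un :: "at_inst \<Rightarrow> real" where
  "p_un S \<equiv> real (card (iSU S)) / real (iN S)"

definition params_ok :: "real \<Rightarrow> at_inst \<Rightarrow> bool" where
  "params_ok C S \<longleftrightarrow>
    (let N = real (iN S); P = real (iP S); d = real (idim S); m = real (im S); T = real (iT S);
         \<alpha> = ialpha S; \<sigma>n = isign S; \<sigma>0 = isig0 S; \<eta> = ieta S; \<epsilon> = ieps S;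
         \<Gamma> = iGamma S; \<delta> = idelta S; pu = p_un S in
     iN S > 0 \<and> iP S > 0 \<and> idim S > 0 \<and> im S > 0 \<and>
     \<alpha> > 0 \<and> \<sigma>n > 0 \<and> \<sigma>0 > 0 \<and> \<eta> > 0 \<and> \<epsilon> > 0 \<and> \<Gamma> > 0 \<and> 0 < \<delta> \<and> \<delta> < 1 \<and>
     iSU S \<subseteq> {..<iN S} \<and>
     \<comment> \<open>(i)\<close>
     T \<ge> C * N / (\<eta> * \<sigma>0 * \<sigma>n ^ 3 * d powr (3/2)) \<and>
     \<comment> \<open>(ii)\<close>
     d \<ge> C * m\<^sup>2 * P\<^sup>2 * N\<^sup>2 * (ln (T * N * m * P / \<delta>)) ^ 4 \<and>
     \<comment> \<open>(iii)\<close>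
     \<alpha> \<ge> C * \<sigma>n * sqrt d * ln (T * N * m * P / \<delta>) / (N powr (1/3) * (1 - pu) powr (1/3)) \<and>
     \<comment> \<open>(iv)\<close>
     \<sigma>0 \<le> (1 / C) * min (1 / (m powr (2/3) * P powr (2/3) * \<sigma>n * sqrt d))
                          (min (1 / (\<alpha> * m powr (2/3))) (1 / (\<sigma>n * m\<^sup>2 * sqrt P * d)))
            / ln (T * d * N * m * P / \<delta>) \<and>
     \<comment> \<open>(v)\<close>
     \<eta> \<le> (1 / C) * min (1 / (\<alpha> ^ 3 * \<sigma>0)) (min (1 / (\<sigma>n\<^sup>2 * d)) (1 / \<alpha>\<^sup>2))
            / ln (T * N * m * P / \<delta>) \<and>
     \<comment> \<open>(vi)\<close>
     C * \<sigma>n * m * sqrt P * ln (T * d * N * P / \<delta>) \<le> \<epsilon> \<and>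
     \<epsilon> < (1 / C) * min \<alpha> (1 / (m * \<sigma>0 * d)) \<and>
     \<comment> \<open>(vii)\<close>
     C / N \<le> pu \<and> pu \<le> (1 / C) * ln d / N \<and>
     N \<ge> C * m * P * ln (T * d * N * m * P / \<delta>) \<and>
     \<comment> \<open>(viii)\<close>
     C * ln (N * P / \<delta>) \<le> m \<and> m \<le> C * (ln d) powr C \<and> 2 \<le> P \<and> P \<le> C \<and>
     \<comment> \<open>(ix)\<close>
     \<Gamma> \<ge> C * d)"

text \<open>Structural form of the realized training data and initialization:
  labels in {+1,-1}, signal patch alpha y u (S_L) or alpha y v (S_U), noise patches
  orthogonal to F = span{u,v}, initialization with w_{r,d} = 0.\<close>
definition data_ok :: "at_inst \<Rightarrow> bool" where
  "data_ok S \<longleftrightarrow>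
    (\<forall>i<iN S. (iy S i = 1 \<or> iy S i = -1) \<and> iS S i < iP S \<and>
       (\<forall>j<idim S. iX S i (iS S i) j =
           ialpha S * iy S i * (if j = (if i \<in> iSU S then idim S - 1 else 0) then 1 else 0)) \<and>
       (\<forall>p<iP S. p \<noteq> iS S i \<longrightarrow> iX S i p 0 = 0 \<and> iX S i p (idim S - 1) = 0)) \<and>
    (\<forall>r<im S. iW0 S r (idim S - 1) = 0)"

definition event_E :: "at_inst \<Rightarrow> bool" where
  "event_E S \<longleftrightarrow>
    (let N = real (iN S); P = real (iP S); d = real (idim S); m = real (im S);
         \<sigma>n = isign S; \<sigma>0 = isig0 S; \<delta> = idelta S;
         x = (\<lambda>i p. iX S i p); w = iW0 S;
         e1 = (\<lambda>j::nat. if j = 0 then 1 else 0 :: real) in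
     (\<forall>i<iN S. \<forall>j<iP S. j \<noteq> iS S i \<longrightarrow>
        1/2 * \<sigma>n\<^sup>2 * d \<le> inner_d (idim S) (x i j) (x i j) \<and>
        inner_d (idim S) (x i j) (x i j) \<le> 3/2 * \<sigma>n\<^sup>2 * d \<and>
        (\<forall>l<idim S. \<bar>x i j l\<bar> \<le> \<sigma>n * sqrt (2 * ln (16 * d * N * P / \<delta>))) \<and>
        (\<forall>r<im S. \<bar>inner_d (idim S) (w r) (x i j)\<bar> \<le> 2 * \<sigma>0 * \<sigma>n * sqrt (d * ln (16 * N * m * P / \<delta>))) \<and>
        1/4 * \<sigma>0 * \<sigma>n * sqrt d \<le> Max ((\<lambda>r. iy S i * inner_d (idim S) (w r) (x i j)) ` {..<im S}) \<and>
        Max ((\<lambda>r. iy S i * inner_d (idim S) (w r) (x i j)) ` {..<im S})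
            \<le> 2 * \<sigma>0 * \<sigma>n * sqrt (d * ln (16 * N * m * P / \<delta>))) \<and>
     (\<forall>i<iN S. \<forall>j<iP S. \<forall>k<iN S. \<forall>q<iP S.
        j \<noteq> iS S i \<longrightarrow> q \<noteq> iS S k \<longrightarrow> (i, j) \<noteq> (k, q) \<longrightarrow>
        \<bar>inner_d (idim S) (x i j) (x k q)\<bar> \<le> 2 * \<sigma>n\<^sup>2 * sqrt (d * ln (16 * N\<^sup>2 * P\<^sup>2 / \<delta>))) \<and>
     (\<forall>r<im S. sqrt (inner_d (idim S) (w r) (w r)) \<le> 2 * \<sigma>0 * sqrt d \<and>
        \<bar>inner_d (idim S) (w r) e1\<bar> \<le> \<sigma>0 * sqrt (2 * ln (16 * m / \<delta>))) \<and>
     1/2 * \<sigma>0 \<le> Max ((\<lambda>r. inner_d (idim S) (w r) e1) ` {..<im S}) \<and>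
     Max ((\<lambda>r. inner_d (idim S) (w r) e1) ` {..<im S}) \<le> \<sigma>0 * sqrt (2 * ln (16 * m / \<delta>)))"

definition adv_feasible :: "at_inst \<Rightarrow> nat \<Rightarrow> (nat \<Rightarrow> nat \<Rightarrow> real) \<Rightarrow> bool" where
  "adv_feasible S i X' \<longleftrightarrow>
    (\<forall>p<iP S. \<forall>j<idim S. \<bar>X' p j - iX S i p j\<bar> \<le> ieps S) \<and>
    (\<exists>c. \<forall>p<iP S. \<forall>j<idim S. X' p j - iX S i p j = c * (if p = iS S i then iX S i p j else 0))"

definition is_adv :: "at_inst \<Rightarrow> (nat \<Rightarrow> nat \<Rightarrow> real) \<Rightarrow> nat \<Rightarrow> (nat \<Rightarrow> nat \<Rightarrow> real) \<Rightarrow> bool" where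
  "is_adv S W i X' \<longleftrightarrow> adv_feasible S i X' \<and>
    (\<forall>X''. adv_feasible S i X'' \<longrightarrow>
        logistic (iy S i * f_of S W X'') \<le> logistic (iy S i * f_of S W X'))"

text \<open>Gradient of the AT loss of sample i w.r.t. w_{r,j}, with the adversarial example Xa held
  fixed: d/dw_r l(y f_W(Xa)) = -psi(y f_W(Xa)) y sum_p [phi'(<w_r,xa_p>) + phi'(-<w_r,xa_p>)] xa_p.\<close>
definition grad_AT :: "at_inst \<Rightarrow> (nat \<Rightarrow> nat \<Rightarrow> real) \<Rightarrow> nat \<Rightarrow> (nat \<Rightarrow> nat \<Rightarrow> real) \<Rightarrow> nat \<Rightarrow> nat \<Rightarrow> real" where
  "grad_AT S W i Xa r j =
    - psi (iy S i * f_of S W Xa) * iy S i *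
      (\<Sum>p<iP S. (act' (inner_d (idim S) (W r) (Xa p)) + act' (- inner_d (idim S) (W r) (Xa p))) * Xa p j)"

definition AT_traj :: "at_inst \<Rightarrow> (nat \<Rightarrow> nat \<Rightarrow> nat \<Rightarrow> real) \<Rightarrow> (nat \<Rightarrow> nat \<Rightarrow> nat \<Rightarrow> nat \<Rightarrow> real) \<Rightarrow> bool" where
  "AT_traj S W Xa \<longleftrightarrow>
    (\<forall>r<im S. \<forall>j<idim S. W 0 r j = iW0 S r j) \<and>
    (\<forall>t. \<forall>i<iN S. is_adv S (W t) i (Xa t i)) \<and>
    (\<forall>t. \<forall>r<im S. \<forall>j<idim S.
       W (Suc t) r j = W t r j - ieta S / real (iN S) * (\<Sum>i<iN S. grad_AT S (W t) i (Xa t i) r j))"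

definition rob_train_loss :: "at_inst \<Rightarrow> (nat \<Rightarrow> nat \<Rightarrow> nat \<Rightarrow> real) \<Rightarrow> (nat \<Rightarrow> nat \<Rightarrow> nat \<Rightarrow> nat \<Rightarrow> real) \<Rightarrow> real" where
  "rob_train_loss S W Xa =
    (\<Sum>i<iN S. logistic (iy S i * f_of S (W (iT S)) (Xa (iT S) i))) / real (iN S)"

text \<open>Test distribution D_L: y uniform on {1,-1}, s uniform on [P], signal patch alpha y e_1,
  noise patches N(0, sigma_n^2 (I - Pi_F)), i.e. i.i.d. N(0,sigma_n^2) on coordinates 1..d-2
  (0-based) and 0 on coordinates 0 and d-1. G collects the i.i.d. Gaussian coordinates.\<close>
definition noise_M :: "nat \<Rightarrow> nat \<Rightarrow> real \<Rightarrow> ((nat \<times> nat) \<Rightarrow> real) measure" where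
  "noise_M P d \<sigma> = PiM ({..<P} \<times> {1..<d - 1}) (\<lambda>_. density lborel (normal_density 0 \<sigma>))"

definition test_X :: "real \<Rightarrow> nat \<Rightarrow> nat \<Rightarrow> real \<Rightarrow> ((nat \<times> nat) \<Rightarrow> real) \<Rightarrow> nat \<Rightarrow> nat \<Rightarrow> real" where
  "test_X \<alpha> d s y G = (\<lambda>p j. if p = s then (if j = 0 then \<alpha> * y else 0)
                               else (if 1 \<le> j \<and> j < d - 1 then G (p, j) else 0))"

definition rob_fail :: "at_inst \<Rightarrow> (nat \<Rightarrow> nat \<Rightarrow> real) \<Rightarrow> real \<Rightarrow> (nat \<Rightarrow> nat \<Rightarrow> real) \<Rightarrow> bool" where
  "rob_fail S W y X \<longleftrightarrow>
    (\<exists>\<delta>::nat \<Rightarrow> nat \<Rightarrow> real. (\<forall>p<iP S. \<forall>j<idim S. \<bar>\<delta> p j\<bar> \<le> ieps S) \<and>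
        y * f_of S W (\<lambda>p j. X p j + \<delta> p j) < 0)"

definition rob_test_err :: "at_inst \<Rightarrow> (nat \<Rightarrow> nat \<Rightarrow> real) \<Rightarrow> real" where
  "rob_test_err S W =
    (\<Sum>y\<in>{1, -1::real}. \<Sum>s<iP S.
       measure (noise_M (iP S) (idim S) (isign S))
         {G \<in> space (noise_M (iP S) (idim S) (isign S)).
            rob_fail S W y (test_X (ialpha S) (idim S) s y G)}) / (2 * real (iP S))"

end

theory Submission
  imports Defs
begin

text \<open>The cubic activation is odd, so $f_W(X) = \sum_r \sum_p \langle w_r, x_p\rangle^3$ and gradient
  descent splits into scalar recursions: $w' = w + b w^2$ for the signal coordinate of a filter and
  $z' = z + a \psi z^2 + \mbox{cross terms}$ for its correlation with a noise patch.
  Telescoping $1/w$ bounds the sum of $\psi$ over all times after $t$, on the learnable samples, by a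
  constant over $\eta \alpha^3 w(t)$; hence the noise of learnable samples stays within twice $\iota + E$, and the loss
  on them vanishes.  Cross terms are at most a tiny multiple of the self-increments $G$, so that
  $z = z(0) + G$ up to an error $E$ (where $|z(0)| \le \iota$) which is controlled at all times by the total growth itself.
  An unlearnable sample is only driven by its noise: the largest correlation $M$ of one filter
  satisfies $M' \ge M + a M^2 / 16$ until some $G$ reaches $m^{-2/3} / 4$, which the horizon
  enforces, and $G$ never decreases.
  At test time the budget exceeds twice the largest noise coordinate with high probability, so
  an attacker may erase all noise patches and plant a negative multiple of the memorized patch,
  which outweighs the signal $\alpha^3 \sum_r w_r^3 = O(\log)$.\<close>

section \<open>The logistic derivative and quadratic growth\<close>

text \<open>The obstacle is that two noise scales interact. The correlations of unlearnable samples
  may reach order \<open>l\<close>, and their cross terms can push the noise of learnable samples up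
  to order \<open>1/m\<close>, possibly far above its initial scale \<open>\<iota>\<close>. No fixed
  multiple of \<open>\<iota>\<close> survives an induction, so the invariant is stated relative to
  \<open>\<iota> + E\<close>, where \<open>E\<close> itself depends on the quantities being bounded.
  This forces two rate conditions. Before the signal is learned, the sum of \<open>psi\<close> is of
  order \<open>1 / (\<eta> \<alpha>^3 \<sigma>)\<close> and is paid for by
  \<open>a * \<iota>\<close>. Once the attacked margin \<open>\<Phi>\<close> is at least 1, some
  filter satisfies \<open>\<alpha> m w \<ge> 1\<close>, so the remaining sum is at most
  \<open>8 m / (\<eta> \<alpha>^2)\<close>; the increments are quadratic in
  \<open>B = \<iota> + E\<close>, and \<open>m B \<le> 3/100\<close> pays for the factor
  \<open>m\<close>. Upper bounds of order \<open>l\<close> come from barriers: beyond them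
  \<open>psi\<close> is below \<open>1/T\<close>, so all \<open>T\<close> steps together add at most
  1. In the memorization argument the winning patch may change over time. Only the maximum
  \<open>M\<close> is followed, and the inequality \<open>E \<le> M - \<rho>\<close> is carried
  along to keep the cross terms comparable with \<open>M\<close>.\<close>

lemma psi_eq: "psi x = 1 / (1 + exp x)"
  by (simp add: psi_def sigmoid_def)

lemma psi_pos: "psi x > 0"
  by (simp add: psi_eq add_pos_pos)

lemma psi_le_1: "psi x \<le> 1"
  by (simp add: psi_eq add_pos_pos divide_le_eq)

lemma psi_le_exp: "psi x \<le> exp (- x)"
  by (simp add: psi_eq exp_minus field_simps add_pos_pos)

lemma psi_antimono: "x \<le> y \<Longrightarrow> psi y \<le> psi x"
  by (simp add: psi_eq frac_le add_pos_pos)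

text \<open>A margin shift of size at most 1 changes \<open>psi\<close> by at most a factor e,
  rounded up to 3. This strips the sample-dependent noise from the margins of learnable
  samples.\<close>

lemma psi_shift_le:
  assumes "\<bar>u\<bar> \<le> 1"
  shows "psi x \<le> 3 * psi (x + u)"
proof -
  have e3: "exp u \<le> 3"
    using assms exp_le by (meson abs_le_D1 exp_le_cancel_iff order_trans)
  have "1 + exp (x + u) \<le> 3 * (1 + exp x)"
    using mult_left_mono[OF e3 exp_ge_zero[of x]] exp_gt_zero[of x]
    unfolding exp_add by (smt (verit))
  then show ?thesis
    by (simp add: psi_eq field_simps add_pos_pos)
qed

lemma psi_shift_ge:
  assumes "\<bar>u\<bar> \<le> 1"
  shows "psi (x + u) \<le> 3 * psi x"
  using psi_shift_le[of "-u" "x + u"] assms by simp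

lemma psi_ge_quarter:
  assumes "x \<le> 1" shows "psi x \<ge> 1/4"
proof -
  have "exp x \<le> 3"
    using assms exp_le by (meson exp_le_cancel_iff order_trans)
  then show ?thesis by (simp add: psi_eq field_simps add_pos_pos)
qed

lemma logistic_le_psi:
  assumes "psi x \<le> 1/2"
  shows "logistic x \<le> 2 * psi x"
proof -
  have "logistic x \<le> exp (- x)"
    using ln_add_one_self_le_self[of "exp (-x)"] by (simp add: logistic_def)
  also have "\<dots> = psi x * (1 + exp (- x))"
  proof -
    have "1 + exp x \<noteq> 0" using exp_gt_zero[of x] by linarith
    then show ?thesis by (simp add: psi_eq exp_minus field_simps)
  qed
  also have "exp (-x) \<le> 1"
    using assms by (simp add: psi_eq field_simps add_pos_pos)
  then have "psi x * (1 + exp (- x)) \<le> psi x * 2"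
    using psi_pos[of x] by simp
  finally show ?thesis by simp
qed

text \<open>Barrier argument: a step from below \<open>A\<close> overshoots by at most
  \<open>b\<close>, and above \<open>A\<close> each step adds at most \<open>e\<close>. With
  \<open>e = 1/T\<close> the drift over \<open>T\<close> steps is at most 1. The hypothesis
  \<open>small\<close> may use the bound being proved, because the step estimate for the signal
  itself needs an a priori upper bound.\<close>

lemma bounded_growth:
  fixes x :: "nat \<Rightarrow> real"
  assumes x0: "x 0 \<le> A + b" and e0: "e \<ge> 0"
    and big: "\<And>t. t < u \<Longrightarrow> x t \<le> A \<Longrightarrow> x (Suc t) \<le> x t + b"
    and small: "\<And>t. t < u \<Longrightarrow> A \<le> x t \<Longrightarrow> x t \<le> A + b + real t * e \<Longrightarrow> x (Suc t) \<le> x t + e"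
  shows "t \<le> u \<Longrightarrow> x t \<le> A + b + real t * e"
proof (induction t)
  case 0 then show ?case using x0 by simp
next
  case (Suc t)
  then have IH: "x t \<le> A + b + real t * e" and tu: "t < u" by auto
  show ?case
  proof (cases "x t \<le> A")
    case True
    then have "x (Suc t) \<le> A + b" using big[OF tu True] by simp
    also have "\<dots> \<le> A + b + real (Suc t) * e" using e0 by simp
    finally show ?thesis .
  next
    case False
    then show ?thesis using small[OF tu _ IH] IH by (simp add: algebra_simps)
  qed
qed

text \<open>Discrete form of \<open>(1/x)' = -c\<close> for \<open>x' = c x^2\<close>: the exact
  decrease is \<open>c / (1 + c x)\<close>, and \<open>c x \<le> 1\<close> costs a factor 2.\<close>

lemma recip_growth:
  fixes x y c :: real
  assumes "x > 0" "c \<ge> 0" "c * x \<le> 1" "y \<ge> x + c * x\<^sup>2"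
  shows "1 / y + c / 2 \<le> 1 / x"
proof -
  have p: "x + c * x\<^sup>2 > 0" using assms by (simp add: add_pos_nonneg)
  have "1 / y \<le> 1 / (x + c * x\<^sup>2)" using assms p by (intro divide_left_mono) auto
  moreover have "1 / x - 1 / (x + c * x\<^sup>2) = c / (1 + c * x)"
  proof -
    have "1 + c * x > 0" using assms by (simp add: add_pos_nonneg)
    then show ?thesis using assms p by (simp add: field_simps power2_eq_square)
  qed
  moreover have "c / (1 + c * x) \<ge> c / 2" using assms by (intro divide_left_mono) (auto simp: add_pos_nonneg)
  ultimately show ?thesis by linarith
qed

lemma cube_mono: "x \<le> y \<Longrightarrow> x ^ 3 \<le> y ^ 3" for x y :: real
  by (simp add: power_mono_odd)

section \<open>Signal and noise dynamics\<close>

text \<open>Here \<open>w r t\<close> is the signal coordinate of filter \<open>r\<close>, \<open>z r (k, q) t\<close> its correlation with noise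
  patch \<open>q\<close> of sample \<open>k\<close> times the label, \<open>g k t\<close> the perturbed signal strength and \<open>F k t\<close> the
  adversarial margin.  The logarithm is \<open>l\<close>; \<open>\<iota>\<close> and \<open>\<omega>\<close> bound the initial \<open>z\<close> and \<open>w\<close>, while \<open>\<rho>\<close>
  bounds the largest initial \<open>z\<close> from below.  The Gram matrix \<open>K\<close> is normalized by
  $\sigma_n^2 d$, so that \<open>a\<close> $= 3 \eta \sigma_n^2 d / N$.\<close>

locale at_dynamics =
  fixes N m P T :: nat and l \<alpha> \<epsilon> \<eta> \<sigma> a \<theta> \<iota> \<rho> \<omega> :: real
    and SL SU :: "nat set" and Q :: "nat \<Rightarrow> nat set"
    and K :: "nat \<times> nat \<Rightarrow> nat \<times> nat \<Rightarrow> real"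
    and w :: "nat \<Rightarrow> nat \<Rightarrow> real" and z :: "nat \<Rightarrow> nat \<times> nat \<Rightarrow> nat \<Rightarrow> real"
    and g F :: "nat \<Rightarrow> nat \<Rightarrow> real"
  assumes N_pos: "N > 0" and m_pos: "m > 0" and P_le: "P \<le> 2 * m" and T_pos: "T > 0"
    and l_ge: "l \<ge> 10" and exp_l: "exp l \<ge> real T"
    and \<alpha>_pos: "\<alpha> > 0" and \<epsilon>_nonneg: "\<epsilon> \<ge> 0" and \<epsilon>_le: "\<epsilon> \<le> \<alpha> / 100"
    and \<eta>_pos: "\<eta> > 0" and \<sigma>_pos: "\<sigma> > 0"
    and a_pos: "a > 0" and a_le: "a * l \<le> 1 / 100"
    and \<theta>_nonneg: "\<theta> \<ge> 0" and \<theta>_le: "\<theta> * (real N * real P) * l \<le> 1 / (100 * real m)"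
    and m_ge: "m \<ge> 1000"
    and \<iota>_pos: "\<iota> > 0" and \<iota>_le: "\<iota> \<le> 1 / (100 * real m)"
    and \<rho>_pos: "\<rho> > 0" and \<iota>_\<rho>: "\<iota>\<^sup>2 \<le> 128 * l * \<rho>\<^sup>2"
    and stage1_rate: "a * \<iota> * 10 ^ 6 \<le> \<eta> * \<alpha> ^ 3 * \<sigma>"
    and stage2_rate: "a * 10 ^ 6 \<le> \<eta> * \<alpha>\<^sup>2"
    and step_le: "\<eta> * \<alpha>\<^sup>2 * l * 10 ^ 6 \<le> 1"
    and \<omega>_nonneg: "\<omega> \<ge> 0" and \<omega>_le: "real m * (\<alpha> * \<omega>) ^ 3 \<le> 1 / 100"
    and horizon_noise: "real T * a * \<rho> > 32"
    and horizon_signal: "real T * (\<eta> * \<alpha> ^ 3 * \<sigma>) \<ge> 1000 * l"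
    and split: "SL \<union> SU = {..<N}" "SL \<inter> SU = {}" "real (card SL) \<ge> real N / 2"
    and Q_sub: "\<And>k. k < N \<Longrightarrow> Q k \<subseteq> {..<P}"
    and w_init: "\<And>r. r < m \<Longrightarrow> \<bar>w r 0\<bar> \<le> \<omega>"
    and w_init_ex: "\<exists>r<m. w r 0 \<ge> \<sigma> / 2"
    and z_init: "\<And>r k q. r < m \<Longrightarrow> k < N \<Longrightarrow> q \<in> Q k \<Longrightarrow> \<bar>z r (k, q) 0\<bar> \<le> \<iota>"
    and z_init_ex: "\<exists>r<m. \<exists>k\<in>SU. \<exists>q\<in>Q k. z r (k, q) 0 \<ge> \<rho>"
    and g_bounds: "\<And>k t. k \<in> SL \<Longrightarrow> \<alpha> - \<epsilon> \<le> g k t \<and> g k t \<le> \<alpha> + \<epsilon>"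
    and g_min: "\<And>k t. k \<in> SL \<Longrightarrow> g k t ^ 3 * (\<Sum>r<m. w r t ^ 3)
          = min ((\<alpha> - \<epsilon>) ^ 3 * (\<Sum>r<m. w r t ^ 3)) ((\<alpha> + \<epsilon>) ^ 3 * (\<Sum>r<m. w r t ^ 3))"
    and F_SL: "\<And>k t. k \<in> SL \<Longrightarrow>
          F k t = g k t ^ 3 * (\<Sum>r<m. w r t ^ 3) + (\<Sum>r<m. \<Sum>q\<in>Q k. z r (k, q) t ^ 3)"
    and F_SU: "\<And>k t. k \<in> SU \<Longrightarrow> F k t = (\<Sum>r<m. \<Sum>q\<in>Q k. z r (k, q) t ^ 3)"
    and w_step: "\<And>r t. r < m \<Longrightarrow>
          w r (Suc t) = w r t + 3 * \<eta> / real N * (\<Sum>k\<in>SL. psi (F k t) * g k t ^ 3) * (w r t)\<^sup>2"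
    and K_diag: "\<And>k q. k < N \<Longrightarrow> q \<in> Q k \<Longrightarrow> 1 / 2 \<le> K (k, q) (k, q) \<and> K (k, q) (k, q) \<le> 3 / 2"
    and K_off: "\<And>k q k' q'. k < N \<Longrightarrow> q \<in> Q k \<Longrightarrow> k' < N \<Longrightarrow> q' \<in> Q k' \<Longrightarrow> (k, q) \<noteq> (k', q') \<Longrightarrow>
          \<bar>K (k, q) (k', q')\<bar> \<le> \<theta> / 2"
    and z_step: "\<And>r k q t. r < m \<Longrightarrow> k < N \<Longrightarrow> q \<in> Q k \<Longrightarrow>
          z r (k, q) (Suc t) = z r (k, q) t
            + a * (\<Sum>j\<in>Sigma {..<N} Q. K (k, q) j * psi (F (fst j) t) * (z r j t)\<^sup>2)"
begin

section \<open>Self-increments and the cross-term error\<close>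

definition "J = Sigma {..<N} Q"
definition "S t = (\<Sum>r<m. w r t ^ 3)"
text \<open>The attacked signal margin: the adversary weakens the signal if \<open>S t\<close> is
  positive and strengthens it if \<open>S t\<close> is negative. It is common to all learnable
  samples, which is why a single \<open>p\<close> suffices.\<close>

definition "\<Phi> t = min ((\<alpha> - \<epsilon>) ^ 3 * S t) ((\<alpha> + \<epsilon>) ^ 3 * S t)"
definition "p t = psi (\<Phi> t)"
definition "b t = 3 * \<eta> / real N * (\<Sum>k\<in>SL. psi (F k t) * g k t ^ 3)"
definition "noise k t = (\<Sum>r<m. \<Sum>q\<in>Q k. z r (k, q) t ^ 3)"
definition "dG r j t = a * K j j * psi (F (fst j) t) * (z r j t)\<^sup>2"
definition "G r j t = (\<Sum>s<t. dG r j s)"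
text \<open>Independent of the patch, so that one quantity per filter dominates the error of all its
  patches at once.\<close>

definition "E r t = \<theta> * (\<Sum>j\<in>J. G r j t)"

lemma finQ: "k < N \<Longrightarrow> finite (Q k)"
  using Q_sub finite_subset by blast

lemma cardQ: "k < N \<Longrightarrow> card (Q k) \<le> P"
  using card_mono[OF _ Q_sub] by fastforce

lemma finJ: "finite J"
  unfolding J_def using finQ by auto

lemma cardJ: "real (card J) \<le> real N * real P"
proof -
  have "card J \<le> card ({..<N} \<times> {..<P})"
    unfolding J_def using Q_sub by (intro card_mono) auto
  then show ?thesis by (simp flip: of_nat_mult)
qed

lemma SL_lt: "k \<in> SL \<Longrightarrow> k < N" and SU_lt: "k \<in> SU \<Longrightarrow> k < N"
  using split by auto

lemma dG_le: "j \<in> J \<Longrightarrow> dG r j t \<le> 3 / 2 * a * psi (F (fst j) t) * (z r j t)\<^sup>2"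
  and dG_ge: "j \<in> J \<Longrightarrow> dG r j t \<ge> 1 / 2 * a * psi (F (fst j) t) * (z r j t)\<^sup>2"
proof -
  assume "j \<in> J"
  then have K: "1 / 2 \<le> K j j" "K j j \<le> 3 / 2" using K_diag unfolding J_def by auto
  define c where "c = a * psi (F (fst j) t) * (z r j t)\<^sup>2"
  have c: "c \<ge> 0" using a_pos psi_pos[of "F (fst j) t"] by (simp add: c_def)
  have "dG r j t = K j j * c" by (simp add: dG_def c_def)
  then show "dG r j t \<le> 3 / 2 * a * psi (F (fst j) t) * (z r j t)\<^sup>2"
    and "dG r j t \<ge> 1 / 2 * a * psi (F (fst j) t) * (z r j t)\<^sup>2"
    using mult_right_mono[OF K(1) c] mult_right_mono[OF K(2) c] by (simp_all add: c_def)
qed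

lemma dG_nonneg: "j \<in> J \<Longrightarrow> dG r j t \<ge> 0"
  using a_pos psi_pos[of "F (fst j) t"] by (intro order_trans[OF _ dG_ge]) auto

lemma G_nonneg: "j \<in> J \<Longrightarrow> G r j t \<ge> 0"
  unfolding G_def by (intro sum_nonneg dG_nonneg)

lemma G_Suc: "G r j (Suc t) = G r j t + dG r j t"
  by (simp add: G_def)

lemma G_0: "G r j 0 = 0"
  by (simp add: G_def)

lemma E_Suc: "E r (Suc t) = E r t + \<theta> * (\<Sum>j\<in>J. dG r j t)"
  by (simp add: E_def G_Suc sum.distrib algebra_simps)

lemma E_nonneg: "E r t \<ge> 0"
  unfolding E_def using \<theta>_nonneg G_nonneg by (intro mult_nonneg_nonneg sum_nonneg) auto

lemma E_0: "E r 0 = 0"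
  by (simp add: E_def G_0)

lemma E_Suc_ge: "E r t \<le> E r (Suc t)"
  unfolding E_Suc using \<theta>_nonneg dG_nonneg by (simp add: sum_nonneg)

lemma E_mono: "s \<le> t \<Longrightarrow> E r s \<le> E r t"
  using E_Suc_ge by (rule lift_Suc_mono_le)

lemma G_mono: "j \<in> J \<Longrightarrow> s \<le> t \<Longrightarrow> G r j s \<le> G r j t"
  by (rule lift_Suc_mono_le) (auto simp: G_Suc dG_nonneg)

lemma tau_le: "\<theta> * (real N * real P) \<le> 1 / (100 * real m * l)"
  using \<theta>_le l_ge m_pos by (simp add: field_simps)

lemma E_le:
  assumes "\<And>j. j \<in> J \<Longrightarrow> G r j t \<le> x" "x \<ge> 0"
  shows "E r t \<le> \<theta> * (real N * real P) * x"
proof -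
  have "(\<Sum>j\<in>J. G r j t) \<le> real (card J) * x"
    using sum_bounded_above[of J "\<lambda>j. G r j t" x] assms by simp
  also have "\<dots> \<le> real N * real P * x"
    using cardJ assms by (intro mult_right_mono) auto
  finally show ?thesis unfolding E_def using \<theta>_nonneg
    by (simp add: mult_left_mono mult.assoc)
qed

text \<open>Off-diagonal entries of \<open>K\<close> are at most \<open>\<theta> / 2\<close> and
  diagonal ones at least 1/2, so each cross term is at most \<open>\<theta>\<close> times the
  self-increment of the patch that causes it.\<close>

lemma z_increment:
  assumes "r < m" "j \<in> J"
  shows "\<bar>z r j (Suc t) - z r j t - dG r j t\<bar> \<le> \<theta> * (\<Sum>j\<in>J. dG r j t)"
proof -
  obtain k q where j: "j = (k, q)" "k < N" "q \<in> Q k"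
    using assms(2) unfolding J_def by auto
  let ?h = "\<lambda>j'. K j j' * psi (F (fst j') t) * (z r j' t)\<^sup>2"
  have "z r j (Suc t) - z r j t = a * (\<Sum>j'\<in>J. ?h j')"
    using z_step[OF assms(1) j(2,3)] by (simp add: j(1) J_def)
  also have "(\<Sum>j'\<in>J. ?h j') = ?h j + (\<Sum>j'\<in>J - {j}. ?h j')"
    by (rule sum.remove[OF finJ assms(2)])
  finally have "z r j (Suc t) - z r j t - dG r j t = a * (\<Sum>j'\<in>J - {j}. ?h j')"
    by (simp add: dG_def algebra_simps)
  also have "\<bar>\<dots>\<bar> \<le> a * (\<Sum>j'\<in>J - {j}. \<bar>?h j'\<bar>)"
    using a_pos sum_abs[of ?h "J - {j}"] unfolding abs_mult by (simp add: mult_left_mono)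
  also have "\<dots> \<le> a * (\<Sum>j'\<in>J - {j}. \<theta> / 2 * psi (F (fst j') t) * (z r j' t)\<^sup>2)"
  proof (intro mult_left_mono sum_mono)
    fix j' assume j': "j' \<in> J - {j}"
    then have "\<bar>K j j'\<bar> \<le> \<theta> / 2"
      using K_off[OF j(2,3)] unfolding J_def j(1) by auto
    then show "\<bar>?h j'\<bar> \<le> \<theta> / 2 * psi (F (fst j') t) * (z r j' t)\<^sup>2"
      using psi_pos[of "F (fst j') t"] mult_right_mono[of "\<bar>K j j'\<bar>" "\<theta> / 2" "psi (F (fst j') t) * (z r j' t)\<^sup>2"]
      by (simp add: abs_mult mult.assoc)
  qed (use a_pos in auto)
  also have "\<dots> = \<theta> * (\<Sum>j'\<in>J - {j}. 1 / 2 * a * psi (F (fst j') t) * (z r j' t)\<^sup>2)"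
    by (simp add: sum_distrib_left mult_ac)
  also have "\<dots> \<le> \<theta> * (\<Sum>j'\<in>J - {j}. dG r j' t)"
    using \<theta>_nonneg dG_ge by (intro mult_left_mono sum_mono) auto
  also have "\<dots> \<le> \<theta> * (\<Sum>j\<in>J. dG r j t)"
    using \<theta>_nonneg dG_nonneg finJ by (intro mult_left_mono sum_mono2) auto
  finally show ?thesis .
qed

lemma z_approx:
  assumes "r < m" "j \<in> J"
  shows "\<bar>z r j t - z r j 0 - G r j t\<bar> \<le> E r t"
proof (induction t)
  case 0 then show ?case by (simp add: G_0 E_0)
next
  case (Suc t)
  then show ?case using z_increment[OF assms, of t] by (simp add: G_Suc E_Suc)
qed

lemma z_init': "r < m \<Longrightarrow> j \<in> J \<Longrightarrow> \<bar>z r j 0\<bar> \<le> \<iota>"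
  using z_init unfolding J_def by auto

lemma z_lower: "r < m \<Longrightarrow> j \<in> J \<Longrightarrow> z r j t \<ge> G r j t - (\<iota> + E r t)"
  using z_approx[of r j t] z_init'[of r j] by linarith

lemma z_upper: "r < m \<Longrightarrow> j \<in> J \<Longrightarrow> \<bar>z r j t\<bar> \<le> G r j t + \<iota> + E r t"
  using z_approx[of r j t] z_init'[of r j] G_nonneg[of j r t] by linarith

lemma z_lower': "r < m \<Longrightarrow> j \<in> J \<Longrightarrow> z r j t \<ge> - (\<iota> + E r t)"
  using z_lower[of r j t] G_nonneg[of j r t] by linarith

text \<open>The time scale $64 / (\eta \alpha^3 \sigma_0)$ of signal learning is too short for any noise
  correlation to leave its initial scale.\<close>

lemma stage1:
  assumes "r < m" "real t * (\<eta> * \<alpha> ^ 3 * \<sigma>) \<le> 64"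
  shows "j \<in> J \<Longrightarrow> G r j t \<le> \<iota>" and "E r t \<le> \<iota>"
proof -
  have tau1: "\<theta> * (real N * real P) \<le> 1"
  proof -
    have "1 * 10 \<le> (100 * real m) * l" using l_ge m_pos by (intro mult_mono) linarith+
    then have "1 \<le> 100 * real m * l" by linarith
    then have "1 / (100 * real m * l) \<le> 1" by (metis divide_le_eq_1_pos less_le_trans zero_less_one)
    then show ?thesis using tau_le by linarith
  qed
  have Ef: "E r s \<le> \<iota>" if "\<forall>j\<in>J. G r j s \<le> \<iota>" for s
  proof -
    have "E r s \<le> \<theta> * (real N * real P) * \<iota>" using that \<iota>_pos by (intro E_le) auto
    also have "\<dots> \<le> 1 * \<iota>" using \<iota>_pos by (intro mult_right_mono tau1) auto
    finally show ?thesis by simp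
  qed
  have main: "\<forall>j\<in>J. G r j s \<le> \<iota>" if "s \<le> t" for s
    using that
  proof (induction s rule: less_induct)
    case (less s)
    show ?case
    proof
      fix j assume j: "j \<in> J"
      \<comment> \<open>At the earlier time \<open>u\<close> each of \<open>G\<close>,
        \<open>\<iota>\<close> and \<open>E\<close> contributes at most \<open>\<iota>\<close> to
        the correlation; 27/2 is \<open>3/2 * 3^2\<close>. The induction is strong because
        \<open>G\<close> sums over all earlier times.\<close>
      have "dG r j u \<le> 27 / 2 * a * \<iota>\<^sup>2" if "u < s" for u
      proof -
        have Gu: "\<forall>j\<in>J. G r j u \<le> \<iota>" using less that by auto
        then have "\<bar>z r j u\<bar> \<le> 3 * \<iota>"
          using z_upper[OF assms(1) j, of u] Ef[OF Gu] j by force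
        then have z2: "(z r j u)\<^sup>2 \<le> (3 * \<iota>)\<^sup>2" by (metis abs_ge_zero power2_abs power_mono)
        have "dG r j u \<le> 3 / 2 * a * psi (F (fst j) u) * (z r j u)\<^sup>2" by (rule dG_le[OF j])
        also have "\<dots> \<le> 3 / 2 * a * 1 * (3 * \<iota>)\<^sup>2"
          using a_pos psi_pos[of "F (fst j) u"] psi_le_1 z2 by (intro mult_mono) auto
        finally show ?thesis by (simp add: power2_eq_square)
      qed
      then have "G r j s \<le> real s * (27 / 2 * a * \<iota>\<^sup>2)"
        unfolding G_def using sum_bounded_above[of "{..<s}" "dG r j" "27 / 2 * a * \<iota>\<^sup>2"] by simp
      also have "\<dots> \<le> real t * (27 / 2 * a * \<iota>\<^sup>2)"
        using less.prems a_pos by (intro mult_right_mono) auto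
      also have "\<dots> = 27 / 2 * \<iota> * (real t * (a * \<iota>))" by (simp add: power2_eq_square)
      also have "\<dots> \<le> 27 / 2 * \<iota> * (real t * (\<eta> * \<alpha> ^ 3 * \<sigma> / 10 ^ 6))"
        using stage1_rate \<iota>_pos by (intro mult_left_mono) auto
      also have "\<dots> = 27 / 2 * \<iota> * (real t * (\<eta> * \<alpha> ^ 3 * \<sigma>) / 10 ^ 6)" by simp
      also have "\<dots> \<le> 27 / 2 * \<iota> * (64 / 10 ^ 6)"
        using \<iota>_pos by (intro mult_left_mono divide_right_mono assms(2)) auto
      also have "\<dots> \<le> \<iota>" using \<iota>_pos by simp
      finally show "G r j s \<le> \<iota>" .
    qed
  qed
  show "j \<in> J \<Longrightarrow> G r j t \<le> \<iota>" using main[of t] by auto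
  show "E r t \<le> \<iota>" using Ef main[of t] by auto
qed

section \<open>Growth of the signal\<close>

definition "ok t \<longleftrightarrow> (\<forall>k\<in>SL. \<bar>noise k t\<bar> \<le> 1)"

lemma \<alpha>\<epsilon>: "\<alpha> - \<epsilon> \<ge> 99 / 100 * \<alpha>" "\<alpha> + \<epsilon> \<le> 101 / 100 * \<alpha>" "\<alpha> - \<epsilon> > 0"
  using \<epsilon>_le \<epsilon>_nonneg \<alpha>_pos by auto

lemma cube_factor:
  assumes "\<alpha> - \<epsilon> \<le> x" "x \<le> \<alpha> + \<epsilon>"
  shows "\<alpha> ^ 3 / 2 \<le> x ^ 3" "x ^ 3 \<le> 2 * \<alpha> ^ 3"
proof -
  have "(99 / 100 * \<alpha>) ^ 3 \<le> x ^ 3" "x ^ 3 \<le> (101 / 100 * \<alpha>) ^ 3"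
    using assms \<alpha>\<epsilon> by (intro cube_mono; linarith)+
  moreover have "\<alpha> ^ 3 > 0" using \<alpha>_pos by simp
  ultimately show "\<alpha> ^ 3 / 2 \<le> x ^ 3" "x ^ 3 \<le> 2 * \<alpha> ^ 3"
    unfolding power_mult_distrib by (auto simp: power3_eq_cube)
qed

lemma g_cube: "k \<in> SL \<Longrightarrow> \<alpha> ^ 3 / 2 \<le> g k t ^ 3 \<and> g k t ^ 3 \<le> 2 * \<alpha> ^ 3"
  using cube_factor g_bounds by blast

lemma g_cube_pos: "k \<in> SL \<Longrightarrow> g k t ^ 3 > 0"
  using g_cube[of k t] \<alpha>_pos by (smt (verit) half_gt_zero zero_less_power)

lemma b_nonneg: "b t \<ge> 0"
  unfolding b_def using \<eta>_pos psi_pos g_cube_pos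
  by (intro mult_nonneg_nonneg sum_nonneg) (auto simp: less_imp_le)

lemma w_Suc: "r < m \<Longrightarrow> w r (Suc t) = w r t + b t * (w r t)\<^sup>2"
  using w_step[of r t] by (simp add: b_def)

lemma w_mono: "r < m \<Longrightarrow> s \<le> t \<Longrightarrow> w r s \<le> w r t"
  by (rule lift_Suc_mono_le) (auto simp: w_Suc b_nonneg)

lemma w_ge: "r < m \<Longrightarrow> w r t \<ge> - \<omega>"
  using w_mono[of r 0 t] w_init[of r] by force

lemma S_mono: "s \<le> t \<Longrightarrow> S s \<le> S t"
  unfolding S_def by (intro sum_mono cube_mono w_mono) auto

lemma \<Phi>_mono: "s \<le> t \<Longrightarrow> \<Phi> s \<le> \<Phi> t"
  unfolding \<Phi>_def using S_mono[of s t] \<alpha>\<epsilon>(3) \<alpha>_pos \<epsilon>_nonneg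
  by (intro min.mono mult_left_mono) auto

lemma p_antimono: "s \<le> t \<Longrightarrow> p t \<le> p s"
  unfolding p_def by (intro psi_antimono \<Phi>_mono)

lemma p_pos: "p t > 0" and p_le_1: "p t \<le> 1"
  by (simp_all add: p_def psi_pos psi_le_1)

lemma F_SL': "k \<in> SL \<Longrightarrow> F k t = \<Phi> t + noise k t"
  using F_SL[of k t] g_min[of k t] by (simp add: \<Phi>_def S_def noise_def)

lemma F_SU': "k \<in> SU \<Longrightarrow> F k t = noise k t"
  using F_SU by (simp add: noise_def)

text \<open>Margins of learnable samples are \<open>\<Phi>\<close> plus noise, so as long as
  \<open>ok\<close> holds the single number \<open>p t\<close> replaces all their loss derivatives
  up to a factor 3.\<close>

lemma psi_SL:
  assumes "ok t" "k \<in> SL"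
  shows "p t / 3 \<le> psi (F k t)" "psi (F k t) \<le> 3 * p t"
  using assms psi_shift_le[of "noise k t" "\<Phi> t"] psi_shift_ge[of "noise k t" "\<Phi> t"]
  by (auto simp: F_SL' p_def ok_def)

text \<open>The constants are \<open>3 * 1/2 * 1/3 * 1/2\<close> (at least half of the samples are
  learnable) and \<open>3 * 3 * 2\<close>, from \<open>psi_SL\<close> and
  \<open>g_cube\<close>.\<close>

lemma b_bounds:
  assumes "ok t"
  shows "\<eta> * \<alpha> ^ 3 * p t / 4 \<le> b t" "b t \<le> 18 * (\<eta> * \<alpha> ^ 3 * p t)"
proof -
  let ?s = "\<Sum>k\<in>SL. psi (F k t) * g k t ^ 3"
  have a3: "\<alpha> ^ 3 > 0" using \<alpha>_pos by simp
  have "?s \<ge> real (card SL) * (p t / 3 * (\<alpha> ^ 3 / 2))"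
    using psi_SL(1)[OF assms] g_cube p_pos[of t] a3
    by (intro sum_bounded_below mult_mono) (auto intro: psi_pos less_imp_le)
  moreover have "real (card SL) * (p t / 3 * (\<alpha> ^ 3 / 2)) \<ge> real N / 2 * (p t / 3 * (\<alpha> ^ 3 / 2))"
    using split(3) p_pos[of t] a3 by (intro mult_right_mono) auto
  ultimately have "?s \<ge> real N / 2 * (p t / 3 * (\<alpha> ^ 3 / 2))" by linarith
  then have "3 * \<eta> / real N * ?s \<ge> 3 * \<eta> / real N * (real N / 2 * (p t / 3 * (\<alpha> ^ 3 / 2)))"
    using \<eta>_pos by (intro mult_left_mono) auto
  then show "\<eta> * \<alpha> ^ 3 * p t / 4 \<le> b t"
    unfolding b_def using N_pos by (simp add: field_simps)
  have "?s \<le> real (card SL) * (3 * p t * (2 * \<alpha> ^ 3))"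
    using psi_SL(2)[OF assms] g_cube p_pos[of t] a3 g_cube_pos psi_pos
    by (intro sum_bounded_above mult_mono) (auto intro: less_imp_le)
  moreover have "card SL \<le> N" using split(1) card_mono[of "{..<N}" SL] by auto
  then have "real (card SL) * (3 * p t * (2 * \<alpha> ^ 3)) \<le> real N * (3 * p t * (2 * \<alpha> ^ 3))"
    using p_pos[of t] a3 by (intro mult_right_mono) auto
  ultimately have "?s \<le> real N * (3 * p t * (2 * \<alpha> ^ 3))" by linarith
  then have "3 * \<eta> / real N * ?s \<le> 3 * \<eta> / real N * (real N * (3 * p t * (2 * \<alpha> ^ 3)))"
    using \<eta>_pos by (intro mult_left_mono) auto
  then show "b t \<le> 18 * (\<eta> * \<alpha> ^ 3 * p t)"
    unfolding b_def using N_pos by (simp add: field_simps)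
qed

lemma m\<omega>: "\<alpha> ^ 3 * (real m * \<omega> ^ 3) \<le> 1 / 100"
  using \<omega>_le by (simp add: power_mult_distrib mult_ac)

lemma \<alpha>\<omega>: "\<alpha> * \<omega> \<le> 1"
proof (rule ccontr)
  assume "\<not> \<alpha> * \<omega> \<le> 1"
  then have "(\<alpha> * \<omega>) ^ 3 \<ge> 1 ^ 3" by (intro power_mono) auto
  then have "real m * (\<alpha> * \<omega>) ^ 3 \<ge> 1000 * 1" using m_ge by (intro mult_mono) auto
  then show False using \<omega>_le by linarith
qed

text \<open>Filters never decrease, so each one can pull the sum down by at most
  \<open>\<omega>^3\<close>; one large filter therefore forces a large \<open>S\<close>.\<close>

lemma S_lower: "r < m \<Longrightarrow> S t \<ge> w r t ^ 3 - real m * \<omega> ^ 3"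
proof -
  assume r: "r < m"
  have nn: "0 \<le> w r' t ^ 3 + \<omega> ^ 3" if "r' < m" for r'
    using cube_mono[OF w_ge[OF that, of t]] by simp
  have "w r t ^ 3 + \<omega> ^ 3 \<le> (\<Sum>r<m. w r t ^ 3 + \<omega> ^ 3)"
    using nn r by (intro member_le_sum) auto
  then show ?thesis using \<omega>_nonneg by (simp add: sum.distrib S_def) (smt (verit) zero_le_power)
qed

lemma \<Phi>_nonneg_eq: "S t \<ge> 0 \<Longrightarrow> \<Phi> t = (\<alpha> - \<epsilon>) ^ 3 * S t"
proof -
  assume "S t \<ge> 0"
  moreover have "(\<alpha> - \<epsilon>) ^ 3 \<le> (\<alpha> + \<epsilon>) ^ 3"
    using \<epsilon>_nonneg by (intro cube_mono) auto
  ultimately show ?thesis unfolding \<Phi>_def by (simp add: min_def mult_right_mono)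
qed

text \<open>A large filter makes \<open>\<Phi>\<close> large and hence \<open>p\<close> small, so
  the product stays bounded for all times without any upper bound on \<open>w\<close>. It keeps the
  relative step \<open>b * w\<close> below 1, as \<open>recip_growth\<close> requires.\<close>

lemma \<alpha>wp: "r < m \<Longrightarrow> \<alpha> * \<bar>w r t\<bar> * p t \<le> 1"
proof -
  assume r: "r < m"
  define x where "x = \<alpha> * w r t"
  have a3: "\<alpha> ^ 3 > 0" using \<alpha>_pos by simp
  have x3: "x ^ 3 \<le> \<alpha> ^ 3 * S t + 1 / 100"
    using mult_left_mono[OF S_lower[OF r, of t], of "\<alpha> ^ 3"] m\<omega> a3
    by (simp add: x_def power_mult_distrib algebra_simps)
  consider "w r t \<le> 0" | "w r t > 0" "S t < 0" | "w r t > 0" "S t \<ge> 0" by linarith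
  then have "\<alpha> * \<bar>w r t\<bar> \<le> 1 \<or> \<bar>x\<bar> * p t \<le> 1"
  proof cases
    case 1
    then have "\<alpha> * \<bar>w r t\<bar> \<le> \<alpha> * \<omega>" using w_ge[OF r, of t] \<alpha>_pos by (intro mult_left_mono) auto
    then show ?thesis using \<alpha>\<omega> by linarith
  next
    case 2
    then have "x ^ 3 \<le> 1" using x3 a3 mult_pos_neg[OF a3, of "S t"] by linarith
    then have "x \<le> 1" by (metis linorder_not_le one_less_power zero_less_numeral)
    then show ?thesis using 2 by (simp add: x_def)
  next
    case 3
    have x0: "x > 0" using 3 \<alpha>_pos by (simp add: x_def)
    have "\<Phi> t = (\<alpha> - \<epsilon>) ^ 3 * S t" by (rule \<Phi>_nonneg_eq[OF 3(2)])
    moreover have "(\<alpha> - \<epsilon>) ^ 3 \<ge> \<alpha> ^ 3 / 2" using cube_factor(1)[of "\<alpha> - \<epsilon>"] \<epsilon>_nonneg by simp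
    then have "\<alpha> ^ 3 / 2 * S t \<le> (\<alpha> - \<epsilon>) ^ 3 * S t" using 3(2) by (rule mult_right_mono)
    ultimately have "\<Phi> t \<ge> \<alpha> ^ 3 / 2 * S t" by linarith
    then have phi: "\<Phi> t \<ge> x ^ 3 / 2 - 1 / 100" using x3 by linarith
    \<comment> \<open>The tangent of the cube at 1: \<open>x^3 \<ge> 3 x - 2\<close> makes the lower
      bound on \<open>\<Phi>\<close> linear, to be compared with
      \<open>exp \<Phi> \<ge> 1 + \<Phi>\<close>.\<close>
    have "(x - 1)\<^sup>2 * (x + 2) \<ge> 0" using x0 by simp
    also have "(x - 1)\<^sup>2 * (x + 2) = x ^ 3 - 3 * x + 2"
      by (simp add: power2_eq_square power3_eq_cube algebra_simps)
    finally have "x \<le> 1 + exp (\<Phi> t)" using phi exp_ge_add_one_self[of "\<Phi> t"] x0 by linarith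
    then have "x * p t \<le> 1" unfolding p_def psi_eq by (simp add: divide_le_eq add_pos_pos)
    then show ?thesis using x0 by simp
  qed
  then show ?thesis
  proof
    assume "\<alpha> * \<bar>w r t\<bar> \<le> 1"
    then have "\<alpha> * \<bar>w r t\<bar> * p t \<le> 1 * 1"
      using p_pos[of t] p_le_1[of t] \<alpha>_pos by (intro mult_mono) auto
    then show ?thesis by simp
  next
    assume "\<bar>x\<bar> * p t \<le> 1"
    then show ?thesis using \<alpha>_pos by (simp add: x_def abs_mult)
  qed
qed

lemma \<eta>\<alpha>2: "\<eta> * \<alpha>\<^sup>2 \<le> 1 / 100"
proof -
  have "\<eta> * \<alpha>\<^sup>2 * 10 \<le> \<eta> * \<alpha>\<^sup>2 * l" using \<eta>_pos \<alpha>_pos l_ge by (intro mult_left_mono) auto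
  then show ?thesis using step_le by simp
qed

lemma bw:
  assumes "ok t" "r < m"
  shows "b t * \<bar>w r t\<bar> \<le> 1"
proof -
  have "b t * \<bar>w r t\<bar> \<le> 18 * (\<eta> * \<alpha> ^ 3 * p t) * \<bar>w r t\<bar>"
    using b_bounds(2)[OF assms(1)] by (intro mult_right_mono) auto
  also have "\<dots> = 18 * (\<eta> * \<alpha>\<^sup>2) * (\<alpha> * \<bar>w r t\<bar> * p t)"
    by (simp add: power2_eq_square power3_eq_cube)
  also have "\<dots> \<le> 18 * (\<eta> * \<alpha>\<^sup>2) * 1"
    using \<alpha>wp[OF assms(2)] \<eta>_pos by (intro mult_left_mono) auto
  also have "\<dots> \<le> 1" using \<eta>\<alpha>2 by linarith
  finally show ?thesis .
qed

text \<open>The starting time \<open>s\<close> is free so that the estimate can be used twice: from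
  time 0 with \<open>w \<ge> \<sigma> / 2\<close>, and again from the time when some filter has
  reached \<open>1 / (\<alpha> m)\<close>. It assumes \<open>ok\<close> only before
  \<open>u\<close>, since it is called inside the induction that establishes
  \<open>ok\<close>.\<close>

lemma sig_sum:
  assumes "r < m" "s \<le> u" "w r s > 0" "\<And>t. s \<le> t \<Longrightarrow> t < u \<Longrightarrow> ok t"
  shows "\<eta> * \<alpha> ^ 3 * (\<Sum>t\<in>{s..<u}. p t) \<le> 8 / w r s"
proof -
  have "\<eta> * \<alpha> ^ 3 / 8 * (\<Sum>t\<in>{s..<u}. p t) + 1 / w r u \<le> 1 / w r s"
    using assms(2,4)
  proof (induction u rule: dec_induct)
    case base then show ?case by simp
  next
    case (step n)
    have okn: "ok n" using step by auto
    have wn: "w r n > 0" using w_mono[OF assms(1) step(1)] assms(3) by simp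
    let ?c = "\<eta> * \<alpha> ^ 3 * p n / 4"
    have c: "?c \<le> b n" "?c \<ge> 0" using b_bounds[OF okn] \<eta>_pos \<alpha>_pos p_pos[of n] by auto
    have "1 / w r (Suc n) + ?c / 2 \<le> 1 / w r n"
    proof (rule recip_growth[OF wn c(2)])
      show "?c * w r n \<le> 1" using mult_right_mono[OF c(1) less_imp_le[OF wn]] bw[OF okn assms(1)]
        unfolding abs_of_pos[OF wn] by linarith
      show "w r n + ?c * (w r n)\<^sup>2 \<le> w r (Suc n)"
        unfolding w_Suc[OF assms(1)] by (intro add_left_mono mult_right_mono c(1)) auto
    qed
    then show ?case using step by (simp add: algebra_simps)
  qed
  moreover have "w r u > 0" using w_mono[OF assms(1,2)] assms(3) by simp
  then have "1 / w r u > 0" by simp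
  ultimately have "\<eta> * \<alpha> ^ 3 / 8 * (\<Sum>t\<in>{s..<u}. p t) \<le> 1 / w r s" by linarith
  then show ?thesis by (simp add: field_simps)
qed

lemma sig_sum0:
  assumes "\<And>t. t < u \<Longrightarrow> ok t"
  shows "(\<eta> * \<alpha> ^ 3 * \<sigma>) * (\<Sum>t<u. p t) \<le> 16"
proof -
  obtain r where r: "r < m" "w r 0 \<ge> \<sigma> / 2" using w_init_ex by auto
  have "\<eta> * \<alpha> ^ 3 * (\<Sum>t\<in>{0..<u}. p t) \<le> 8 / w r 0"
    using r assms \<sigma>_pos by (intro sig_sum) auto
  also have "\<dots> \<le> 8 / (\<sigma> / 2)" using r \<sigma>_pos by (intro divide_left_mono) auto
  finally show ?thesis using \<sigma>_pos by (simp add: field_simps atLeast0LessThan)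
qed

text \<open>\<open>\<Phi>\<close> is monotone, so \<open>\<Phi> u < 1\<close> would give
  \<open>p \<ge> 1/4\<close> at every earlier time and push the sum in \<open>sig_sum0\<close> above
  16. This is the origin of 64 = 4 * 16.\<close>

lemma \<Phi>_ge_1:
  assumes "\<And>t. t < u \<Longrightarrow> ok t" "real u * (\<eta> * \<alpha> ^ 3 * \<sigma>) > 64"
  shows "\<Phi> u \<ge> 1"
proof (rule ccontr)
  assume "\<not> \<Phi> u \<ge> 1"
  then have "p t \<ge> 1 / 4" if "t < u" for t
    using \<Phi>_mono[of t u] that unfolding p_def by (intro psi_ge_quarter) auto
  then have "(\<Sum>t<u. p t) \<ge> real u * (1 / 4)"
    using sum_bounded_below[of "{..<u}" "1 / 4" p] by simp
  then have "(\<eta> * \<alpha> ^ 3 * \<sigma>) * (real u * (1 / 4)) \<le> (\<eta> * \<alpha> ^ 3 * \<sigma>) * (\<Sum>t<u. p t)"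
    using \<eta>_pos \<alpha>_pos \<sigma>_pos by (intro mult_left_mono) auto
  also have "\<dots> \<le> 16" by (rule sig_sum0[OF assms(1)])
  finally show False using assms(2) by (simp add: mult_ac)
qed

text \<open>If all filters were below \<open>1 / (\<alpha> m)\<close>, their \<open>m\<close> cubes
  would give a margin of at most \<open>2 / m^2\<close>.\<close>

lemma \<Phi>_ge_1_filter:
  assumes "\<Phi> t \<ge> 1"
  shows "\<exists>r<m. w r t > 0 \<and> \<alpha> * real m * w r t \<ge> 1"
proof (rule ccontr)
  assume *: "\<not> ?thesis"
  have small: "w r t ^ 3 \<le> (1 / (\<alpha> * real m)) ^ 3" if "r < m" for r
  proof (intro cube_mono)
    have pos: "\<alpha> * real m > 0" using \<alpha>_pos m_pos by simp
    have "\<alpha> * real m * w r t \<le> 1"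
      using * that pos by (smt (verit) mult_nonneg_nonpos)
    then show "w r t \<le> 1 / (\<alpha> * real m)" using pos by (simp add: field_simps)
  qed
  have "S t \<le> real m * (1 / (\<alpha> * real m)) ^ 3"
    unfolding S_def using sum_bounded_above[of "{..<m}" "\<lambda>r. w r t ^ 3"] small by simp
  also have "\<dots> = 1 / (\<alpha> ^ 3 * (real m)\<^sup>2)" using m_pos by (simp add: power_divide power_mult_distrib power2_eq_square power3_eq_cube)
  finally have Sl: "S t \<le> 1 / (\<alpha> ^ 3 * (real m)\<^sup>2)" .
  have "(\<alpha> + \<epsilon>) ^ 3 * S t \<ge> 1" using assms by (simp add: \<Phi>_def)
  moreover have "(\<alpha> + \<epsilon>) ^ 3 * S t \<le> (\<alpha> + \<epsilon>) ^ 3 * (1 / (\<alpha> ^ 3 * (real m)\<^sup>2))"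
    using \<alpha>_pos \<epsilon>_nonneg Sl by (intro mult_left_mono) auto
  moreover have "(\<alpha> + \<epsilon>) ^ 3 * (1 / (\<alpha> ^ 3 * (real m)\<^sup>2)) \<le> 2 * \<alpha> ^ 3 * (1 / (\<alpha> ^ 3 * (real m)\<^sup>2))"
    using cube_factor(2)[of "\<alpha> + \<epsilon>"] \<epsilon>_nonneg \<alpha>_pos by (intro mult_right_mono) auto
  moreover have "2 * \<alpha> ^ 3 * (1 / (\<alpha> ^ 3 * (real m)\<^sup>2)) = 2 / (real m)\<^sup>2" using \<alpha>_pos by simp
  moreover have "2 / (real m)\<^sup>2 < 1"
  proof -
    have "real m * real m \<ge> 1000 * 1000" using m_ge by (intro mult_mono) auto
    then show ?thesis by (simp add: power2_eq_square divide_less_eq) 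
  qed
  ultimately show False by linarith
qed

section \<open>The joint invariant for learnable and unlearnable noise\<close>

text \<open>The drift \<open>t / T\<close> absorbs the increments of patches with \<open>G > l / 2\<close>: there
  $\psi \le e^{-3l}$, which is far below $1/T$.\<close>

definition "Inv t \<longleftrightarrow> (\<forall>r<m. \<forall>j\<in>J.
   (fst j \<in> SL \<longrightarrow> G r j t \<le> \<iota> + E r t) \<and> (fst j \<in> SU \<longrightarrow> G r j t \<le> 3 / 4 * l + real t / real T))"

lemma J_cases: "j \<in> J \<Longrightarrow> fst j \<in> SL \<or> fst j \<in> SU"
proof -
  assume "j \<in> J"
  then have "fst j \<in> {..<N}" unfolding J_def by auto
  then show ?thesis unfolding split(1)[symmetric] by blast
qed

lemma minv: "1 / real m \<le> 1 / 1000"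
  using m_ge by (intro divide_left_mono) auto

text \<open>\<open>E\<close> occurs on both sides: the invariant bounds every \<open>G\<close> by
  \<open>l + (\<iota> + E)\<close>, and \<open>E\<close> is \<open>\<theta>\<close> times their sum.
  Since \<open>\<theta> N P \<le> 1/1000\<close>, the occurrence on the right is absorbed.\<close>

lemma E_bound:
  assumes "Inv t" "t \<le> T" "r < m"
  shows "E r t \<le> 1 / (50 * real m)"
proof -
  have "G r j t \<le> l + (\<iota> + E r t)" if "j \<in> J" for j
  proof -
    have "real t / real T \<le> 1" using assms(2) T_pos by simp
    then show ?thesis
      using assms(1,3) that J_cases[OF that] E_nonneg[of r t] \<iota>_pos l_ge unfolding Inv_def
      by force
  qed
  then have "E r t \<le> \<theta> * (real N * real P) * (l + (\<iota> + E r t))"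
    using E_nonneg[of r t] \<iota>_pos l_ge by (intro E_le) auto
  also have "\<dots> = \<theta> * (real N * real P) * l + \<theta> * (real N * real P) * (\<iota> + E r t)"
    by (simp add: algebra_simps)
  also have "\<dots> \<le> 1 / (100 * real m) + 1 / 1000 * (\<iota> + E r t)"
  proof (intro add_mono \<theta>_le mult_right_mono)
    have "1 * 10 \<le> real m * l" using m_ge l_ge by (intro mult_mono) auto
    then have "1 / (100 * (real m * l)) \<le> 1 / (100 * 10)"
      using m_pos l_ge by (intro divide_left_mono mult_pos_pos) linarith+
    then show "\<theta> * (real N * real P) \<le> 1 / 1000"
      using tau_le unfolding mult.assoc by linarith
  qed (use E_nonneg[of r t] \<iota>_pos in auto)
  finally have "E r t \<le> 1 / (100 * real m) + 1 / 1000 * (\<iota> + E r t)" .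
  then have "E r t \<le> 2 * (1 / (100 * real m))"
    using \<iota>_le E_nonneg[of r t] by (simp add: field_simps)
  then show ?thesis by simp
qed

lemma \<iota>E_bound:
  assumes "Inv t" "t \<le> T" "r < m"
  shows "\<iota> + E r t \<le> 3 / (100 * real m)"
  using E_bound[OF assms] \<iota>_le by (simp add: field_simps)

lemma z_SL:
  assumes "Inv t" "r < m" "j \<in> J" "fst j \<in> SL"
  shows "\<bar>z r j t\<bar> \<le> 2 * (\<iota> + E r t)"
  using assms z_upper[of r j t] unfolding Inv_def by force

lemma noise_abs_le:
  assumes "k < N" "\<And>r q. r < m \<Longrightarrow> q \<in> Q k \<Longrightarrow> \<bar>z r (k, q) t\<bar> \<le> c" "c \<ge> 0"
  shows "\<bar>noise k t\<bar> \<le> real m * (real P * c ^ 3)"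
proof -
  have "\<bar>noise k t\<bar> \<le> (\<Sum>r<m. \<Sum>q\<in>Q k. \<bar>z r (k, q) t\<bar> ^ 3)"
    unfolding noise_def power_abs[symmetric]
    by (intro order_trans[OF sum_abs] sum_mono) (auto intro!: order_trans[OF sum_abs] simp: power_abs)
  also have "\<dots> \<le> (\<Sum>r<m. real P * c ^ 3)"
  proof (rule sum_mono)
    fix r assume "r \<in> {..<m}"
    then have "(\<Sum>q\<in>Q k. \<bar>z r (k, q) t\<bar> ^ 3) \<le> real (card (Q k)) * c ^ 3"
      using assms(2) by (intro sum_bounded_above power_mono) auto
    also have "\<dots> \<le> real P * c ^ 3" using cardQ[OF assms(1)] assms(3) by (intro mult_right_mono) auto
    finally show "(\<Sum>q\<in>Q k. \<bar>z r (k, q) t\<bar> ^ 3) \<le> real P * c ^ 3" .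
  qed
  finally show ?thesis by simp
qed

text \<open>Adding \<open>c^3\<close> makes every cube nonnegative, so the total is bounded below by
  zero or by any single summand, at the price of \<open>m P c^3\<close>.\<close>

lemma noise_lower:
  assumes "k < N" "\<And>r q. r < m \<Longrightarrow> q \<in> Q k \<Longrightarrow> z r (k, q) t \<ge> - c" "c \<ge> 0"
  shows "noise k t \<ge> - (real m * (real P * c ^ 3))"
    and "r0 < m \<Longrightarrow> q0 \<in> Q k \<Longrightarrow> noise k t \<ge> z r0 (k, q0) t ^ 3 - real m * (real P * c ^ 3)"
proof -
  let ?f = "\<lambda>r q. z r (k, q) t ^ 3 + c ^ 3"
  have nn: "0 \<le> ?f r q" if "r < m" "q \<in> Q k" for r q
    using cube_mono[OF assms(2)[OF that]] by simp
  have "real (card (Q k)) * c ^ 3 \<le> real P * c ^ 3"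
    using cardQ[OF assms(1)] assms(3) by (intro mult_right_mono) auto
  then have eq: "(\<Sum>r<m. \<Sum>q\<in>Q k. ?f r q) \<le> noise k t + real m * (real P * c ^ 3)"
    by (simp add: sum.distrib noise_def mult_left_mono)
  have "0 \<le> (\<Sum>r<m. \<Sum>q\<in>Q k. ?f r q)" using nn by (intro sum_nonneg) auto
  then show "noise k t \<ge> - (real m * (real P * c ^ 3))" using eq by linarith
  assume r0: "r0 < m" and q0: "q0 \<in> Q k"
  have "z r0 (k, q0) t ^ 3 \<le> ?f r0 q0" using assms(3) by simp
  also have "\<dots> \<le> (\<Sum>q\<in>Q k. ?f r0 q)"
    using nn r0 q0 finQ[OF assms(1)] by (intro member_le_sum) auto
  also have "\<dots> \<le> (\<Sum>r<m. \<Sum>q\<in>Q k. ?f r q)"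
    using nn r0 by (intro member_le_sum[of r0 _ "\<lambda>r. \<Sum>q\<in>Q k. ?f r q"] sum_nonneg) auto
  finally show "noise k t \<ge> z r0 (k, q0) t ^ 3 - real m * (real P * c ^ 3)" using eq by linarith
qed

text \<open>There are at most \<open>2 m^2\<close> pairs of filter and patch, so cubes of
  correlations of order \<open>1/m\<close> sum to order \<open>1/m\<close> only. This makes
  \<open>1/m\<close> the harmless scale of noise.\<close>

lemma mP_cube: "0 \<le> c \<Longrightarrow> c \<le> x / real m \<Longrightarrow> real m * (real P * c ^ 3) \<le> 2 * x ^ 3 / 1000"
proof -
  assume c: "0 \<le> c" "c \<le> x / real m"
  then have "x / real m \<ge> 0" by linarith
  then have x: "x \<ge> 0" using m_pos by (simp add: zero_le_divide_iff)
  have "real m * (real P * c ^ 3) \<le> real m * (2 * real m * (x / real m) ^ 3)"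
    using c P_le by (intro mult_left_mono mult_mono power_mono) auto
  also have "\<dots> = 2 * x ^ 3 * (1 / real m)"
    using m_pos by (simp add: power_divide power3_eq_cube power2_eq_square)
  also have "\<dots> \<le> 2 * x ^ 3 * (1 / 1000)" using minv x by (intro mult_left_mono) auto
  finally show ?thesis by simp
qed

lemma Inv_ok:
  assumes "Inv t" "t \<le> T"
  shows "ok t"
  unfolding ok_def
proof
  fix k assume k: "k \<in> SL"
  have "\<bar>noise k t\<bar> \<le> real m * (real P * (6 / (100 * real m)) ^ 3)"
  proof (rule noise_abs_le[OF SL_lt[OF k]])
    fix r q assume rq: "r < m" "q \<in> Q k"
    then have "\<bar>z r (k, q) t\<bar> \<le> 2 * (\<iota> + E r t)"
      using k SL_lt[OF k] by (intro z_SL[OF assms(1)]) (auto simp: J_def)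
    then show "\<bar>z r (k, q) t\<bar> \<le> 6 / (100 * real m)" using \<iota>E_bound[OF assms rq(1)] by simp
  qed simp
  also have "\<dots> \<le> 2 * (6 / 100) ^ 3 / 1000" by (rule mP_cube) auto
  finally show "\<bar>noise k t\<bar> \<le> 1" by (simp add: power3_eq_cube)
qed

lemma Inv_noise_lower:
  assumes "Inv t" "t \<le> T" "k < N"
  shows "noise k t \<ge> - 1"
    and "r0 < m \<Longrightarrow> q0 \<in> Q k \<Longrightarrow> noise k t \<ge> z r0 (k, q0) t ^ 3 - 1"
proof -
  have low: "- (3 / (100 * real m)) \<le> z r (k, q) t" if "r < m" "q \<in> Q k" for r q
    using z_lower'[of r "(k, q)" t] that assms(3) \<iota>E_bound[OF assms(1,2) that(1)] by (simp add: J_def)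
  have "real m * (real P * (3 / (100 * real m)) ^ 3) \<le> 2 * (3 / 100) ^ 3 / 1000"
    by (rule mP_cube) auto
  also have "\<dots> \<le> 1" by (simp add: power3_eq_cube)
  finally have small: "real m * (real P * (3 / (100 * real m)) ^ 3) \<le> 1" .
  show "noise k t \<ge> - 1"
    using noise_lower(1)[where t = t, OF assms(3) low] small by simp
  show "noise k t \<ge> z r0 (k, q0) t ^ 3 - 1" if "r0 < m" "q0 \<in> Q k"
    using noise_lower(2)[where t = t, OF assms(3) low _ that] small by simp
qed

lemma dG_SL:
  assumes "Inv t" "t \<le> T" "r < m" "j \<in> J" "fst j \<in> SL" "\<iota> + E r t \<le> B"
  shows "dG r j t \<le> 18 * a * B\<^sup>2 * p t"
proof -
  have "\<bar>z r j t\<bar> \<le> 2 * B" using z_SL[OF assms(1,3,4,5)] assms(6) by (smt (verit))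
  then have z2: "(z r j t)\<^sup>2 \<le> (2 * B)\<^sup>2" by (metis abs_ge_zero power2_abs power_mono)
  have "dG r j t \<le> 3 / 2 * a * psi (F (fst j) t) * (z r j t)\<^sup>2" by (rule dG_le[OF assms(4)])
  also have "\<dots> \<le> 3 / 2 * a * (3 * p t) * (2 * B)\<^sup>2"
    using a_pos p_pos[of t] psi_SL(2)[OF Inv_ok[OF assms(1,2)] assms(5)] z2 psi_pos[of "F (fst j) t"]
    by (intro mult_mono) auto
  finally show ?thesis by (simp add: power2_eq_square mult_ac)
qed

text \<open>The sum of increments is split at the end of \<open>stage1\<close>, and each half may
  use half of the budget. Early, correlations are of order \<open>\<iota>\<close> and
  \<open>stage1_rate\<close> applies; it controls \<open>a * \<iota>\<close> only, whereas
  \<open>E\<close> may dominate \<open>\<iota>\<close> later. Late, a filter has learned the signal,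
  so little \<open>psi\<close> is left and \<open>stage2_rate\<close> suffices.\<close>

lemma Inv_step_SL:
  assumes Inv: "\<And>s. s \<le> t \<Longrightarrow> Inv s" and t: "t < T" and r: "r < m" and j: "j \<in> J" "fst j \<in> SL"
  shows "G r j (Suc t) \<le> \<iota> + E r t"
proof -
  let ?B = "\<iota> + E r t"
  let ?\<beta> = "\<eta> * \<alpha> ^ 3 * \<sigma>"
  have \<beta>: "?\<beta> > 0" using \<eta>_pos \<alpha>_pos \<sigma>_pos by simp
  \<comment> \<open>The last time covered by \<open>stage1\<close>; its successor is past 64, as
    \<open>\<Phi>_ge_1\<close> demands.\<close>
  define S1 where "S1 = nat \<lfloor>64 / ?\<beta>\<rfloor>"
  have ok: "ok s" if "s \<le> t" for s using Inv_ok Inv that t by auto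
  have S1_le: "real s * ?\<beta> \<le> 64" if "s \<le> S1" for s
  proof -
    have "real s \<le> real S1" using that by simp
    also have "\<dots> \<le> 64 / ?\<beta>" unfolding S1_def using \<beta> by (simp add: of_nat_nat)
    finally show ?thesis using \<beta> by (simp add: pos_le_divide_eq)
  qed
  have S1_gt: "real (Suc S1) * ?\<beta> > 64"
  proof -
    have "64 / ?\<beta> < of_int \<lfloor>64 / ?\<beta>\<rfloor> + 1" by linarith
    moreover have "64 / ?\<beta> > 0" using \<beta> by (intro divide_pos_pos) auto
    then have "\<lfloor>64 / ?\<beta>\<rfloor> \<ge> 0" by linarith
    then have "real (Suc S1) = of_int \<lfloor>64 / ?\<beta>\<rfloor> + 1" unfolding S1_def by simp
    ultimately have "real (Suc S1) > 64 / ?\<beta>" by (metis (no_types))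
    then show ?thesis using \<beta> by (simp add: pos_divide_less_eq)
  qed
  have early: "(\<Sum>s<u. dG r j s) \<le> \<iota> / 2" if u: "u \<le> Suc t" "u \<le> Suc S1" for u
  proof -
    have "dG r j s \<le> 18 * a * (2 * \<iota>)\<^sup>2 * p s" if s: "s < u" for s
    proof (rule dG_SL)
      show "\<iota> + E r s \<le> 2 * \<iota>" using stage1(2)[OF r S1_le[of s]] s u by simp
    qed (use Inv s u t r j in auto)
    then have "(\<Sum>s<u. dG r j s) \<le> (\<Sum>s<u. 18 * a * (2 * \<iota>)\<^sup>2 * p s)"
      by (intro sum_mono) auto
    also have "\<dots> = 72 * \<iota> * (a * \<iota>) * (\<Sum>s<u. p s)"
      unfolding sum_distrib_left[symmetric] by (simp add: power2_eq_square mult_ac)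
    also have "\<dots> \<le> 72 * \<iota> * (?\<beta> / 10 ^ 6) * (\<Sum>s<u. p s)"
      using stage1_rate \<iota>_pos p_pos by (intro mult_right_mono mult_left_mono sum_nonneg) (auto intro: less_imp_le)
    also have "\<dots> = 72 * \<iota> / 10 ^ 6 * (?\<beta> * (\<Sum>s<u. p s))" by simp
    also have "\<dots> \<le> 72 * \<iota> / 10 ^ 6 * 16"
      using \<iota>_pos u by (intro mult_left_mono sig_sum0 ok) auto
    also have "\<dots> \<le> \<iota> / 2" using \<iota>_pos by simp
    finally show ?thesis .
  qed
  show ?thesis
  proof (cases "t \<le> S1")
    case True
    then show ?thesis using early[of "Suc t"] \<iota>_pos E_nonneg[of r t] by (simp add: G_def del: sum.lessThan_Suc)
  next
    case False
    then have lt: "Suc S1 \<le> Suc t" by simp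
    have "\<Phi> (Suc S1) \<ge> 1" using ok False by (intro \<Phi>_ge_1 S1_gt) auto
    then obtain r' where r': "r' < m" "w r' (Suc S1) > 0" "\<alpha> * real m * w r' (Suc S1) \<ge> 1"
      using \<Phi>_ge_1_filter by blast
    have "\<eta> * \<alpha> ^ 3 * (\<Sum>s\<in>{Suc S1..<Suc t}. p s) \<le> 8 / w r' (Suc S1)"
      using ok by (intro sig_sum r' lt) auto
    also have "\<dots> \<le> 8 * (\<alpha> * real m)" using r' by (simp add: field_simps)
    finally have "\<alpha> * (\<eta> * \<alpha>\<^sup>2 * (\<Sum>s\<in>{Suc S1..<Suc t}. p s)) \<le> \<alpha> * (8 * real m)"
      by (simp add: power2_eq_square power3_eq_cube mult_ac)
    then have psum: "\<eta> * \<alpha>\<^sup>2 * (\<Sum>s\<in>{Suc S1..<Suc t}. p s) \<le> 8 * real m"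
      using \<alpha>_pos by simp
    have B0: "?B > 0" using \<iota>_pos E_nonneg[of r t] by simp
    have "dG r j s \<le> 18 * a * ?B\<^sup>2 * p s" if s: "s \<in> {Suc S1..<Suc t}" for s
    proof (rule dG_SL)
      show "\<iota> + E r s \<le> ?B" using E_mono[of s t r] s by simp
    qed (use Inv s t r j in auto)
    then have "(\<Sum>s\<in>{Suc S1..<Suc t}. dG r j s) \<le> (\<Sum>s\<in>{Suc S1..<Suc t}. 18 * a * ?B\<^sup>2 * p s)"
      by (rule sum_mono)
    also have "\<dots> = 18 * ?B\<^sup>2 * a * (\<Sum>s\<in>{Suc S1..<Suc t}. p s)"
      unfolding sum_distrib_left[symmetric] by (simp add: mult_ac)
    also have "\<dots> \<le> 18 * ?B\<^sup>2 * (\<eta> * \<alpha>\<^sup>2 / 10 ^ 6) * (\<Sum>s\<in>{Suc S1..<Suc t}. p s)"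
      using stage2_rate p_pos by (intro mult_right_mono mult_left_mono sum_nonneg) (auto intro: less_imp_le)
    also have "\<dots> = 18 * ?B\<^sup>2 / 10 ^ 6 * (\<eta> * \<alpha>\<^sup>2 * (\<Sum>s\<in>{Suc S1..<Suc t}. p s))" by simp
    also have "\<dots> \<le> 18 * ?B\<^sup>2 / 10 ^ 6 * (8 * real m)"
      by (intro mult_left_mono psum) auto
    \<comment> \<open>One of the two factors \<open>B\<close> is spent on cancelling
      \<open>m\<close>; the other remains as the bound.\<close>
    also have "\<dots> = 144 / 10 ^ 6 * ?B * (real m * ?B)" by (simp add: power2_eq_square)
    also have "\<dots> \<le> 144 / 10 ^ 6 * ?B * (3 / 100)"
    proof (rule mult_left_mono)
      have "?B \<le> 3 / (100 * real m)" using Inv[of t] t r by (intro \<iota>E_bound) auto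
      then show "real m * ?B \<le> 3 / 100" using m_pos by (simp add: field_simps)
    qed (use B0 in auto)
    also have "\<dots> \<le> ?B / 2" using B0 by simp
    finally have late: "(\<Sum>s\<in>{Suc S1..<Suc t}. dG r j s) \<le> ?B / 2" .
    have "G r j (Suc t) = (\<Sum>s<Suc S1. dG r j s) + (\<Sum>s\<in>{Suc S1..<Suc t}. dG r j s)"
      unfolding G_def lessThan_atLeast0 by (rule sum.atLeastLessThan_concat[symmetric]) (use lt in auto)
    also have "\<dots> \<le> \<iota> / 2 + ?B / 2" using early[of "Suc S1"] late lt by linarith
    also have "\<dots> \<le> ?B" using E_nonneg[of r t] \<iota>_pos by (simp add: field_simps)
    finally show ?thesis .
  qed
qed

text \<open>A barrier argument again: below \<open>l / 2\<close> one step adds at most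
  \<open>l / 4\<close> because \<open>a * l\<close> is small, and above it the margin is at least
  \<open>3 l\<close>, so a step adds at most \<open>exp (- l) \<le> 1 / T\<close>.\<close>

lemma Inv_step_SU:
  assumes Inv: "Inv t" and t: "t < T" and r: "r < m" and j: "j \<in> J" "fst j \<in> SU"
  shows "G r j (Suc t) \<le> 3 / 4 * l + real (Suc t) / real T"
proof -
  obtain k q where jk: "j = (k, q)" "k < N" "q \<in> Q k" using j unfolding J_def by auto
  have "\<iota> + E r t \<le> 3 / (100 * real m)" using Inv t r by (intro \<iota>E_bound) auto
  also have "\<dots> \<le> 1" using minv by (simp add: field_simps)
  finally have B: "\<iota> + E r t \<le> 1" .
  have tT: "real t / real T \<le> 1" using t by simp
  have G: "G r j t \<le> 3 / 4 * l + real t / real T" using Inv r j unfolding Inv_def by auto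
  have sq: "(z r j t)\<^sup>2 \<le> y\<^sup>2" if "\<bar>z r j t\<bar> \<le> y" for y
    using that by (metis abs_ge_zero power2_abs power_mono)
  have inc: "dG r j t \<le> 3 / 2 * a * x * y\<^sup>2" if "psi (F k t) \<le> x" "\<bar>z r j t\<bar> \<le> y" for x y
  proof -
    have "dG r j t \<le> 3 / 2 * a * psi (F k t) * (z r j t)\<^sup>2" using dG_le[OF j(1)] jk by simp
    also have "\<dots> \<le> 3 / 2 * a * x * y\<^sup>2"
      using that sq[of y] a_pos psi_pos[of "F k t"] by (intro mult_mono) auto
    finally show ?thesis .
  qed
  show ?thesis
  proof (cases "G r j t \<le> l / 2")
    case True
    have "dG r j t \<le> 3 / 2 * a * 1 * l\<^sup>2"
      using z_upper[OF r j(1), of t] True B l_ge psi_le_1 by (intro inc) auto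
    also have "\<dots> = 3 / 2 * l * (a * l)" by (simp add: power2_eq_square)
    also have "\<dots> \<le> 3 / 2 * l * (1 / 100)" using a_le l_ge by (intro mult_left_mono) auto
    also have "\<dots> \<le> l / 4" using l_ge by simp
    finally show ?thesis using True by (simp add: G_Suc add_increasing2)
  next
    case False
    have zl: "z r j t \<ge> l / 3" using z_lower[OF r j(1), of t] False B l_ge by linarith
    \<comment> \<open>With \<open>l \<ge> 10\<close> the cube exceeds \<open>3 l + 1\<close>; the
      extra 1 pays for the negative contributions of the other filters and patches.\<close>
    then have "z r j t ^ 3 \<ge> (l / 3) ^ 3" by (rule cube_mono)
    moreover have "l * 100 \<le> l * (l * l)" using l_ge mult_mono[of 10 l 10 l] by (intro mult_left_mono) auto
    moreover have "(l / 3) ^ 3 = l * (l * l) / 27" by (simp add: power3_eq_cube)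
    ultimately have "z r j t ^ 3 \<ge> 3 * l + 1" using l_ge by linarith
    then have "F k t \<ge> 3 * l"
      using Inv_noise_lower(2)[OF Inv _ jk(2) r jk(3)] t F_SU'[of k t] j(2) jk by simp
    then have "psi (F k t) \<le> exp (- (3 * l))"
      using psi_le_exp[of "F k t"] by (meson exp_le_cancel_iff neg_le_iff_le order_trans)
    then have "dG r j t \<le> 3 / 2 * a * exp (- (3 * l)) * (2 * l)\<^sup>2"
      using z_upper[OF r j(1), of t] G B tT l_ge by (intro inc) linarith+
    also have "\<dots> = 6 * l * exp (- (3 * l)) * (a * l)" by (simp add: power2_eq_square)
    also have "\<dots> \<le> 6 * l * exp (- (3 * l)) * (1 / 100)" using a_le l_ge by (intro mult_left_mono) auto
    also have "\<dots> \<le> exp (- l)"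
    proof -
      have "l \<le> exp l" using exp_ge_add_one_self[of l] by linarith
      also have "\<dots> \<le> exp (2 * l)" using l_ge by simp
      finally have "l * exp (- (3 * l)) \<le> exp (2 * l) * exp (- (3 * l))" by (intro mult_right_mono) auto
      also have "\<dots> = exp (- l)" by (simp flip: exp_add)
      finally have le: "l * exp (- (3 * l)) \<le> exp (- l)" .
      have "6 * l * exp (- (3 * l)) * (1 / 100) = 6 / 100 * (l * exp (- (3 * l)))" by simp
      also have "\<dots> \<le> 1 * exp (- l)" using l_ge by (intro mult_mono le) auto
      finally show ?thesis by simp
    qed
    also have "\<dots> \<le> 1 / real T" using exp_l T_pos by (simp add: exp_minus field_simps)
    finally show ?thesis using G by (simp add: G_Suc add_divide_distrib)
  qed
qed

text \<open>Strong induction, since the step for learnable patches re-sums the increments of all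
  earlier times.\<close>

lemma Inv_all: "t \<le> T \<Longrightarrow> Inv t"
proof (induction t rule: less_induct)
  case (less t)
  show ?case
  proof (cases t)
    case 0
    then show ?thesis using \<iota>_pos l_ge E_nonneg by (auto simp: Inv_def G_0 add_nonneg_nonneg less_imp_le)
  next
    case (Suc s)
    have prev: "Inv u" if "u \<le> s" for u using less that Suc by auto
    show ?thesis
      unfolding Inv_def
    proof (intro allI impI ballI conjI)
      fix r j assume r: "r < m" and j: "j \<in> J"
      show "G r j t \<le> \<iota> + E r t" if "fst j \<in> SL"
        using Inv_step_SL[OF prev _ r j that] less.prems E_Suc_ge[of r s] Suc
        by (metis Suc_le_lessD add_left_mono order_trans)
      show "G r j t \<le> 3 / 4 * l + real t / real T" if "fst j \<in> SU"
        using Inv_step_SU[OF prev[OF order_refl] _ r j that] less.prems Suc by auto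
    qed
  qed
qed

lemma ok_all: "t \<le> T \<Longrightarrow> ok t"
  using Inv_all Inv_ok by blast

lemma \<Phi>_T: "\<Phi> T \<ge> 1"
  using horizon_signal l_ge ok_all by (intro \<Phi>_ge_1) auto

lemma learned_filter: "\<exists>r<m. \<alpha> * real m * w r T \<ge> 1"
  using \<Phi>_ge_1_filter[OF \<Phi>_T] by blast

text \<open>\<open>p\<close> is antitone, so \<open>T * p T\<close> is at most the sum of all
  \<open>p\<close>, which \<open>sig_sum0\<close> bounds; \<open>horizon_signal\<close> then makes
  \<open>p T\<close> of order \<open>1 / l\<close>.\<close>

lemma SL_loss: "k \<in> SL \<Longrightarrow> logistic (F k T) \<le> 1 / l"
proof -
  assume k: "k \<in> SL"
  have "real T * p T \<le> (\<Sum>t<T. p t)"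
    using sum_bounded_below[of "{..<T}" "p T" p] p_antimono by simp
  then have "(\<eta> * \<alpha> ^ 3 * \<sigma>) * (real T * p T) \<le> (\<eta> * \<alpha> ^ 3 * \<sigma>) * (\<Sum>t<T. p t)"
    using \<eta>_pos \<alpha>_pos \<sigma>_pos by (intro mult_left_mono) auto
  also have "\<dots> \<le> 16" using ok_all by (intro sig_sum0) auto
  finally have "(real T * (\<eta> * \<alpha> ^ 3 * \<sigma>)) * p T \<le> 16" by (simp add: mult_ac)
  moreover have "1000 * l * p T \<le> (real T * (\<eta> * \<alpha> ^ 3 * \<sigma>)) * p T"
    using p_pos[of T] by (intro mult_right_mono horizon_signal) auto
  ultimately have "1000 * l * p T \<le> 16" by linarith
  then have pT: "p T \<le> 16 / (1000 * l)" using l_ge by (simp add: field_simps)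
  have psi: "psi (F k T) \<le> 3 * (16 / (1000 * l))"
    using psi_SL(2)[OF ok_all[OF order_refl] k] pT by linarith
  also have "\<dots> \<le> 1 / 2" using l_ge by (simp add: field_simps)
  finally have "logistic (F k T) \<le> 2 * psi (F k T)" by (rule logistic_le_psi)
  also have "\<dots> \<le> 2 * (3 * (16 / (1000 * l)))" using psi by linarith
  also have "\<dots> \<le> 1 / l" using l_ge by (simp add: field_simps)
  finally show ?thesis .
qed

lemma SU_margin: "k \<in> SU \<Longrightarrow> F k T \<ge> - 1"
  using Inv_noise_lower(1)[OF Inv_all[OF order_refl] order_refl SU_lt] F_SU' by auto

section \<open>Upper bound on the learned signal\<close>

definition "Y t = (\<alpha> - \<epsilon>) ^ 3 * S t"

lemma \<alpha>S_le: "Y t \<le> x \<Longrightarrow> 0 \<le> x \<Longrightarrow> \<alpha> ^ 3 * S t \<le> 2 * x"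
proof -
  assume x: "Y t \<le> x" "0 \<le> x"
  show ?thesis
  proof (cases "S t \<ge> 0")
    case True
    have "\<alpha> ^ 3 / 2 * S t \<le> Y t"
      unfolding Y_def using True \<epsilon>_nonneg by (intro mult_right_mono cube_factor) auto
    then show ?thesis using x by simp
  next
    case False
    then have "\<alpha> ^ 3 * S t \<le> 0" using \<alpha>_pos by (intro mult_nonneg_nonpos) auto
    then show ?thesis using x by linarith
  qed
qed

lemma w_upper:
  assumes "Y t \<le> 6 * l" "r < m"
  shows "\<alpha> * \<bar>w r t\<bar> \<le> 13 * l"
proof (cases "w r t \<le> 0")
  case True
  then have "\<alpha> * \<bar>w r t\<bar> \<le> \<alpha> * \<omega>" using w_ge[OF assms(2), of t] \<alpha>_pos by (intro mult_left_mono) auto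
  then show ?thesis using \<alpha>\<omega> l_ge by linarith
next
  case False
  have "\<alpha> ^ 3 * S t \<le> 2 * (6 * l)" using assms(1) l_ge by (intro \<alpha>S_le) auto
  moreover have "\<alpha> ^ 3 * (w r t ^ 3 - real m * \<omega> ^ 3) \<le> \<alpha> ^ 3 * S t"
    using \<alpha>_pos by (intro mult_left_mono S_lower assms) auto
  then have "(\<alpha> * w r t) ^ 3 \<le> \<alpha> ^ 3 * S t + 1 / 100"
    using m\<omega> by (simp add: power_mult_distrib right_diff_distrib)
  ultimately have c: "(\<alpha> * w r t) ^ 3 \<le> 13 * l" using l_ge by linarith
  have "\<alpha> * w r t \<le> 13 * l"
  proof (rule ccontr)
    assume *: "\<not> ?thesis"
    then have "\<alpha> * w r t \<le> (\<alpha> * w r t) ^ 3" using l_ge by (intro self_le_power) auto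
    then show False using c * by linarith
  qed
  then show ?thesis using False by simp
qed

text \<open>The relative step \<open>x = b * w\<close> is at most \<open>p / 4000\<close>, and
  \<open>(1 + x)^3 - 1\<close> is at most \<open>7 |x|\<close>. The increment thus keeps the factor
  \<open>p t\<close>, which becomes negligible above the barrier.\<close>

lemma Y_step:
  assumes t: "t < T" and Y: "Y t \<le> 6 * l"
  shows "Y (Suc t) \<le> Y t + p t * l / 50"
proof -
  have ok: "ok t" using ok_all t by auto
  have inc: "w r (Suc t) ^ 3 \<le> w r t ^ 3 + 7 / 4000 * p t * \<bar>w r t\<bar> ^ 3" if r: "r < m" for r
  proof -
    define x where "x = b t * w r t"
    have ax: "\<bar>x\<bar> = b t * \<bar>w r t\<bar>" using b_nonneg[of t] by (simp add: x_def abs_mult)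
    have x1: "\<bar>x\<bar> \<le> 1" using bw[OF ok r] ax by simp
    have "b t * \<bar>w r t\<bar> \<le> 18 * (\<eta> * \<alpha> ^ 3 * p t) * \<bar>w r t\<bar>"
      using b_bounds(2)[OF ok] by (intro mult_right_mono) auto
    also have "\<dots> = 18 * (\<eta> * \<alpha>\<^sup>2 * p t) * (\<alpha> * \<bar>w r t\<bar>)"
      by (simp add: power2_eq_square power3_eq_cube)
    also have "\<dots> \<le> 18 * (\<eta> * \<alpha>\<^sup>2 * p t) * (13 * l)"
      using w_upper[OF Y r] \<eta>_pos p_pos[of t] by (intro mult_left_mono) auto
    also have "\<dots> = 234 * p t * (\<eta> * \<alpha>\<^sup>2 * l)" by simp
    also have "\<dots> \<le> 234 * p t * (1 / 10 ^ 6)"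
      using step_le p_pos[of t] by (intro mult_left_mono) auto
    also have "\<dots> \<le> p t / 4000" using p_pos[of t] by simp
    finally have xp: "\<bar>x\<bar> \<le> p t / 4000" using ax by simp
    have "w r (Suc t) = w r t * (1 + x)"
      by (simp add: w_Suc[OF r] x_def power2_eq_square algebra_simps)
    then have "w r (Suc t) ^ 3 - w r t ^ 3 = w r t ^ 3 * (x * (3 + 3 * x + x\<^sup>2))"
      by (simp add: power_mult_distrib power3_eq_cube power2_eq_square algebra_simps)
    also have "\<dots> \<le> \<bar>w r t\<bar> ^ 3 * (\<bar>x\<bar> * \<bar>3 + 3 * x + x\<^sup>2\<bar>)"
      by (metis abs_ge_self abs_mult power_abs)
    also have "\<dots> \<le> \<bar>w r t\<bar> ^ 3 * (p t / 4000 * 7)"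
    proof (intro mult_left_mono mult_mono xp)
      have "x\<^sup>2 \<le> 1" using x1 by (simp add: abs_square_le_1)
      then show "\<bar>3 + 3 * x + x\<^sup>2\<bar> \<le> 7" using x1 zero_le_power2[of x] by linarith
    qed (use p_pos[of t] in auto)
    finally show ?thesis by (simp add: mult_ac)
  qed
  \<comment> \<open>Negative filters stay above \<open>- \<omega>\<close>, so the sum of absolute
    cubes is controlled by \<open>S\<close> itself up to \<open>2 m \<omega>^3\<close>.\<close>
  have abs3: "\<bar>w r t\<bar> ^ 3 \<le> w r t ^ 3 + 2 * \<omega> ^ 3" if r: "r < m" for r
  proof (cases "w r t \<ge> 0")
    case False
    have "(- w r t) ^ 3 \<le> \<omega> ^ 3" using w_ge[OF r, of t] by (intro cube_mono) auto
    then show ?thesis using False by simp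
  qed (use \<omega>_nonneg in auto)
  have "S (Suc t) \<le> (\<Sum>r<m. w r t ^ 3 + 7 / 4000 * p t * \<bar>w r t\<bar> ^ 3)"
    unfolding S_def using inc by (intro sum_mono) auto
  also have "\<dots> = S t + 7 / 4000 * p t * (\<Sum>r<m. \<bar>w r t\<bar> ^ 3)"
    by (simp add: sum.distrib S_def sum_distrib_left)
  also have "\<dots> \<le> S t + 7 / 4000 * p t * (S t + 2 * (real m * \<omega> ^ 3))"
  proof -
    have "(\<Sum>r<m. \<bar>w r t\<bar> ^ 3) \<le> (\<Sum>r<m. w r t ^ 3 + 2 * \<omega> ^ 3)" using abs3 by (intro sum_mono) auto
    then show ?thesis using p_pos[of t] by (simp add: S_def sum.distrib mult_ac)
  qed
  finally have "(\<alpha> - \<epsilon>) ^ 3 * S (Suc t) \<le> (\<alpha> - \<epsilon>) ^ 3 * (S t + 7 / 4000 * p t * (S t + 2 * (real m * \<omega> ^ 3)))"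
    using \<alpha>\<epsilon>(3) by (intro mult_left_mono) auto
  then have "Y (Suc t) \<le> Y t + 7 / 4000 * p t * (Y t + 2 * ((\<alpha> - \<epsilon>) ^ 3 * (real m * \<omega> ^ 3)))"
    by (simp add: Y_def algebra_simps add_divide_distrib)
  also have "\<dots> \<le> Y t + 7 / 4000 * p t * (7 * l)"
  proof (intro add_left_mono mult_left_mono)
    have "(\<alpha> - \<epsilon>) ^ 3 * (real m * \<omega> ^ 3) \<le> \<alpha> ^ 3 * (real m * \<omega> ^ 3)"
      using \<omega>_nonneg \<epsilon>_nonneg by (intro mult_right_mono cube_mono) auto
    then show "Y t + 2 * ((\<alpha> - \<epsilon>) ^ 3 * (real m * \<omega> ^ 3)) \<le> 7 * l"
      using m\<omega> Y l_ge by linarith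
  qed (use p_pos[of t] in auto)
  also have "\<dots> \<le> Y t + p t * l / 50" using p_pos[of t] l_ge by simp
  finally show ?thesis .
qed

text \<open>The attack at test time has to outweigh this margin. The barrier is \<open>4 l\<close>:
  there \<open>p \<le> exp (- 4 l)\<close>, one factor \<open>exp l\<close> is spent on
  \<open>l\<close>, and the rest is below \<open>1 / T\<close>.\<close>

lemma signal_upper: "\<alpha> ^ 3 * S T \<le> 12 * l"
proof -
  have "Y T \<le> 4 * l + l + real T * (1 / real T)"
  proof (rule bounded_growth[where u = T])
    have "S 0 \<le> real m * \<omega> ^ 3"
      unfolding S_def using sum_bounded_above[of "{..<m}" "\<lambda>r. w r 0 ^ 3" "\<omega> ^ 3"] w_init
      by (auto intro!: cube_mono simp: abs_le_iff)
    then have "Y 0 \<le> (\<alpha> - \<epsilon>) ^ 3 * (real m * \<omega> ^ 3)"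
      unfolding Y_def using \<alpha>\<epsilon>(3) by (intro mult_left_mono) auto
    also have "\<dots> \<le> \<alpha> ^ 3 * (real m * \<omega> ^ 3)"
      using \<omega>_nonneg \<epsilon>_nonneg by (intro mult_right_mono cube_mono) auto
    finally show "Y 0 \<le> 4 * l + l" using m\<omega> l_ge by linarith
  next
    fix t assume t: "t < T" "Y t \<le> 4 * l"
    then have "Y (Suc t) \<le> Y t + p t * l / 50" using l_ge by (intro Y_step) auto
    also have "p t * l \<le> 1 * l" using p_le_1[of t] l_ge by (intro mult_right_mono) auto
    finally show "Y (Suc t) \<le> Y t + l" using l_ge by linarith
  next
    fix t assume t: "t < T" "4 * l \<le> Y t" "Y t \<le> 4 * l + l + real t * (1 / real T)"
    have "real t * (1 / real T) \<le> 1" using t by simp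
    then have "Y t \<le> 6 * l" using t(3) l_ge by linarith
    then have st: "Y (Suc t) \<le> Y t + p t * l / 50" using t by (intro Y_step) auto
    have "S t \<ge> 0"
    proof (rule ccontr)
      assume "\<not> S t \<ge> 0"
      then have "Y t \<le> 0" unfolding Y_def using \<alpha>\<epsilon>(3) by (intro mult_nonneg_nonpos) auto
      then show False using t l_ge by linarith
    qed
    \<comment> \<open>Above the barrier \<open>S\<close> is nonnegative, so \<open>Y\<close>
      coincides with \<open>\<Phi>\<close>. The recursion is run for \<open>Y\<close> because it is
      linear in \<open>S\<close>.\<close>
    then have "\<Phi> t \<ge> 4 * l" using \<Phi>_nonneg_eq t by (simp add: Y_def)
    then have "p t \<le> exp (- (4 * l))"
      unfolding p_def using psi_le_exp[of "\<Phi> t"] by (meson exp_le_cancel_iff neg_le_iff_le order_trans)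
    moreover have "l \<le> exp l" using exp_ge_add_one_self[of l] by linarith
    ultimately have "p t * l \<le> exp (- (4 * l)) * exp l"
      using l_ge by (intro mult_mono) auto
    also have "\<dots> = exp (- (3 * l))" by (simp flip: exp_add)
    also have "\<dots> \<le> exp (- l)" using l_ge by simp
    finally have pl: "p t * l \<le> exp (- l)" .
    have "exp (- l) \<le> 1 / real T" using exp_l T_pos by (simp add: exp_minus field_simps)
    moreover have "p t * l \<ge> 0" using p_pos[of t] l_ge by simp
    ultimately show "Y (Suc t) \<le> Y t + 1 / real T" using st pl by linarith
  qed (use T_pos in auto)
  then have "Y T \<le> 6 * l" using T_pos l_ge by simp
  then show ?thesis using \<alpha>S_le[of T "6 * l"] l_ge by simp
qed

section \<open>Memorization by an unlearnable sample\<close>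

definition "\<kappa> = root 3 (1 / (64 * (real m)\<^sup>2))"

text \<open>The value is chosen so that \<open>2 m^2\<close> correlations of size
  \<open>2 \<kappa>\<close> give a margin of at most \<open>16 m^2 \<kappa>^3 = 1/4\<close>; below
  \<open>\<kappa>\<close> the loss derivative has therefore not saturated.\<close>

lemma \<kappa>3: "\<kappa> ^ 3 = 1 / (64 * (real m)\<^sup>2)"
  unfolding \<kappa>_def by (rule odd_real_root_pow) simp

lemma \<kappa>_ge: "\<kappa> \<ge> 1 / (4 * real m)"
proof (rule ccontr)
  assume "\<not> ?thesis"
  moreover have "\<kappa> \<ge> 0" by (simp add: \<kappa>_def)
  ultimately have "\<kappa> ^ 3 < (1 / (4 * real m)) ^ 3" by (intro power_strict_mono) auto
  also have "\<dots> = 1 / (64 * (real m)\<^sup>2) * (1 / real m)" by (simp add: power_divide power3_eq_cube power2_eq_square)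
  also have "\<dots> \<le> 1 / (64 * (real m)\<^sup>2) * 1" using minv by (intro mult_left_mono) auto
  finally show False using \<kappa>3 by simp
qed

lemma \<kappa>_pos: "\<kappa> > 0"
  using \<kappa>_ge m_pos by (smt (verit) divide_pos_pos of_nat_0_less_iff zero_less_mult_iff)

lemma \<kappa>_le_1: "\<kappa> \<le> 1"
proof (rule ccontr)
  assume "\<not> ?thesis"
  then have "\<kappa> ^ 3 \<ge> 1" by (intro one_le_power) auto
  moreover have "(real m)\<^sup>2 \<ge> 1" using m_pos by (intro one_le_power) auto
  then have "1 / (64 * (real m)\<^sup>2) \<le> 1 / 64" using m_pos by (intro divide_left_mono) auto
  ultimately show False using \<kappa>3 by linarith
qed

lemma small_\<kappa>: "3 / (100 * real m) \<le> \<kappa> / 8"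
proof -
  have "3 / (100 * real m) = 12 / 100 * (1 / (4 * real m))" by simp
  also have "\<dots> \<le> 12 / 100 * \<kappa>" using \<kappa>_ge by (intro mult_left_mono) auto
  finally show ?thesis using \<kappa>_pos by linarith
qed

text \<open>If no \<open>G\<close> reached \<open>\<kappa>\<close>, then
  \<open>psi \<ge> 1/4\<close> on all unlearnable samples up to \<open>T\<close>. A filter starting
  at \<open>\<rho>\<close> would grow quadratically throughout, and telescoping \<open>1 / M\<close>
  would give \<open>T a \<rho> \<le> 32\<close>, against \<open>horizon_noise\<close>.\<close>

lemma SU_noise_learned: "\<exists>r<m. \<exists>j\<in>J. fst j \<in> SU \<and> G r j T \<ge> \<kappa>"
proof (rule ccontr)
  assume neg: "\<not> ?thesis"
  have Gs: "G r j t \<le> \<kappa>" if "r < m" "j \<in> J" "fst j \<in> SU" "t \<le> T" for r j t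
    using neg that G_mono[of j t T r] by (meson linear order_trans)
  have zs: "\<bar>z r j t\<bar> \<le> 2 * \<kappa>" if "r < m" "j \<in> J" "fst j \<in> SU" "t \<le> T" for r j t
    using z_upper[OF that(1,2), of t] Gs[OF that] \<iota>E_bound[OF Inv_all[OF that(4)] that(4,1)]
      small_\<kappa> \<kappa>_pos by linarith
  have psi4: "psi (F k t) \<ge> 1 / 4" if k: "k \<in> SU" and t: "t \<le> T" for k t
  proof (rule psi_ge_quarter)
    have "\<bar>noise k t\<bar> \<le> real m * (real P * (2 * \<kappa>) ^ 3)"
      using zs k t SU_lt[OF k] \<kappa>_pos by (intro noise_abs_le) (auto simp: J_def)
    also have "\<dots> \<le> real m * (2 * real m * (2 * \<kappa>) ^ 3)"
      using P_le \<kappa>_pos by (intro mult_left_mono mult_right_mono) auto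
    also have "\<dots> = 16 * (real m)\<^sup>2 * \<kappa> ^ 3" by (simp add: power_mult_distrib power2_eq_square)
    also have "\<dots> \<le> 1" unfolding \<kappa>3 using m_pos by simp
    finally show "F k t \<le> 1" using F_SU'[OF k] by simp
  qed
  obtain r k0 q0 where r: "r < m" and k0: "k0 \<in> SU" "q0 \<in> Q k0" "z r (k0, q0) 0 \<ge> \<rho>"
    using z_init_ex by blast
  define JU where "JU = {j \<in> J. fst j \<in> SU}"
  have j0: "(k0, q0) \<in> JU" using k0 SU_lt[OF k0(1)] by (auto simp: JU_def J_def)
  have finU: "finite JU" using finJ by (simp add: JU_def)
  \<comment> \<open>Only one filter is followed, as cross terms do not mix filters. The maximizing
    patch may change with time, but the current one alone already gives the lower bound for the next
    maximum.\<close>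
  define M where "M t = Max ((\<lambda>j. z r j t) ` JU)" for t
  have M_ge: "z r j t \<le> M t" if "j \<in> JU" for j t
    unfolding M_def using finU that by (intro Max_ge) auto
  have M_ex: "\<exists>j\<in>JU. z r j t = M t" for t
  proof -
    have "M t \<in> (\<lambda>j. z r j t) ` JU" unfolding M_def using finU j0 by (intro Max_in) auto
    then show ?thesis by auto
  qed
  have step: "M t + a / 16 * (M t)\<^sup>2 \<le> M (Suc t) \<and> E r (Suc t) - E r t \<le> M (Suc t) - M t"
    if t: "t < T" and M\<rho>: "\<rho> \<le> M t" and EM: "E r t \<le> M t - \<rho>" for t
  proof -
    have M0: "M t > 0" using M\<rho> \<rho>_pos by simp
    \<comment> \<open>Other patches may start at \<open>\<iota>\<close>, above \<open>\<rho>\<close>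
      by a factor of order \<open>sqrt l\<close>. For squares this costs a factor \<open>l\<close>,
      which the smallness of \<open>\<theta> N P l\<close> absorbs below.\<close>
    have "(\<iota> + E r t)\<^sup>2 \<le> 2 * \<iota>\<^sup>2 + 2 * (E r t)\<^sup>2"
      using zero_le_power2[of "\<iota> - E r t"] by (simp add: power2_eq_square algebra_simps)
    also have "\<dots> \<le> 2 * (128 * l * (M t)\<^sup>2) + 2 * (M t)\<^sup>2"
    proof -
      have "128 * l * \<rho>\<^sup>2 \<le> 128 * l * (M t)\<^sup>2"
        using M\<rho> \<rho>_pos l_ge by (intro mult_left_mono power_mono) auto
      moreover have "(E r t)\<^sup>2 \<le> (M t)\<^sup>2"
        using EM \<rho>_pos E_nonneg[of r t] by (intro power_mono) auto
      ultimately show ?thesis using \<iota>_\<rho> by linarith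
    qed
    also have "\<dots> \<le> 257 * l * (M t)\<^sup>2"
    proof -
      have "2 * (M t)\<^sup>2 \<le> l * (M t)\<^sup>2" using l_ge by (intro mult_right_mono) auto
      then show ?thesis by linarith
    qed
    finally have B2: "(\<iota> + E r t)\<^sup>2 \<le> 257 * l * (M t)\<^sup>2" .
    have Mle: "(M t)\<^sup>2 \<le> l * (M t)\<^sup>2" using l_ge mult_right_mono[of 1 l "(M t)\<^sup>2"] by simp
    have sq: "x\<^sup>2 \<le> y\<^sup>2" if "\<bar>x\<bar> \<le> y" for x y :: real
      using that by (metis abs_ge_zero power2_abs power_mono)
    have z2: "(z r j t)\<^sup>2 \<le> 1030 * l * (M t)\<^sup>2" if j: "j \<in> J" for j
    proof (cases "fst j \<in> SL")
      case True
      have "(z r j t)\<^sup>2 \<le> (2 * (\<iota> + E r t))\<^sup>2"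
        using t by (intro sq z_SL Inv_all r j True) auto
      also have "\<dots> = 4 * (\<iota> + E r t)\<^sup>2" by (simp only: power_mult_distrib) simp
      finally show ?thesis using B2 Mle zero_le_power2[of "M t"] by linarith
    next
      case False
      then have "j \<in> JU" using J_cases[OF j] j by (simp add: JU_def)
      then have "z r j t \<le> M t" by (rule M_ge)
      moreover have "- (\<iota> + E r t) \<le> z r j t" by (rule z_lower'[OF r j])
      ultimately have "(z r j t)\<^sup>2 \<le> (M t)\<^sup>2 \<or> (z r j t)\<^sup>2 \<le> (\<iota> + E r t)\<^sup>2"
        by (cases "z r j t \<ge> 0") (auto intro: sq)
      then show ?thesis using B2 Mle zero_le_power2[of "M t"] by linarith
    qed
    have "dG r j t \<le> 1545 * a * (l * (M t)\<^sup>2)" if j: "j \<in> J" for j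
    proof -
      have "dG r j t \<le> 3 / 2 * a * psi (F (fst j) t) * (z r j t)\<^sup>2" by (rule dG_le[OF j])
      also have "\<dots> \<le> 3 / 2 * a * 1 * (1030 * l * (M t)\<^sup>2)"
        using a_pos psi_pos[of "F (fst j) t"] psi_le_1 z2[OF j] by (intro mult_mono) auto
      finally show ?thesis by simp
    qed
    then have "(\<Sum>j\<in>J. dG r j t) \<le> real (card J) * (1545 * a * (l * (M t)\<^sup>2))"
      by (rule sum_bounded_above)
    also have "\<dots> \<le> real N * real P * (1545 * a * (l * (M t)\<^sup>2))"
      using a_pos l_ge by (intro mult_right_mono cardJ) auto
    finally have "\<theta> * (\<Sum>j\<in>J. dG r j t) \<le> \<theta> * (real N * real P * (1545 * a * (l * (M t)\<^sup>2)))"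
      by (rule mult_left_mono[OF _ \<theta>_nonneg])
    also have "\<dots> = \<theta> * (real N * real P) * l * (1545 * a * (M t)\<^sup>2)" by simp
    also have "\<dots> \<le> 1 / 100000 * (1545 * a * (M t)\<^sup>2)"
    proof (rule mult_right_mono)
      show "\<theta> * (real N * real P) * l \<le> 1 / 100000" using \<theta>_le minv by simp
    qed (use a_pos in auto)
    also have "\<dots> \<le> a / 16 * (M t)\<^sup>2" using a_pos M0 by simp
    finally have Einc: "\<theta> * (\<Sum>j\<in>J. dG r j t) \<le> a / 16 * (M t)\<^sup>2" .
    obtain j where j: "j \<in> JU" "z r j t = M t" using M_ex by blast
    then have jJ: "j \<in> J" "fst j \<in> SU" by (auto simp: JU_def)
    have "a / 8 * (M t)\<^sup>2 \<le> dG r j t"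
    proof -
      have "1 / 2 * a * (1 / 4) * (M t)\<^sup>2 \<le> 1 / 2 * a * psi (F (fst j) t) * (M t)\<^sup>2"
        using psi4[OF jJ(2)] t a_pos by (intro mult_right_mono mult_left_mono) auto
      then show ?thesis using dG_ge[OF jJ(1), where r = r and t = t] j by simp
    qed
    then have "M (Suc t) \<ge> M t + a / 8 * (M t)\<^sup>2 - \<theta> * (\<Sum>j\<in>J. dG r j t)"
      using z_increment[OF r jJ(1), of t] M_ge[OF j(1), of "Suc t"] j(2) by linarith
    then show ?thesis using Einc by (simp add: E_Suc)
  qed
  \<comment> \<open>\<open>E\<close> grows no faster than \<open>M\<close>, so
    \<open>E \<le> M - \<rho>\<close> reproduces itself. The rate \<open>a / 32\<close> is half of
    \<open>a / 16\<close>, by \<open>recip_growth\<close>.\<close>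
  have inv: "\<rho> \<le> M t \<and> E r t \<le> M t - \<rho> \<and> 1 / M t + real t * (a / 32) \<le> 1 / \<rho>" if "t \<le> T" for t
    using that
  proof (induction t)
    case 0
    have "\<rho> \<le> M 0" using M_ge[OF j0, of 0] k0(3) by simp
    moreover from this have "1 / M 0 \<le> 1 / \<rho>" using \<rho>_pos by (intro divide_left_mono) auto
    ultimately show ?case by (simp add: E_0)
  next
    case (Suc t)
    then have t: "t < T" and IH: "\<rho> \<le> M t" "E r t \<le> M t - \<rho>" "1 / M t + real t * (a / 32) \<le> 1 / \<rho>" by auto
    note st = step[OF t IH(1,2)]
    have M0: "M t > 0" using IH(1) \<rho>_pos by simp
    have "1 / M (Suc t) + a / 16 / 2 \<le> 1 / M t"
    proof (rule recip_growth[OF M0])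
      obtain j where j: "j \<in> JU" "z r j t = M t" using M_ex by blast
      then have "M t \<le> 2 * \<kappa>" using zs[OF r, of j t] t by (auto simp: JU_def)
      then have "M t \<le> 2" using \<kappa>_le_1 by simp
      moreover have "a * 10 \<le> a * l" using a_pos l_ge by (intro mult_left_mono) auto
      then have "a \<le> 1" using a_le by simp
      ultimately have "a * M t \<le> 1 * 2" using a_pos M0 by (intro mult_mono) auto
      then show "a / 16 * M t \<le> 1" by simp
    qed (use a_pos st in auto)
    moreover have "M t \<le> M (Suc t)" using st a_pos by (smt (verit) divide_nonneg_nonneg mult_nonneg_nonneg zero_le_power2)
    ultimately show ?case using IH st by (auto simp: algebra_simps add_divide_distrib)
  qed
  have "M T > 0" using inv[of T] \<rho>_pos by linarith
  then have "1 / M T > 0" by simp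
  then have "real T * (a / 32) \<le> 1 / \<rho>" using inv[of T] by linarith
  then have "real T * a * \<rho> \<le> 32" using \<rho>_pos by (simp add: field_simps)
  then show False using horizon_noise by simp
qed

text \<open>The sum over filters is what the network outputs on this patch, up to the label. The one
  learned filter gives \<open>(\<kappa> / 2)^3 = 1 / (512 m^2)\<close>, while all filters together
  can lose only order \<open>1 / m^2\<close> with a far smaller constant.\<close>

lemma memorized_patch:
  "\<exists>k\<in>SU. \<exists>q\<in>Q k. (\<exists>r<m. z r (k, q) T \<ge> 1 / (8 * real m)) \<and>
     (\<Sum>r<m. z r (k, q) T ^ 3) \<ge> 1 / (1024 * (real m)\<^sup>2)"
proof -
  obtain r0 j where rj: "r0 < m" "j \<in> J" "fst j \<in> SU" "G r0 j T \<ge> \<kappa>"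
    using SU_noise_learned by blast
  have low: "- (3 / (100 * real m)) \<le> z r j T" if "r < m" for r
    using z_lower'[OF that rj(2), of T] \<iota>E_bound[OF Inv_all[OF order_refl] order_refl that] by linarith
  have z0: "z r0 j T \<ge> \<kappa> / 2"
    using z_lower[OF rj(1,2), of T] rj(4) \<iota>E_bound[OF Inv_all[OF order_refl] order_refl rj(1)]
      small_\<kappa> \<kappa>_pos by linarith
  let ?c = "(3 / (100 * real m)) ^ 3"
  have "z r0 j T ^ 3 + ?c \<le> (\<Sum>r<m. z r j T ^ 3 + ?c)"
  proof (rule member_le_sum)
    fix r assume "r \<in> {..<m} - {r0}"
    then show "0 \<le> z r j T ^ 3 + ?c" using cube_mono[OF low[of r]] by simp
  qed (use rj in auto)
  also have "\<dots> = (\<Sum>r<m. z r j T ^ 3) + real m * ?c" by (simp add: sum.distrib)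
  also have "real m * ?c = 27 / 1000000 * (1 / (real m)\<^sup>2)"
    using m_pos by (simp add: power_divide power3_eq_cube power2_eq_square)
  finally have "(\<Sum>r<m. z r j T ^ 3) \<ge> z r0 j T ^ 3 - 27 / 1000000 * (1 / (real m)\<^sup>2)"
    by (smt (verit) zero_le_power divide_nonneg_nonneg of_nat_0_le_iff)
  moreover have "z r0 j T ^ 3 \<ge> (\<kappa> / 2) ^ 3" using z0 by (rule cube_mono)
  moreover have "(\<kappa> / 2) ^ 3 = 1 / 512 * (1 / (real m)\<^sup>2)" by (simp add: power_divide \<kappa>3)
  moreover have "1 / (real m)\<^sup>2 \<ge> 0" by simp
  ultimately have "(\<Sum>r<m. z r j T ^ 3) \<ge> 1 / 1024 * (1 / (real m)\<^sup>2)" by linarith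
  moreover have "z r0 j T \<ge> 1 / (8 * real m)"
    using z0 \<kappa>_ge by simp
  ultimately show ?thesis using rj unfolding J_def by (auto intro!: bexI exI)
qed

end

section \<open>The parameter regime\<close>

text \<open>All parameters are reals here, which removes the coercions from the estimates.
  Integrality survives as \<open>N_ge\<close>, \<open>d_ge\<close> and \<open>T_nat\<close>; the
  last turns a positive lower bound on \<open>T\<close> into \<open>T \<ge> 1\<close>.\<close>

locale at_params =
  fixes C N P d m T \<alpha> \<sigma>n \<sigma>0 \<eta> \<epsilon> \<delta> pu :: real
  assumes C_ge: "C \<ge> 10 ^ 6" and N_ge: "N \<ge> 1" and d_ge: "d \<ge> 1"
    and T_nat: "T = 0 \<or> T \<ge> 1"
    and pos: "\<alpha> > 0" "\<sigma>n > 0" "\<sigma>0 > 0" "\<eta> > 0" "\<epsilon> > 0" and \<delta>: "0 < \<delta>" "\<delta> < 1"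
    and pu_nonneg: "pu \<ge> 0"
    and cond_T: "T \<ge> C * N / (\<eta> * \<sigma>0 * \<sigma>n ^ 3 * d powr (3/2))"
    and cond_d: "d \<ge> C * m\<^sup>2 * P\<^sup>2 * N\<^sup>2 * (ln (T * N * m * P / \<delta>)) ^ 4"
    and cond_\<alpha>: "\<alpha> \<ge> C * \<sigma>n * sqrt d * ln (T * N * m * P / \<delta>) / (N powr (1/3) * (1 - pu) powr (1/3))"
    and cond_\<sigma>0: "\<sigma>0 \<le> (1 / C) * min (1 / (m powr (2/3) * P powr (2/3) * \<sigma>n * sqrt d))
                          (min (1 / (\<alpha> * m powr (2/3))) (1 / (\<sigma>n * m\<^sup>2 * sqrt P * d)))
            / ln (T * d * N * m * P / \<delta>)"
    and cond_\<eta>: "\<eta> \<le> (1 / C) * min (1 / (\<alpha> ^ 3 * \<sigma>0)) (min (1 / (\<sigma>n\<^sup>2 * d)) (1 / \<alpha>\<^sup>2))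
            / ln (T * N * m * P / \<delta>)"
    and cond_\<epsilon>: "C * \<sigma>n * m * sqrt P * ln (T * d * N * P / \<delta>) \<le> \<epsilon>"
       "\<epsilon> < (1 / C) * min \<alpha> (1 / (m * \<sigma>0 * d))"
    and cond_pu: "pu \<le> (1 / C) * ln d / N"
    and cond_N: "N \<ge> C * m * P * ln (T * d * N * m * P / \<delta>)"
    and cond_m: "C * ln (N * P / \<delta>) \<le> m"
    and cond_P: "2 \<le> P" "P \<le> C"
begin

definition "l = ln (T * N * m * P / \<delta>)"
definition "l' = ln (T * d * N * m * P / \<delta>)"
text \<open>The bounds of the event with their logarithms replaced by \<open>2 l\<close>. For cross
  products, division by \<open>\<sigma>n^2 d\<close> leaves \<open>2 sqrt (2 l / d)\<close>, which
  is \<open>\<theta> / 2\<close>.\<close>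

definition "\<theta> = 4 * sqrt (2 * l / d)"
definition "\<iota> = 2 * \<sigma>0 * \<sigma>n * sqrt (d * (2 * l))"
definition "\<rho> = 1 / 4 * \<sigma>0 * \<sigma>n * sqrt d"
definition "\<omega> = \<sigma>0 * sqrt (2 * (2 * l))"
definition "a = 3 * \<eta> * \<sigma>n\<^sup>2 * d / N"

section \<open>Sizes and logarithms\<close>

lemma C_pos: "C > 0" and C_large: "C \<ge> 1000000"
  using C_ge by auto

lemma d32: "d powr (3/2) = sqrt d ^ 3"
proof -
  have "d powr (3/2) = d powr (1 + 1/2)" by simp
  also have "\<dots> = d powr 1 * d powr (1/2)" by (rule powr_add)
  also have "\<dots> = d * sqrt d" using d_ge by (simp add: powr_half_sqrt)
  finally show ?thesis using d_ge by (simp add: power3_eq_cube)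
qed

lemma T_ge1: "T \<ge> 1"
proof -
  have "C * N / (\<eta> * \<sigma>0 * \<sigma>n ^ 3 * d powr (3/2)) > 0"
    using C_pos N_ge pos d_ge by (intro divide_pos_pos mult_pos_pos) auto
  then show ?thesis using cond_T T_nat by linarith
qed

lemma inv\<delta>: "x > 0 \<Longrightarrow> x \<le> x / \<delta>"
  using \<delta> by (simp add: field_simps)

lemma NP\<delta>: "N * P / \<delta> \<ge> 2"
proof -
  have "1 * 2 \<le> N * P" using N_ge cond_P by (intro mult_mono) auto
  then show ?thesis using inv\<delta>[of "N * P"] by linarith
qed

text \<open>\<open>N P / \<delta> \<ge> 2\<close> and \<open>ln 2 \<ge> 1/2\<close> turn the
  logarithmic lower bound on \<open>m\<close> into \<open>m \<ge> C / 2\<close>. This also yields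
  \<open>P \<le> C \<le> 2 m\<close>.\<close>

lemma m_ge: "m \<ge> 500000" "2 * m \<ge> C"
proof -
  have "ln 2 \<le> ln (N * P / \<delta>)" using NP\<delta> by (intro ln_mono) auto
  then have "ln (N * P / \<delta>) \<ge> 1 / 2" using ln2_ge_two_thirds by linarith
  then have "C * (1 / 2) \<le> C * ln (N * P / \<delta>)" using C_pos by (intro mult_left_mono) auto
  then show "2 * m \<ge> C" using cond_m by linarith
  then show "m \<ge> 500000" using C_large by linarith
qed

lemma P_le_m: "P \<le> 2 * m"
  using cond_P m_ge by linarith

lemma prod_ge: "T * N * m * P / \<delta> \<ge> T" "T * N * m * P / \<delta> \<ge> m" "T * N * m * P / \<delta> \<ge> N"
   "T * N * m * P / \<delta> > 0"
proof -
  have 1: "T * N * m * P / \<delta> \<ge> T * N * m * P" using T_ge1 N_ge m_ge cond_P by (intro inv\<delta>) auto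
  have "T * 1 * 1 * 1 \<le> T * N * m * P" "1 * 1 * m * 1 \<le> T * N * m * P" "1 * N * 1 * 1 \<le> T * N * m * P"
    using T_ge1 N_ge m_ge cond_P by (intro mult_mono; simp)+
  then show "T * N * m * P / \<delta> \<ge> T" "T * N * m * P / \<delta> \<ge> m" "T * N * m * P / \<delta> \<ge> N"
     "T * N * m * P / \<delta> > 0" using 1 T_ge1 by linarith+
qed

lemma exp_l: "exp l \<ge> T"
  unfolding l_def using prod_ge by simp

lemma l_ge: "l \<ge> 10"
proof -
  have "exp 10 = (exp 1 :: real) ^ 10" by (simp flip: exp_of_nat_mult)
  also have "\<dots> \<le> 3 ^ 10" by (intro power_mono exp_le) auto
  also have "\<dots> \<le> m" using m_ge by simp
  also have "\<dots> \<le> exp l" unfolding l_def using prod_ge by simp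
  finally show ?thesis by simp
qed

lemma l'_ge: "l' \<ge> l" and lnd_le: "ln d \<le> l'"
proof -
  have eq: "T * d * N * m * P / \<delta> = d * (T * N * m * P / \<delta>)" by simp
  have ge1: "T * N * m * P / \<delta> \<ge> 1" using prod_ge(1) T_ge1 by linarith
  show "l' \<ge> l" unfolding l_def l'_def eq using prod_ge(4) d_ge
    by (intro ln_mono) (auto intro: mult_pos_pos simp del: times_divide_eq_right times_divide_eq_left)
  show "ln d \<le> l'" unfolding l'_def eq using ge1 d_ge mult_left_mono[OF ge1, of d]
    by (intro ln_mono) (auto simp del: times_divide_eq_right times_divide_eq_left)
qed

text \<open>Squaring the argument of \<open>l\<close> absorbs the constant 16, since
  \<open>16 \<le> m\<close>.\<close>

lemma logs_le:
  "ln (16 * N * m * P / \<delta>) \<le> 2 * l" "ln (16 * N\<^sup>2 * P\<^sup>2 / \<delta>) \<le> 2 * l" "ln (16 * m / \<delta>) \<le> 2 * l"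
proof -
  have d1: "1 / \<delta> \<ge> 1" using \<delta> by simp
  have 2: "2 * l = ln ((T * N * m * P / \<delta>)\<^sup>2)"
    unfolding l_def using prod_ge(4) by (simp add: ln_realpow)
  have eq: "(T * N * m * P / \<delta>)\<^sup>2 = (T * T) * (N * N) * (m * m) * (P * P) * ((1 / \<delta>) * (1 / \<delta>))"
    by (simp add: power2_eq_square)
  have TT: "1 * 1 \<le> T * T" using T_ge1 by (intro mult_mono) auto
  have NN: "N * 1 \<le> N * N" using N_ge by (intro mult_mono) auto
  have mm: "16 * m \<le> m * m" using m_ge by (intro mult_mono) auto
  have NN1: "1 \<le> N * N" using NN N_ge by linarith
  have PP1: "1 \<le> P * P" using mult_mono[of 1 P 1 P] cond_P by simp
  have mm16: "16 \<le> m * m" using mm m_ge by linarith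
  have PP: "P * 1 \<le> P * P" using cond_P by (intro mult_mono) auto
  have dd: "(1 / \<delta>) * 1 \<le> (1 / \<delta>) * (1 / \<delta>)" using \<delta> d1 by (intro mult_mono) auto
  note nn = N_ge m_ge cond_P d1 \<delta> T_ge1
  have "1 * N * (16 * m) * P * (1 / \<delta>) \<le> (T * T) * (N * N) * (m * m) * (P * P) * ((1 / \<delta>) * (1 / \<delta>))"
    using TT NN mm PP dd nn by (intro mult_mono) auto
  then have "16 * N * m * P / \<delta> \<le> (T * N * m * P / \<delta>)\<^sup>2" unfolding eq by (simp add: mult_ac)
  then show "ln (16 * N * m * P / \<delta>) \<le> 2 * l" unfolding 2 using nn by (intro ln_mono) auto
  have "1 * (N * N) * 16 * (P * P) * (1 / \<delta>) \<le> (T * T) * (N * N) * (m * m) * (P * P) * ((1 / \<delta>) * (1 / \<delta>))"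
    using TT mm16 dd nn by (intro mult_mono) auto
  then have "16 * N\<^sup>2 * P\<^sup>2 / \<delta> \<le> (T * N * m * P / \<delta>)\<^sup>2"
    unfolding eq by (simp add: mult_ac power2_eq_square)
  then show "ln (16 * N\<^sup>2 * P\<^sup>2 / \<delta>) \<le> 2 * l" unfolding 2 using nn by (intro ln_mono) auto
  have "1 * 1 * (16 * m) * 1 * (1 / \<delta>) \<le> (T * T) * (N * N) * (m * m) * (P * P) * ((1 / \<delta>) * (1 / \<delta>))"
    using TT NN1 mm PP1 dd nn by (intro mult_mono) auto
  then have "16 * m / \<delta> \<le> (T * N * m * P / \<delta>)\<^sup>2" unfolding eq by (simp add: mult_ac)
  then show "ln (16 * m / \<delta>) \<le> 2 * l" unfolding 2 using nn by (intro ln_mono) auto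
qed

lemma sqrt_2l: "sqrt (2 * l) \<le> l" "sqrt l \<le> l"
proof -
  have "2 * l \<le> l * l" "1 * l \<le> l * l" using l_ge by (intro mult_right_mono; simp)+
  then show "sqrt (2 * l) \<le> l" "sqrt l \<le> l" using l_ge by (auto intro!: real_le_lsqrt simp: power2_eq_square)
qed

text \<open>The square root of the dimension condition; 1000 comes from
  \<open>C \<ge> 10^6\<close>.\<close>

lemma sqrt_d: "sqrt d \<ge> 1000 * m * P * N * l\<^sup>2" "sqrt d \<ge> 1" "sqrt d \<le> d" "m \<le> d"
proof -
  have "(1000 * m * P * N * l\<^sup>2)\<^sup>2 = 10 ^ 6 * (m\<^sup>2 * P\<^sup>2 * N\<^sup>2 * l ^ 4)"
    by (simp add: power_mult_distrib)
  also have "\<dots> \<le> C * (m\<^sup>2 * P\<^sup>2 * N\<^sup>2 * l ^ 4)" using C_ge by (intro mult_right_mono) auto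
  also have "\<dots> \<le> d" using cond_d by (simp add: l_def mult.assoc)
  finally show 1: "sqrt d \<ge> 1000 * m * P * N * l\<^sup>2" by (rule real_le_rsqrt)
  show "sqrt d \<ge> 1" using d_ge by simp
  have "1 * d \<le> d * d" using d_ge by (intro mult_right_mono) auto
  then show 2: "sqrt d \<le> d" using d_ge by (intro real_le_lsqrt) (auto simp: power2_eq_square)
  have "1000 * m * 1 * 1 * 1 \<le> 1000 * m * P * N * l\<^sup>2"
    using m_ge cond_P N_ge l_ge by (intro mult_mono one_le_power) auto
  then show "m \<le> d" using 1 2 m_ge by linarith
qed

lemma \<theta>_le: "\<theta> \<ge> 0" "\<theta> * (N * P) * l \<le> 1 / (100 * m)"
proof -
  show "\<theta> \<ge> 0" unfolding \<theta>_def using l_ge d_ge by simp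
  have sd: "sqrt d > 0" using sqrt_d(2) by linarith
  have mPN: "m * P * N > 0" using m_ge cond_P N_ge by (intro mult_pos_pos) auto
  have "\<theta> = 4 * sqrt (2 * l) / sqrt d" by (simp add: \<theta>_def real_sqrt_divide)
  also have "\<dots> \<le> 4 * l / sqrt d" using sqrt_2l sd by (intro divide_right_mono) auto
  also have "\<dots> \<le> 4 * l / (1000 * m * P * N * l\<^sup>2)"
    using sqrt_d(1) l_ge mPN sd m_ge cond_P N_ge by (intro divide_left_mono) (auto intro!: mult_pos_pos)
  also have "\<dots> = 1 / (250 * (m * P * N) * l)" using l_ge by (simp add: power2_eq_square)
  finally have "\<theta> * ((N * P) * l) \<le> 1 / (250 * (m * P * N) * l) * ((N * P) * l)"
    using l_ge N_ge cond_P by (intro mult_right_mono) auto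
  also have "\<dots> = 1 / (250 * m)" using l_ge N_ge cond_P m_ge by (simp add: field_simps)
  also have "\<dots> \<le> 1 / (100 * m)" using m_ge by (intro divide_left_mono) auto
  finally show "\<theta> * (N * P) * l \<le> 1 / (100 * m)" by (simp add: mult.assoc)
qed

section \<open>Verification of the hypotheses of the dynamics\<close>

lemma min_div_le: "x \<le> (1 / C) * y / k \<Longrightarrow> y \<le> 1 / u \<Longrightarrow> u > 0 \<Longrightarrow> k > 0 \<Longrightarrow> x * u * k * C \<le> 1"
proof -
  assume x: "x \<le> (1 / C) * y / k" and y: "y \<le> 1 / u" and u: "u > 0" "k > 0"
  have "(1 / C) * y / k \<le> (1 / C) * (1 / u) / k"
    using y u C_pos by (intro divide_right_mono mult_left_mono) auto
  then have "x \<le> 1 / (C * u * k)" using x by simp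
  then show ?thesis using u C_pos by (simp add: field_simps)
qed

lemma \<sigma>0_le:
  "\<sigma>0 * (\<alpha> * m powr (2/3)) * l * C \<le> 1"
  "\<sigma>0 * (\<sigma>n * m\<^sup>2 * sqrt P * d) * l * C \<le> 1"
proof -
  have l': "l' > 0" "l \<le> l'" using l'_ge l_ge by auto
  have *: "\<sigma>0 * u * l * C \<le> 1" if "\<sigma>0 * u * l' * C \<le> 1" "u > 0" for u
  proof -
    have "\<sigma>0 * u * l * C \<le> \<sigma>0 * u * l' * C"
      using l' pos that C_pos by (intro mult_right_mono mult_left_mono) auto
    then show ?thesis using that by linarith
  qed
  show "\<sigma>0 * (\<alpha> * m powr (2/3)) * l * C \<le> 1"
    using pos m_ge l' by (intro * min_div_le[OF cond_\<sigma>0[folded l'_def]]) auto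
  show "\<sigma>0 * (\<sigma>n * m\<^sup>2 * sqrt P * d) * l * C \<le> 1"
    using pos m_ge l' cond_P d_ge by (intro * min_div_le[OF cond_\<sigma>0[folded l'_def]]) auto
qed

lemma \<eta>_le:
  "\<eta> * (\<sigma>n\<^sup>2 * d) * l * C \<le> 1" "\<eta> * \<alpha>\<^sup>2 * l * C \<le> 1" "\<eta> * (\<alpha> ^ 3 * \<sigma>0) * l * C \<le> 1"
  using pos d_ge l_ge by (intro min_div_le[OF cond_\<eta>[folded l_def]]; simp)+

lemma \<iota>_le: "\<iota> > 0" "\<iota> \<le> 1 / (100 * m)"
proof -
  show "\<iota> > 0" unfolding \<iota>_def using pos l_ge d_ge by simp
  have "\<iota> = 2 * \<sigma>0 * \<sigma>n * (sqrt d * sqrt (2 * l))" by (simp add: \<iota>_def real_sqrt_mult)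
  also have "\<dots> \<le> 2 * \<sigma>0 * \<sigma>n * (d * l)"
    using sqrt_2l sqrt_d pos l_ge d_ge by (intro mult_left_mono mult_mono) auto
  finally have i: "\<iota> \<le> 2 * (\<sigma>0 * (\<sigma>n * d) * l)" by (simp add: mult_ac)
  have "\<sigma>0 * (\<sigma>n * d) * l * (m * 1 * 1000000) \<le> \<sigma>0 * (\<sigma>n * d) * l * (m\<^sup>2 * sqrt P * C)"
    using pos d_ge l_ge m_ge cond_P C_large
    by (intro mult_left_mono mult_mono) (auto simp: power2_eq_square)
  also have "\<dots> = \<sigma>0 * (\<sigma>n * m\<^sup>2 * sqrt P * d) * l * C" by simp
  finally have "\<sigma>0 * (\<sigma>n * d) * l * (m * 1 * 1000000) \<le> 1" using \<sigma>0_le(2) by linarith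
  then have "\<iota> * (100 * m) \<le> 1"
    using mult_right_mono[OF i, of "100 * m"] m_ge by (simp only: mult_ac) linarith
  then show "\<iota> \<le> 1 / (100 * m)" using m_ge by (simp add: field_simps)
qed

lemma \<iota>_\<rho>: "\<rho> > 0" "\<iota>\<^sup>2 \<le> 128 * l * \<rho>\<^sup>2"
proof -
  show "\<rho> > 0" unfolding \<rho>_def using pos d_ge by simp
  show "\<iota>\<^sup>2 \<le> 128 * l * \<rho>\<^sup>2" unfolding \<iota>_def \<rho>_def using d_ge l_ge by (simp add: power_mult_distrib power_divide)
qed

text \<open>The sample size condition gives \<open>N \<ge> m ln d\<close>, while at most
  \<open>ln d / C\<close> samples are unlearnable. The bound \<open>1/m\<close> makes their share of
  the training loss vanish.\<close>

lemma pu_le: "pu \<le> 1 / C" "pu \<le> 1 / m"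
proof -
  have N: "N \<ge> C * m * P * l'" using cond_N by (simp add: l'_def)
  have "1 * 1 * m * l' \<le> C * m * P * l'" "1 * l' \<le> C * m * P * l'"
  proof -
    have "l' > 0" using l'_ge l_ge by linarith
    moreover have "1 * m \<le> C * m * P" "1 * 1 \<le> C * m * P"
    proof -
      have "1 * m * 1 \<le> C * m * P" "1 * 1 * 1 \<le> C * m * P"
        using C_large m_ge cond_P by (intro mult_mono; simp)+
      then show "1 * m \<le> C * m * P" "1 * 1 \<le> C * m * P" by auto
    qed
    ultimately show "1 * 1 * m * l' \<le> C * m * P * l'" "1 * l' \<le> C * m * P * l'"
      by (intro mult_right_mono; simp)+
  qed
  moreover have "ln d * m \<le> l' * m" using lnd_le m_ge by (intro mult_right_mono) auto
  ultimately have Nd: "N \<ge> ln d * m" "N \<ge> ln d" using N lnd_le by (auto simp: mult.commute)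
  have pu: "pu \<le> ln d / (C * N)" using cond_pu by simp
  also have "\<dots> \<le> N / (C * N)" using Nd N_ge C_pos by (intro divide_right_mono) auto
  finally show "pu \<le> 1 / C" using N_ge by simp
  have "ln d / (C * N) \<le> (N / m) / (C * N)"
    using Nd N_ge C_pos m_ge by (intro divide_right_mono) (auto simp: field_simps)
  also have "\<dots> = 1 / (C * m)" using N_ge by simp
  also have "\<dots> \<le> 1 / (1 * m)" using C_large m_ge by (intro divide_left_mono mult_right_mono) auto
  finally show "pu \<le> 1 / m" using pu by linarith
qed

text \<open>Links the limit \<open>d\<close> to infinity to the two quantities in the loss bound:
  \<open>ln d \<le> N\<close>, and \<open>ln N\<close> is below \<open>l\<close> by definition and
  below \<open>m\<close> by \<open>cond_m\<close>.\<close>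

lemma ln_ln_d_le:
  shows "ln (ln d) \<le> l" "ln (ln d) \<le> m"
proof -
  have lnd: "ln d > 0" using sqrt_d(4) m_ge(1) by (intro ln_gt_zero) linarith
  have "1 * 1 * 1 * l' \<le> C * m * P * l'"
    using C_large m_ge cond_P l'_ge l_ge by (intro mult_mono) auto
  then have "ln d \<le> N" using cond_N lnd_le by (simp add: l'_def)
  then have lN: "ln (ln d) \<le> ln N" using lnd N_ge by (intro ln_mono) auto
  also have "ln N \<le> l" unfolding l_def using prod_ge(3) N_ge by (intro ln_mono) auto
  finally show "ln (ln d) \<le> l" .
  have "N * 1 \<le> N * P" using N_ge cond_P by (intro mult_left_mono) auto
  then have NP: "N \<le> N * P / \<delta>" using inv\<delta>[of "N * P"] N_ge cond_P by (smt (verit) mult_pos_pos)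
  have "0 \<le> ln N" using N_ge by simp
  then have "1 * ln N \<le> C * ln (N * P / \<delta>)"
    using NP N_ge C_large by (intro mult_mono ln_mono) auto
  then show "ln (ln d) \<le> m" using lN cond_m by linarith
qed

lemma pu_half: "pu \<le> 1 / 2"
proof -
  have "1 / C \<le> 1 / 2" using C_large by (intro divide_left_mono) auto
  then show ?thesis using pu_le by linarith
qed

text \<open>The signal strength condition, cubed and squared. In the square the factor
  \<open>N^(2/3)\<close> is enlarged to \<open>N\<close>.\<close>

lemma signal_dominates:
  "C ^ 3 * (\<sigma>n ^ 3 * sqrt d ^ 3) * l ^ 3 \<le> \<alpha> ^ 3 * N"
  "C\<^sup>2 * (\<sigma>n\<^sup>2 * d) * l\<^sup>2 \<le> \<alpha>\<^sup>2 * N"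
proof -
  define A where "A = N powr (1/3)"
  define B where "B = (1 - pu) powr (1/3)"
  have A1: "A \<ge> 1" using N_ge unfolding A_def by (simp add: ge_one_powr_ge_zero)
  have A3: "A ^ 3 = N" unfolding A_def using N_ge by (simp add: powr_power)
  have B0: "B > 0" "B \<le> 1" unfolding B_def using pu_half pu_nonneg
    by (auto intro: powr_le1)
  have X: "C * \<sigma>n * sqrt d * l \<ge> 0" using C_pos pos d_ge l_ge by simp
  have "C * \<sigma>n * sqrt d * l / A \<le> C * \<sigma>n * sqrt d * l / (A * B)"
    using X A1 B0 by (intro divide_left_mono) (auto intro: mult_left_le)
  also have "\<dots> \<le> \<alpha>" using cond_\<alpha> by (simp add: A_def B_def l_def)
  finally have le: "C * \<sigma>n * sqrt d * l \<le> \<alpha> * A" using A1 by (simp add: field_simps)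
  have "(C * \<sigma>n * sqrt d * l) ^ 3 \<le> (\<alpha> * A) ^ 3" using le X by (rule power_mono)
  then show "C ^ 3 * (\<sigma>n ^ 3 * sqrt d ^ 3) * l ^ 3 \<le> \<alpha> ^ 3 * N"
    by (simp add: power_mult_distrib A3 mult_ac)
  have "(C * \<sigma>n * sqrt d * l)\<^sup>2 \<le> (\<alpha> * A)\<^sup>2" using le X by (rule power_mono)
  then have "C\<^sup>2 * (\<sigma>n\<^sup>2 * d) * l\<^sup>2 \<le> \<alpha>\<^sup>2 * A\<^sup>2" using d_ge by (simp add: power_mult_distrib mult_ac)
  also have "A\<^sup>2 \<le> A ^ 3" using A1 by (intro power_increasing) auto
  then have "\<alpha>\<^sup>2 * A\<^sup>2 \<le> \<alpha>\<^sup>2 * N" unfolding A3 by (intro mult_left_mono) auto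
  finally show "C\<^sup>2 * (\<sigma>n\<^sup>2 * d) * l\<^sup>2 \<le> \<alpha>\<^sup>2 * N" .
qed

text \<open>The two rate conditions are the two forms of \<open>signal_dominates\<close>: up to
  \<open>sqrt l\<close>, \<open>a * \<iota> * N\<close> is of order
  \<open>\<eta> \<sigma>0 \<sigma>n^3 d^(3/2)\<close>, and \<open>a * N\<close> is
  \<open>3 \<eta> \<sigma>n^2 d\<close>.\<close>

lemma a_facts: "a > 0" "a * l \<le> 1 / 100" "a * \<iota> * 10 ^ 6 \<le> \<eta> * \<alpha> ^ 3 * \<sigma>0" "a * 10 ^ 6 \<le> \<eta> * \<alpha>\<^sup>2"
proof -
  show a0: "a > 0" unfolding a_def using pos d_ge N_ge by simp
  have "a * l \<le> 3 * \<eta> * \<sigma>n\<^sup>2 * d / 1 * l"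
    unfolding a_def using pos d_ge N_ge l_ge by (intro mult_right_mono divide_left_mono) auto
  also have "\<dots> * 300 \<le> 3 * (\<eta> * (\<sigma>n\<^sup>2 * d) * l) * C"
    using pos d_ge l_ge C_large mult_left_mono[of 300 C "3 * (\<eta> * (\<sigma>n\<^sup>2 * d) * l)"] by (simp add: mult_ac)
  also have "\<dots> \<le> 3" using \<eta>_le(1) by simp
  finally show "a * l \<le> 1 / 100" by simp
  have C3: "C ^ 3 \<ge> 6 * 10 ^ 6"
  proof -
    have "(1000000 :: real) ^ 3 \<le> C ^ 3" using C_large by (intro power_mono) auto
    then show ?thesis by simp
  qed
  have "a * \<iota> * 10 ^ 6 * N = 6 * 10 ^ 6 * (\<eta> * \<sigma>0 * (\<sigma>n ^ 3 * sqrt d ^ 3)) * sqrt (2 * l)"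
    using N_ge d_ge by (simp add: a_def \<iota>_def real_sqrt_mult power3_eq_cube power2_eq_square)
  also have "\<dots> \<le> C ^ 3 * (\<eta> * \<sigma>0 * (\<sigma>n ^ 3 * sqrt d ^ 3)) * l ^ 3"
  proof (intro mult_mono)
    have "l * 1 \<le> l * l\<^sup>2" using l_ge by (intro mult_left_mono) auto
    then show "sqrt (2 * l) \<le> l ^ 3" using sqrt_2l by (simp add: power3_eq_cube power2_eq_square)
  qed (use C3 C_pos pos d_ge l_ge in auto)
  also have "\<dots> = \<eta> * \<sigma>0 * (C ^ 3 * (\<sigma>n ^ 3 * sqrt d ^ 3) * l ^ 3)" by simp
  also have "\<dots> \<le> \<eta> * \<sigma>0 * (\<alpha> ^ 3 * N)" using signal_dominates pos by (intro mult_left_mono) auto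
  finally have "a * \<iota> * 10 ^ 6 * N \<le> \<eta> * \<alpha> ^ 3 * \<sigma>0 * N" by (simp add: mult_ac)
  then show "a * \<iota> * 10 ^ 6 \<le> \<eta> * \<alpha> ^ 3 * \<sigma>0" using N_ge by simp
  have "a * 10 ^ 6 * N = 3 * 10 ^ 6 * (\<eta> * (\<sigma>n\<^sup>2 * d)) * 1" using N_ge by (simp add: a_def)
  also have "\<dots> \<le> C\<^sup>2 * (\<eta> * (\<sigma>n\<^sup>2 * d)) * l\<^sup>2"
  proof (intro mult_mono)
    have "1000000 * 1000000 \<le> C * C" using C_large by (intro mult_mono) auto
    then show "3 * 10 ^ 6 \<le> C\<^sup>2" by (simp add: power2_eq_square)
  qed (use pos d_ge l_ge in auto)
  also have "\<dots> = \<eta> * (C\<^sup>2 * (\<sigma>n\<^sup>2 * d) * l\<^sup>2)" by simp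
  also have "\<dots> \<le> \<eta> * (\<alpha>\<^sup>2 * N)" using signal_dominates pos by (intro mult_left_mono) auto
  finally have "a * 10 ^ 6 * N \<le> \<eta> * \<alpha>\<^sup>2 * N" by simp
  then show "a * 10 ^ 6 \<le> \<eta> * \<alpha>\<^sup>2" using N_ge by simp
qed

lemma step_le: "\<eta> * \<alpha>\<^sup>2 * l * 10 ^ 6 \<le> 1"
proof -
  have "\<eta> * \<alpha>\<^sup>2 * l * 10 ^ 6 \<le> \<eta> * \<alpha>\<^sup>2 * l * C" using C_ge pos l_ge by (intro mult_left_mono) auto
  then show ?thesis using \<eta>_le by linarith
qed

lemma \<omega>_le: "\<omega> \<ge> 0" "m * (\<alpha> * \<omega>) ^ 3 \<le> 1 / 100"
proof -
  show "\<omega> \<ge> 0" unfolding \<omega>_def using pos l_ge by simp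
  define M where "M = m powr (2/3)"
  have M3: "M ^ 3 = m\<^sup>2" unfolding M_def using m_ge by (simp add: powr_power)
  have M0: "M > 0" unfolding M_def using m_ge by simp
  have "\<alpha> * \<omega> * M = 2 * (\<sigma>0 * (\<alpha> * M)) * sqrt l" by (simp add: \<omega>_def real_sqrt_mult)
  also have "\<dots> \<le> 2 * (\<sigma>0 * (\<alpha> * M)) * l"
    using sqrt_2l pos M0 by (intro mult_left_mono) auto
  also have "\<dots> * 1000 \<le> 2 * (\<sigma>0 * (\<alpha> * M) * l * C)"
    using pos M0 l_ge C_large mult_left_mono[of 1000 C "2 * (\<sigma>0 * (\<alpha> * M)) * l"] by (simp add: mult_ac)
  also have "\<dots> \<le> 2" using \<sigma>0_le(1) by (simp add: M_def)
  finally have aM: "\<alpha> * \<omega> * M \<le> 1 / 500" by linarith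
  have "(\<alpha> * \<omega> * M) ^ 3 \<le> (1 / 500) ^ 3"
    using aM pos \<open>\<omega> \<ge> 0\<close> M0 by (intro power_mono) auto
  also have "\<dots> \<le> 1 / 100" by (simp add: power3_eq_cube)
  finally have "(\<alpha> * \<omega>) ^ 3 * m\<^sup>2 \<le> 1 / 100" unfolding power_mult_distrib[of _ M] M3 .
  moreover have "(\<alpha> * \<omega>) ^ 3 * m \<le> (\<alpha> * \<omega>) ^ 3 * m\<^sup>2"
    using pos \<open>\<omega> \<ge> 0\<close> m_ge by (intro mult_left_mono) (auto simp: power2_eq_square)
  ultimately show "m * (\<alpha> * \<omega>) ^ 3 \<le> 1 / 100" by (simp add: mult.commute)
qed

lemma T_le: "C * N \<le> T * (\<eta> * \<sigma>0 * (\<sigma>n ^ 3 * sqrt d ^ 3))"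
proof -
  have "\<eta> * \<sigma>0 * (\<sigma>n ^ 3 * sqrt d ^ 3) > 0" using pos d_ge by simp
  then show ?thesis using cond_T unfolding d32 by (simp add: field_simps)
qed

text \<open>\<open>1 / (a \<rho>)\<close> is, up to a constant, the time scale of the horizon
  condition: \<open>T a \<rho> N\<close> is 3/4 of the quantity bounded in
  \<open>T_le\<close>.\<close>

lemma horizon_noise: "T * a * \<rho> > 32"
proof -
  have "32 * N < 3 / 4 * (C * N)" using C_large N_ge by simp
  also have "\<dots> \<le> 3 / 4 * (T * (\<eta> * \<sigma>0 * (\<sigma>n ^ 3 * sqrt d ^ 3)))" using T_le by simp
  also have "\<dots> = T * a * \<rho> * N"
    using N_ge d_ge by (simp add: a_def \<rho>_def power3_eq_cube power2_eq_square)
  finally show ?thesis using N_ge by simp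
qed

text \<open>Multiplying \<open>T_le\<close> by \<open>signal_dominates\<close> cancels the noise
  scale: a horizon long enough for memorization is long enough for the signal.\<close>

lemma horizon_signal: "T * (\<eta> * \<alpha> ^ 3 * \<sigma>0) \<ge> 1000 * l"
proof -
  define D where "D = \<sigma>n ^ 3 * sqrt d ^ 3"
  have D0: "D > 0" unfolding D_def using pos d_ge by simp
  have TN: "C * N \<le> T * (\<eta> * \<sigma>0 * D)" using T_le by (simp add: D_def)
  have "1000 * l * D * N \<le> C ^ 3 * l ^ 3 * D * (C * N)"
  proof (intro mult_mono)
    have "(1000000 :: real) ^ 3 \<le> C ^ 3" using C_large by (intro power_mono) auto
    then show "1000 \<le> C ^ 3" by simp
    have "l * 1 \<le> l * l\<^sup>2" using l_ge by (intro mult_left_mono) auto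
    then show "l \<le> l ^ 3" by (simp add: power3_eq_cube power2_eq_square)
    show "N \<le> C * N" using C_large N_ge by simp
  qed (use l_ge D0 N_ge C_large in auto)
  also have "\<dots> = (C ^ 3 * D * l ^ 3) * (C * N)" by simp
  also have "\<dots> \<le> (\<alpha> ^ 3 * N) * (T * (\<eta> * \<sigma>0 * D))"
    by (rule mult_mono[OF signal_dominates(1)[folded D_def] TN]) (use pos N_ge C_pos in auto)
  finally have "(1000 * l) * (D * N) \<le> (T * (\<eta> * \<alpha> ^ 3 * \<sigma>0)) * (D * N)" by (simp add: mult_ac)
  then show ?thesis using D0 N_ge by simp
qed

text \<open>The signal rate per step is at most 1, so \<open>horizon_signal\<close> bounds
  \<open>T\<close> itself. The value 16 absorbs the constant in the logarithm of the sup-norm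
  bound.\<close>

lemma T_ge: "T \<ge> 16"
proof -
  have "\<eta> * (\<alpha> ^ 3 * \<sigma>0) * 1 \<le> \<eta> * (\<alpha> ^ 3 * \<sigma>0) * (l * C)"
  proof (rule mult_left_mono)
    have "1 * 1 \<le> l * C" using l_ge C_large by (intro mult_mono) auto
    then show "1 \<le> l * C" by simp
  qed (use pos in auto)
  then have "\<eta> * \<alpha> ^ 3 * \<sigma>0 \<le> 1" using \<eta>_le(3) by (simp add: mult_ac)
  then have "T * (\<eta> * \<alpha> ^ 3 * \<sigma>0) \<le> T * 1" using T_ge1 by (intro mult_left_mono) auto
  then show ?thesis using horizon_signal l_ge by linarith
qed

lemma \<epsilon>_le: "\<epsilon> \<le> \<alpha> / 100"
proof -
  have "\<epsilon> \<le> (1 / C) * \<alpha>" using cond_\<epsilon>(2) C_pos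
    by (smt (verit) divide_nonneg_nonneg min.cobounded1 mult_left_mono)
  also have "\<dots> \<le> (1 / 100) * \<alpha>" using C_large pos by (intro mult_right_mono divide_left_mono) auto
  finally show ?thesis by simp
qed

section \<open>Budget of the attack\<close>

definition "X = ln (T * d * N * P / \<delta>)"

text \<open>This logarithm has \<open>d\<close> where \<open>l\<close> has \<open>m\<close>, and
  \<open>m \<le> d\<close>.\<close>

lemma X_ge: "X \<ge> l" "X \<ge> ln (16 * d * N * P / \<delta>)" "ln (16 * d * N * P / \<delta>) \<ge> 1" "X \<ge> ln d"
proof -
  note nn = N_ge cond_P \<delta> d_ge m_ge T_ge
  have "T * N * m * P / \<delta> \<le> T * d * N * P / \<delta>"
    using nn sqrt_d(4) by (intro divide_right_mono) (auto simp: mult_ac)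
  then show "X \<ge> l" unfolding X_def l_def using prod_ge(4) nn by (intro ln_mono) auto
  have "16 * d * N * P / \<delta> \<le> T * d * N * P / \<delta>"
    using nn by (intro divide_right_mono mult_right_mono) auto
  then show "X \<ge> ln (16 * d * N * P / \<delta>)" unfolding X_def using nn by (intro ln_mono) auto
  have "d * 1 * 1 \<le> d * N * P" using nn by (intro mult_mono) auto
  then have P1: "d \<le> d * N * P" "1 \<le> d * N * P" using d_ge by linarith+
  have i: "16 * (d * N * P) \<le> 16 * (d * N * P) / \<delta>" using P1 by (intro inv\<delta>) auto
  then have "16 \<le> 16 * d * N * P / \<delta>" using P1 by (simp add: mult_ac)
  moreover have "exp 1 \<le> (16 :: real)" using exp_le by linarith
  ultimately show "ln (16 * d * N * P / \<delta>) \<ge> 1"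
    by (metis exp_gt_zero ln_exp ln_mono order_trans)
  have "d \<le> 16 * (d * N * P) / \<delta>" using i P1 d_ge by linarith
  then have "d \<le> 16 * d * N * P / \<delta>" by (simp add: mult_ac)
  then have "ln d \<le> ln (16 * d * N * P / \<delta>)" using nn by (intro ln_mono) auto
  then show "X \<ge> ln d" using \<open>X \<ge> ln (16 * d * N * P / \<delta>)\<close> by linarith
qed

lemma \<epsilon>_ge: "\<epsilon> \<ge> C * \<sigma>n * m * X"
proof -
  have "C * \<sigma>n * m * X = C * \<sigma>n * m * 1 * X" by simp
  also have "\<dots> \<le> C * \<sigma>n * m * sqrt P * X"
    using pos C_pos m_ge cond_P X_ge(1) l_ge by (intro mult_right_mono mult_left_mono) auto
  also have "\<dots> \<le> \<epsilon>" using cond_\<epsilon>(1) by (simp add: X_def)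
  finally show ?thesis .
qed

text \<open>\<open>\<mu>\<close> is the largest factor by which a training noise patch can be scaled
  within half the budget per coordinate. It is at least \<open>C m sqrt X / 4\<close>, so its cube
  beats the \<open>1 / m^2\<close> of the memorized output and the \<open>12 l\<close> of the
  signal.\<close>

lemma attack_budget:
  defines "\<mu> \<equiv> \<epsilon> / (2 * (\<sigma>n * sqrt (2 * ln (16 * d * N * P / \<delta>))))"
  shows "\<mu> > 0" "\<mu> ^ 3 * (1 / (1024 * m\<^sup>2)) > 12 * l"
proof -
  define Z where "Z = ln (16 * d * N * P / \<delta>)"
  have Z: "Z \<ge> 1" "Z \<le> X" using X_ge by (auto simp: Z_def)
  show l0: "\<mu> > 0" unfolding \<mu>_def using Z pos by (simp flip: Z_def)
  have s: "sqrt (2 * Z) \<le> 2 * sqrt X"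
    using Z by (intro real_le_lsqrt) (auto simp: power_mult_distrib)
  have sX: "sqrt X \<ge> 1" using Z by simp
  have den: "0 < 2 * (\<sigma>n * sqrt (2 * Z))" using pos Z by simp
  have "C * m * sqrt X / 4 = C * \<sigma>n * m * X / (2 * (\<sigma>n * (2 * sqrt X)))"
    using sX pos Z by (simp add: field_simps)
  also have "\<dots> \<le> \<epsilon> / (2 * (\<sigma>n * (2 * sqrt X)))"
    using \<epsilon>_ge pos sX by (intro divide_right_mono) auto
  also have "\<dots> \<le> \<mu>"
    unfolding \<mu>_def Z_def[symmetric] using s pos den sX Z by (intro divide_left_mono mult_left_mono mult_pos_pos) auto
  finally have "\<mu> \<ge> C * m * sqrt X / 4" .
  then have "\<mu> ^ 3 \<ge> (C * m * sqrt X / 4) ^ 3"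
    using C_pos m_ge sX by (intro power_mono) auto
  moreover have "(C * m * sqrt X / 4) ^ 3 = C ^ 3 * m ^ 3 * (X * sqrt X) / 64"
    using Z by (simp add: power_mult_distrib power_divide power3_eq_cube)
  moreover have "C ^ 3 * m ^ 3 * (X * sqrt X) \<ge> 1000000000000 * m\<^sup>2 * (X * 1)"
  proof (intro mult_mono)
    have "(1000000 :: real) ^ 3 \<le> C ^ 3" using C_large by (intro power_mono) auto
    then show "1000000000000 \<le> C ^ 3" by simp
    show "m\<^sup>2 \<le> m ^ 3" using m_ge by (intro power_increasing) auto
  qed (use Z sX m_ge C_pos in auto)
  ultimately have "\<mu> ^ 3 \<ge> 1000000000000 * m\<^sup>2 * X / 64" by simp
  then have "\<mu> ^ 3 * (1 / (1024 * m\<^sup>2)) \<ge> 1000000000000 * m\<^sup>2 * X / 64 * (1 / (1024 * m\<^sup>2))"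
    by (intro mult_right_mono) auto
  also have "1000000000000 * m\<^sup>2 * X / 64 * (1 / (1024 * m\<^sup>2)) = 1000000000000 / 65536 * X"
    using m_ge by simp
  finally show "\<mu> ^ 3 * (1 / (1024 * m\<^sup>2)) > 12 * l" using X_ge(1) Z by simp
qed

end

section \<open>Gaussian test noise\<close>

lemma act_cube: "act x - act (- x) = x ^ 3"
  by (auto simp: act_def max_def)

lemma act'_sum: "act' x + act' (- x) = 3 * x\<^sup>2"
  by (auto simp: act'_def max_def)

lemma fnet_cube: "fnet m P d W X = (\<Sum>r<m. \<Sum>p<P. inner_d d (W r) (X p) ^ 3)"
  by (simp add: fnet_def act_cube)

text \<open>Comparison with the density of doubled variance: the ratio is
  \<open>sqrt 2 * exp (- x^2 / (4 \<sigma>^2))\<close>, which is bounded by its value at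
  \<open>t\<close> on the tail.\<close>

lemma normal_tail:
  assumes "\<sigma> > 0" "t \<ge> 0"
  shows "emeasure (density lborel (normal_density 0 \<sigma>)) {x. \<bar>x\<bar> > t} \<le> ennreal (sqrt 2 * exp (- t\<^sup>2 / (4 * \<sigma>\<^sup>2)))"
proof -
  let ?c = "sqrt 2 * exp (- t\<^sup>2 / (4 * \<sigma>\<^sup>2))"
  have le: "normal_density 0 \<sigma> x \<le> ?c * normal_density 0 (sqrt 2 * \<sigma>) x" if "\<bar>x\<bar> > t" for x
  proof -
    have "t\<^sup>2 \<le> x\<^sup>2" using that assms by (metis abs_le_square_iff abs_of_nonneg less_imp_le)
    then have "t\<^sup>2 / (4 * \<sigma>\<^sup>2) \<le> x\<^sup>2 / (4 * \<sigma>\<^sup>2)" by (intro divide_right_mono) auto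
    then have "exp (- x\<^sup>2 / (4 * \<sigma>\<^sup>2)) \<le> exp (- t\<^sup>2 / (4 * \<sigma>\<^sup>2))" by simp
    then have "exp (- x\<^sup>2 / (4 * \<sigma>\<^sup>2)) * exp (- x\<^sup>2 / (4 * \<sigma>\<^sup>2)) \<le> exp (- t\<^sup>2 / (4 * \<sigma>\<^sup>2)) * exp (- x\<^sup>2 / (4 * \<sigma>\<^sup>2))"
      by (intro mult_right_mono) auto
    moreover have "exp (- x\<^sup>2 / (4 * \<sigma>\<^sup>2)) * exp (- x\<^sup>2 / (4 * \<sigma>\<^sup>2)) = exp (- x\<^sup>2 / (2 * \<sigma>\<^sup>2))"
      by (simp flip: exp_add)
    ultimately have "exp (- x\<^sup>2 / (2 * \<sigma>\<^sup>2)) \<le> exp (- t\<^sup>2 / (4 * \<sigma>\<^sup>2)) * exp (- x\<^sup>2 / (4 * \<sigma>\<^sup>2))" by linarith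
    note e = this
    define A where "A = 1 / sqrt (2 * pi * \<sigma>\<^sup>2)"
    define B where "B = 1 / sqrt (2 * pi * (sqrt 2 * \<sigma>)\<^sup>2)"
    have AB: "A = sqrt 2 * B"
      using assms by (simp add: A_def B_def real_sqrt_mult power_mult_distrib field_simps)
    have "normal_density 0 \<sigma> x = A * exp (- x\<^sup>2 / (2 * \<sigma>\<^sup>2))"
      by (simp add: normal_density_def A_def)
    also have "\<dots> \<le> A * (exp (- t\<^sup>2 / (4 * \<sigma>\<^sup>2)) * exp (- x\<^sup>2 / (4 * \<sigma>\<^sup>2)))"
      using e by (intro mult_left_mono) (auto simp: A_def)
    also have "\<dots> = ?c * (B * exp (- x\<^sup>2 / (4 * \<sigma>\<^sup>2)))" by (simp add: AB)
    also have "B * exp (- x\<^sup>2 / (4 * \<sigma>\<^sup>2)) = normal_density 0 (sqrt 2 * \<sigma>) x"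
      unfolding normal_density_def B_def by (simp add: power_mult_distrib)
    finally show ?thesis .
  qed
  have "emeasure (density lborel (normal_density 0 \<sigma>)) {x. \<bar>x\<bar> > t}
      = (\<integral>\<^sup>+x. ennreal (normal_density 0 \<sigma> x) * indicator {x. \<bar>x\<bar> > t} x \<partial>lborel)"
    by (subst emeasure_density) auto
  also have "\<dots> \<le> (\<integral>\<^sup>+x. ennreal ?c * ennreal (normal_density 0 (sqrt 2 * \<sigma>) x) \<partial>lborel)"
    using le by (intro nn_integral_mono) (auto simp: indicator_def ennreal_mult[symmetric] intro!: ennreal_leI)
  also have "\<dots> = ennreal ?c * (\<integral>\<^sup>+x. ennreal (normal_density 0 (sqrt 2 * \<sigma>) x) \<partial>lborel)"
    by (intro nn_integral_cmult) auto
  also have "(\<integral>\<^sup>+x. ennreal (normal_density 0 (sqrt 2 * \<sigma>) x) \<partial>lborel) = 1"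
  proof -
    interpret prob_space "density lborel (normal_density 0 (sqrt 2 * \<sigma>))"
      using assms by (intro prob_space_normal_density) auto
    have "emeasure (density lborel (normal_density 0 (sqrt 2 * \<sigma>))) UNIV
        = (\<integral>\<^sup>+x. ennreal (normal_density 0 (sqrt 2 * \<sigma>) x) \<partial>lborel)"
      by (subst emeasure_density) auto
    then show ?thesis using emeasure_space_1 by simp
  qed
  finally show ?thesis by simp
qed

lemma prob_space_noise_M: "\<sigma> > 0 \<Longrightarrow> prob_space (noise_M P d \<sigma>)"
  unfolding noise_M_def by (intro prob_space_PiM prob_space_normal_density)

lemma noise_M_component [measurable]:
  "i \<in> {..<P} \<times> {1..<d - 1} \<Longrightarrow> (\<lambda>G. G i) \<in> borel_measurable (noise_M P d \<sigma>)"
proof -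
  assume i: "i \<in> {..<P} \<times> {1..<d - 1}"
  have "(\<lambda>G. G i) \<in> noise_M P d \<sigma> \<rightarrow>\<^sub>M density lborel (normal_density 0 \<sigma>)"
    unfolding noise_M_def by (rule measurable_component_singleton[OF i])
  also have "noise_M P d \<sigma> \<rightarrow>\<^sub>M density lborel (normal_density 0 \<sigma>) = borel_measurable (noise_M P d \<sigma>)"
    by (rule measurable_cong_sets) auto
  finally show ?thesis .
qed

lemma noise_tail_component:
  assumes "\<sigma> > 0" "t \<ge> 0" "i \<in> {..<P} \<times> {1..<d - 1}"
  shows "measure (noise_M P d \<sigma>) {G \<in> space (noise_M P d \<sigma>). \<bar>G i\<bar> > t} \<le> sqrt 2 * exp (- t\<^sup>2 / (4 * \<sigma>\<^sup>2))"
proof -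
  let ?N = "density lborel (normal_density 0 \<sigma>)"
  let ?M = "noise_M P d \<sigma>"
  have d: "distr ?M ?N (\<lambda>G. G i) = ?N"
    unfolding noise_M_def using assms by (intro distr_PiM_component prob_space_normal_density) auto
  have meas: "(\<lambda>G. G i) \<in> ?M \<rightarrow>\<^sub>M ?N"
    unfolding noise_M_def by (rule measurable_component_singleton[OF assms(3)])
  have "emeasure ?N {x. \<bar>x\<bar> > t} = emeasure (distr ?M ?N (\<lambda>G. G i)) {x. \<bar>x\<bar> > t}" by (simp add: d)
  also have "\<dots> = emeasure ?M ((\<lambda>G. G i) -` {x. \<bar>x\<bar> > t} \<inter> space ?M)"
    by (intro emeasure_distr meas) auto
  also have "(\<lambda>G. G i) -` {x. \<bar>x\<bar> > t} \<inter> space ?M = {G \<in> space ?M. \<bar>G i\<bar> > t}" by auto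
  finally have "emeasure ?M {G \<in> space ?M. \<bar>G i\<bar> > t} \<le> ennreal (sqrt 2 * exp (- t\<^sup>2 / (4 * \<sigma>\<^sup>2)))"
    using normal_tail[OF assms(1,2)] by simp
  then show ?thesis unfolding measure_def by (intro enn2real_leI) auto
qed

lemma noise_tail:
  assumes "\<sigma> > 0" "t \<ge> 0"
  shows "measure (noise_M P d \<sigma>) {G \<in> space (noise_M P d \<sigma>). \<exists>i\<in>{..<P} \<times> {1..<d - 1}. \<bar>G i\<bar> > t}
     \<le> real P * real d * (sqrt 2 * exp (- t\<^sup>2 / (4 * \<sigma>\<^sup>2)))"
proof -
  let ?M = "noise_M P d \<sigma>" and ?I = "{..<P} \<times> {1..<d - 1}"
  interpret prob_space ?M by (rule prob_space_noise_M[OF assms(1)])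
  have "{G \<in> space ?M. \<exists>i\<in>?I. \<bar>G i\<bar> > t} = (\<Union>i\<in>?I. {G \<in> space ?M. \<bar>G i\<bar> > t})" by auto
  also have "measure ?M \<dots> \<le> (\<Sum>i\<in>?I. measure ?M {G \<in> space ?M. \<bar>G i\<bar> > t})"
  proof (rule finite_measure_subadditive_finite)
    have "{G \<in> space ?M. \<bar>G i\<bar> > t} \<in> sets ?M" if [measurable]: "i \<in> ?I" for i by measurable
    then show "(\<lambda>i. {G \<in> space ?M. \<bar>G i\<bar> > t}) ` ?I \<subseteq> sets ?M" by auto
  qed auto
  also have "\<dots> \<le> (\<Sum>i\<in>?I. sqrt 2 * exp (- t\<^sup>2 / (4 * \<sigma>\<^sup>2)))"
    by (intro sum_mono noise_tail_component assms)
  also have "\<dots> = real (card ?I) * (sqrt 2 * exp (- t\<^sup>2 / (4 * \<sigma>\<^sup>2)))" by simp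
  also have "real (card ?I) \<le> real P * real d"
    unfolding card_cartesian_product of_nat_mult by (intro mult_mono) auto
  then have "real (card ?I) * (sqrt 2 * exp (- t\<^sup>2 / (4 * \<sigma>\<^sup>2))) \<le> real P * real d * (sqrt 2 * exp (- t\<^sup>2 / (4 * \<sigma>\<^sup>2)))"
    by (intro mult_right_mono) auto
  finally show ?thesis .
qed

section \<open>Measurability of robust failure\<close>

text \<open>Robust failure quantifies over uncountably many perturbations.  As the failure condition is open,
  the rational grids below suffice, which makes the event measurable.\<close>

definition grid_pert :: "real \<Rightarrow> nat \<Rightarrow> (nat \<times> nat \<Rightarrow> int) \<Rightarrow> nat \<Rightarrow> nat \<Rightarrow> real" where
  "grid_pert \<epsilon> n k = (\<lambda>p j. \<epsilon> * (real_of_int (k (p, j)) / real (Suc n)))"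

lemma fnet_tendsto:
  assumes "\<And>p j. p < P \<Longrightarrow> j < d \<Longrightarrow> (\<lambda>n. X n p j) \<longlonglongrightarrow> Y p j"
  shows "(\<lambda>n. fnet m P d W (X n)) \<longlonglongrightarrow> fnet m P d W Y"
  unfolding fnet_cube inner_d_def
  by (intro tendsto_sum tendsto_power tendsto_mult tendsto_const assms) auto

lemma fnet_cong:
  assumes "\<And>p j. p < P \<Longrightarrow> j < d \<Longrightarrow> X p j = Y p j"
  shows "fnet m P d W X = fnet m P d W Y"
  unfolding fnet_def inner_d_def using assms by (auto intro!: sum.cong arg_cong2[where f = "(-)"] arg_cong[where f = act])

lemma rob_fail_grid:
  assumes \<epsilon>: "ieps S > 0"
  shows "rob_fail S W y X \<longleftrightarrow> (\<exists>n. \<exists>k\<in>PiE ({..<iP S} \<times> {..<idim S}) (\<lambda>_. {- int (Suc n)..int (Suc n)}).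
      y * f_of S W (\<lambda>p j. X p j + grid_pert (ieps S) n k p j) < 0)" (is "?L \<longleftrightarrow> ?R")
proof
  let ?I = "{..<iP S} \<times> {..<idim S}" and ?\<epsilon> = "ieps S"
  assume ?L
  then obtain \<delta> where \<delta>: "\<And>p j. p < iP S \<Longrightarrow> j < idim S \<Longrightarrow> \<bar>\<delta> p j\<bar> \<le> ?\<epsilon>"
    and neg: "y * f_of S W (\<lambda>p j. X p j + \<delta> p j) < 0" unfolding rob_fail_def by blast
  \<comment> \<open>Rounding \<open>\<delta> / \<epsilon>\<close> down to a multiple of
    \<open>1 / (n + 1)\<close> stays within \<open>[-1, 1]\<close>, because both endpoints are grid
    points.\<close>
  define k where "k n = restrict (\<lambda>(p, j). \<lfloor>real (Suc n) * (\<delta> p j / ?\<epsilon>)\<rfloor>) ?I" for n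
  have kin: "k n \<in> PiE ?I (\<lambda>_. {- int (Suc n)..int (Suc n)})" for n
  proof (intro PiE_I)
    fix i assume i: "i \<in> ?I"
    obtain p j where pj: "i = (p, j)" "p < iP S" "j < idim S" using i by auto
    have "\<bar>\<delta> p j / ?\<epsilon>\<bar> \<le> 1" using \<delta>[OF pj(2,3)] \<epsilon> by (simp add: abs_le_iff field_simps)
    then have b: "-1 \<le> \<delta> p j / ?\<epsilon>" "\<delta> p j / ?\<epsilon> \<le> 1" by linarith+
    have "real (Suc n) * (-1) \<le> real (Suc n) * (\<delta> p j / ?\<epsilon>)" "real (Suc n) * (\<delta> p j / ?\<epsilon>) \<le> real (Suc n) * 1"
      using b by (intro mult_left_mono; simp)+
    then have "- int (Suc n) \<le> \<lfloor>real (Suc n) * (\<delta> p j / ?\<epsilon>)\<rfloor>" "\<lfloor>real (Suc n) * (\<delta> p j / ?\<epsilon>)\<rfloor> \<le> int (Suc n)"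
      by (simp_all only: le_floor_iff floor_le_iff) auto
    then show "k n i \<in> {- int (Suc n)..int (Suc n)}" using pj by (simp add: k_def)
  qed (auto simp: k_def)
  have lim: "(\<lambda>n. grid_pert ?\<epsilon> n (k n) p j) \<longlonglongrightarrow> \<delta> p j" if "p < iP S" "j < idim S" for p j
  proof -
    define r where "r = \<delta> p j / ?\<epsilon>"
    have "(\<lambda>n. real_of_int \<lfloor>real (Suc n) * r\<rfloor> / real (Suc n)) \<longlonglongrightarrow> r"
    proof (rule tendsto_sandwich)
      show "\<forall>\<^sub>F n in sequentially. r - 1 / real (Suc n) \<le> real_of_int \<lfloor>real (Suc n) * r\<rfloor> / real (Suc n)"
      proof (rule always_eventually, rule allI)
        fix n
        have "real (Suc n) * r - 1 \<le> real_of_int \<lfloor>real (Suc n) * r\<rfloor>" by linarith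
        then have "(real (Suc n) * r - 1) / real (Suc n) \<le> real_of_int \<lfloor>real (Suc n) * r\<rfloor> / real (Suc n)"
          by (rule divide_right_mono) simp
        then show "r - 1 / real (Suc n) \<le> real_of_int \<lfloor>real (Suc n) * r\<rfloor> / real (Suc n)"
          by (simp add: diff_divide_distrib del: of_nat_Suc)
      qed
      show "\<forall>\<^sub>F n in sequentially. real_of_int \<lfloor>real (Suc n) * r\<rfloor> / real (Suc n) \<le> r"
      proof (rule always_eventually, rule allI)
        fix n
        have "real_of_int \<lfloor>real (Suc n) * r\<rfloor> / real (Suc n) \<le> (real (Suc n) * r) / real (Suc n)"
          by (rule divide_right_mono) (use of_int_floor_le in auto)
        then show "real_of_int \<lfloor>real (Suc n) * r\<rfloor> / real (Suc n) \<le> r"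
          by (simp del: of_nat_Suc)
      qed
      have "(\<lambda>n. r - 1 / real (Suc n)) \<longlonglongrightarrow> r - 0"
        by (intro tendsto_diff tendsto_const LIMSEQ_Suc[OF lim_1_over_n])
      then show "(\<lambda>n. r - 1 / real (Suc n)) \<longlonglongrightarrow> r" by simp
    qed simp
    then have "(\<lambda>n. ?\<epsilon> * (real_of_int \<lfloor>real (Suc n) * r\<rfloor> / real (Suc n))) \<longlonglongrightarrow> ?\<epsilon> * r"
      by (intro tendsto_mult tendsto_const)
    then show ?thesis using that \<epsilon> by (simp add: grid_pert_def k_def r_def)
  qed
  have "(\<lambda>n. y * f_of S W (\<lambda>p j. X p j + grid_pert ?\<epsilon> n (k n) p j)) \<longlonglongrightarrow> y * f_of S W (\<lambda>p j. X p j + \<delta> p j)"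
    by (intro tendsto_mult tendsto_const fnet_tendsto tendsto_add lim)
  then have "\<forall>\<^sub>F n in sequentially. y * f_of S W (\<lambda>p j. X p j + grid_pert ?\<epsilon> n (k n) p j) < 0"
    using neg by (rule order_tendstoD(2))
  then obtain n where "y * f_of S W (\<lambda>p j. X p j + grid_pert ?\<epsilon> n (k n) p j) < 0"
    by (auto simp: eventually_sequentially)
  then show ?R using kin by blast
next
  let ?I = "{..<iP S} \<times> {..<idim S}" and ?\<epsilon> = "ieps S"
  assume ?R
  then obtain n k where k: "k \<in> PiE ?I (\<lambda>_. {- int (Suc n)..int (Suc n)})"
    and neg: "y * f_of S W (\<lambda>p j. X p j + grid_pert ?\<epsilon> n k p j) < 0" by blast
  have "\<bar>grid_pert ?\<epsilon> n k p j\<bar> \<le> ?\<epsilon>" if "p < iP S" "j < idim S" for p j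
  proof -
    have "k (p, j) \<in> {- int (Suc n)..int (Suc n)}" using PiE_mem[OF k, of "(p, j)"] that by simp
    then have "\<bar>real_of_int (k (p, j))\<bar> \<le> real (Suc n)" by auto
    then have "\<bar>real_of_int (k (p, j)) / real (Suc n)\<bar> \<le> 1" by (simp add: abs_divide del: of_nat_Suc)
    then have "?\<epsilon> * \<bar>real_of_int (k (p, j)) / real (Suc n)\<bar> \<le> ?\<epsilon> * 1" using \<epsilon> by (intro mult_left_mono) auto
    then show ?thesis using \<epsilon> by (simp add: grid_pert_def abs_mult)
  qed
  then show ?L using neg unfolding rob_fail_def by blast
qed

lemma rob_fail_measurable:
  assumes \<epsilon>: "ieps S > 0"
  shows "{G \<in> space (noise_M (iP S) (idim S) \<sigma>). rob_fail S W y (test_X \<alpha> (idim S) s y G)}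
     \<in> sets (noise_M (iP S) (idim S) \<sigma>)"
proof -
  let ?M = "noise_M (iP S) (idim S) \<sigma>"
  let ?f = "\<lambda>n k G. y * f_of S W (\<lambda>p j. test_X \<alpha> (idim S) s y G p j + grid_pert (ieps S) n k p j)"
  have X: "(\<lambda>G. test_X \<alpha> (idim S) s y G p j) \<in> borel_measurable ?M" if "p < iP S" "j < idim S" for p j
  proof -
    have "(\<lambda>G. G (p, j)) \<in> borel_measurable ?M" if "1 \<le> j" "j < idim S - 1"
      using that \<open>p < iP S\<close> by (intro noise_M_component) auto
    then show ?thesis
      unfolding test_X_def by (cases "p = s"; cases "Suc 0 \<le> j"; cases "j < idim S - Suc 0") simp_all
  qed
  have m: "?f n k \<in> borel_measurable ?M" for n k
    unfolding fnet_cube inner_d_def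
    by (intro borel_measurable_times borel_measurable_const borel_measurable_sum borel_measurable_power
        borel_measurable_add X) auto
  have "{G \<in> space ?M. rob_fail S W y (test_X \<alpha> (idim S) s y G)} =
    (\<Union>n. \<Union>k\<in>PiE ({..<iP S} \<times> {..<idim S}) (\<lambda>_. {- int (Suc n)..int (Suc n)}). {G \<in> space ?M. ?f n k G < 0})"
    unfolding rob_fail_grid[OF \<epsilon>] by blast
  also have "\<dots> \<in> sets ?M"
  proof (intro sets.countable_UN sets.finite_UN image_subsetI)
    fix n k show "{G \<in> space ?M. ?f n k G < 0} \<in> sets ?M"
      using m[of n k] by measurable
  qed (auto intro!: finite_PiE)
  finally show ?thesis .
qed

section \<open>The training run\<close>

lemma inner_d_cong:
  "(\<And>j. j < d \<Longrightarrow> a j = a' j) \<Longrightarrow> (\<And>j. j < d \<Longrightarrow> b j = b' j) \<Longrightarrow> inner_d d a b = inner_d d a' b'"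
  unfolding inner_d_def by (auto intro: sum.cong)

lemma inner_d_commute: "inner_d d a b = inner_d d b a"
  by (simp add: inner_d_def mult.commute)

lemma inner_d_scale: "inner_d d a (\<lambda>j. c * b j) = c * inner_d d a b"
  by (simp add: inner_d_def sum_distrib_left mult_ac)

lemma inner_d_add_sum:
  "inner_d d (\<lambda>j. a j + e * (\<Sum>i\<in>I. c i * (\<Sum>p\<in>J. h i p * b i p j))) v
    = inner_d d a v + e * (\<Sum>i\<in>I. c i * (\<Sum>p\<in>J. h i p * inner_d d (b i p) v))"
proof -
  have "(\<Sum>j<d. (\<Sum>i\<in>I. c i * (\<Sum>p\<in>J. h i p * b i p j)) * v j)
      = (\<Sum>i\<in>I. c i * (\<Sum>p\<in>J. h i p * (\<Sum>j<d. b i p j * v j)))"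
    unfolding sum_distrib_left sum_distrib_right
    by (subst sum.swap, rule sum.cong[OF refl], subst sum.swap) (simp add: mult_ac)
  then show ?thesis
    by (simp add: inner_d_def distrib_right sum.distrib mult.assoc flip: sum_distrib_left)
qed

lemma inner_d_unit:
  "j0 < d \<Longrightarrow> inner_d d a (\<lambda>j. c * (if j = j0 then 1 else 0)) = c * a j0"
  unfolding inner_d_scale by (simp add: inner_d_def if_distrib[of "\<lambda>x. _ * x"] sum.delta cong: if_cong)

lemma logistic_le_iff: "logistic x \<le> logistic y \<longleftrightarrow> y \<le> x"
  by (simp add: logistic_def add_pos_pos)

locale at_run =
  fixes C :: real and A :: at_inst
    and W :: "nat \<Rightarrow> nat \<Rightarrow> nat \<Rightarrow> real" and Xa :: "nat \<Rightarrow> nat \<Rightarrow> nat \<Rightarrow> nat \<Rightarrow> real"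
  assumes C_ge: "C \<ge> 10 ^ 6" and params: "params_ok C A" and data: "data_ok A"
    and event: "event_E A" and traj: "AT_traj A W Xa"
begin

abbreviation "N \<equiv> iN A"
abbreviation "P \<equiv> iP A"
abbreviation "d \<equiv> idim A"
abbreviation "m \<equiv> im A"
abbreviation "T \<equiv> iT A"
abbreviation "\<alpha> \<equiv> ialpha A"
abbreviation "\<epsilon> \<equiv> ieps A"
abbreviation "y \<equiv> iy A"
abbreviation "s \<equiv> iS A"
abbreviation "x \<equiv> iX A"
abbreviation "SU \<equiv> iSU A"

lemma params_pos: "N > 0" "P > 0" "d > 0" "m > 0" "\<alpha> > 0" "isign A > 0" "isig0 A > 0" "ieta A > 0" "\<epsilon> > 0"
  "SU \<subseteq> {..<N}" "C / real N \<le> p_un A" "real m \<le> C * (ln (real d)) powr C"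
  using params unfolding params_ok_def Let_def by auto

sublocale prm: at_params C "real N" "real P" "real d" "real m" "real T" \<alpha> "isign A" "isig0 A" "ieta A" \<epsilon> "idelta A" "p_un A"
proof
  show "C \<ge> 10 ^ 6" by (rule C_ge)
  show "real T = 0 \<or> 1 \<le> real T" by auto
  show "1 \<le> real N" "1 \<le> real d" using params_pos by auto
  show "p_un A \<ge> 0" by simp
qed (use params in \<open>simp_all add: params_ok_def Let_def\<close>)

lemma d_ge_2: "d \<ge> 2" "0 < d - 1" "d - 1 < d" "0 \<noteq> d - 1"
proof -
  have "real d \<ge> 2" using prm.sqrt_d(4) prm.m_ge(1) by linarith
  then show "d \<ge> 2" "0 < d - 1" "d - 1 < d" "0 \<noteq> d - 1" by auto
qed

definition "Q k = {..<P} - {s k}"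
definition "SL = {..<N} - SU"
definition "w r t = W t r 0"
definition "z r j t = y (fst j) * inner_d d (W t r) (x (fst j) (snd j))"
definition "F k t = y k * f_of A (W t) (Xa t k)"
definition "g k t = y k * Xa t k (s k) 0"
text \<open>The labels are built in because \<open>z\<close> carries the label of its own
  sample.\<close>

definition "K i j = y (fst i) * y (fst j) * inner_d d (x (fst i) (snd i)) (x (fst j) (snd j)) / ((isign A)\<^sup>2 * real d)"
text \<open>The one-parameter family that contains every feasible attack, up to entries outside the
  index range.\<close>

definition "pert k c p j = (if p = s k then (1 + c) * x k p j else x k p j)" for k p j :: nat and c :: real

lemma y_sq: "k < N \<Longrightarrow> y k * y k = 1" "k < N \<Longrightarrow> (y k)\<^sup>2 = 1" "k < N \<Longrightarrow> y k ^ 3 = y k" "k < N \<Longrightarrow> \<bar>y k\<bar> = 1"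
proof -
  assume "k < N"
  then have "y k = 1 \<or> y k = -1" using data unfolding data_ok_def by blast
  then show "y k * y k = 1" "(y k)\<^sup>2 = 1" "y k ^ 3 = y k" "\<bar>y k\<bar> = 1" by auto
qed

lemma s_lt: "k < N \<Longrightarrow> s k < P"
  using data unfolding data_ok_def by blast

lemma signal_patch: "k < N \<Longrightarrow> j < d \<Longrightarrow>
    x k (s k) j = \<alpha> * y k * (if j = (if k \<in> SU then d - 1 else 0) then 1 else 0)"
  using data unfolding data_ok_def by blast

lemma noise_patch: "k < N \<Longrightarrow> q \<in> Q k \<Longrightarrow> x k q 0 = 0 \<and> x k q (d - 1) = 0"
  using data unfolding data_ok_def Q_def by blast

lemma inner_signal: "k < N \<Longrightarrow> inner_d d v (x k (s k)) = \<alpha> * y k * v (if k \<in> SU then d - 1 else 0)"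
proof -
  assume k: "k < N"
  have "inner_d d v (x k (s k)) = inner_d d v (\<lambda>j. \<alpha> * y k * (if j = (if k \<in> SU then d - 1 else 0) then 1 else 0))"
    using signal_patch[OF k] by (intro inner_d_cong) auto
  also have "\<dots> = \<alpha> * y k * v (if k \<in> SU then d - 1 else 0)"
    using params_pos by (intro inner_d_unit) auto
  finally show ?thesis .
qed

lemma inner_pert: "inner_d d v (pert k c p) = (if p = s k then 1 + c else 1) * inner_d d v (x k p)"
proof -
  have "pert k c p = (\<lambda>j. (if p = s k then 1 + c else 1) * x k p j)"
    by (simp add: pert_def fun_eq_iff)
  then show ?thesis by (simp add: inner_d_scale)
qed

lemma sum_patches: "k < N \<Longrightarrow> (\<Sum>p<P. h p) = h (s k) + (\<Sum>q\<in>Q k. h q)"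
  unfolding Q_def using s_lt[of k] by (intro sum.remove) auto

lemma pert_feasible: "k < N \<Longrightarrow> \<bar>c\<bar> * \<alpha> \<le> \<epsilon> \<Longrightarrow> adv_feasible A k (pert k c)"
proof -
  assume k: "k < N" and c: "\<bar>c\<bar> * \<alpha> \<le> \<epsilon>"
  have "\<bar>pert k c p j - x k p j\<bar> \<le> \<epsilon>" if "p < P" "j < d" for p j
  proof (cases "p = s k")
    case True
    then have "\<bar>pert k c p j - x k p j\<bar> = \<bar>c\<bar> * \<bar>x k (s k) j\<bar>" by (simp add: pert_def algebra_simps abs_mult[symmetric])
    also have "\<bar>x k (s k) j\<bar> \<le> \<alpha>"
      using signal_patch[OF k that(2)] y_sq(4)[OF k] params_pos by (simp add: abs_mult)
    then have "\<bar>c\<bar> * \<bar>x k (s k) j\<bar> \<le> \<bar>c\<bar> * \<alpha>" by (intro mult_left_mono) auto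
    finally show ?thesis using c by linarith
  qed (use params_pos in \<open>simp add: pert_def\<close>)
  moreover have "\<forall>p<P. \<forall>j<d. pert k c p j - x k p j = c * (if p = s k then x k p j else 0)"
    by (simp add: pert_def algebra_simps)
  ultimately show ?thesis unfolding adv_feasible_def by blast
qed

lemma adv: "k < N \<Longrightarrow> is_adv A (W t) k (Xa t k)"
  using traj unfolding AT_traj_def by blast

lemma Xa_ex: "k < N \<Longrightarrow> \<exists>c. \<bar>c\<bar> * \<alpha> \<le> \<epsilon> \<and> (\<forall>p<P. \<forall>j<d. Xa t k p j = pert k c p j)"
proof -
  assume k: "k < N"
  obtain c where b: "\<forall>p<P. \<forall>j<d. \<bar>Xa t k p j - x k p j\<bar> \<le> \<epsilon>"
    and c: "\<forall>p<P. \<forall>j<d. Xa t k p j - x k p j = c * (if p = s k then x k p j else 0)"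
    using adv[OF k, of t] unfolding is_adv_def adv_feasible_def by blast
  let ?j = "if k \<in> SU then d - 1 else 0"
  have j: "?j < d" using params_pos by auto
  have "Xa t k (s k) ?j - x k (s k) ?j = c * x k (s k) ?j" using c s_lt[OF k] j by simp
  then have "\<bar>c * x k (s k) ?j\<bar> \<le> \<epsilon>" using b s_lt[OF k] j by metis
  moreover have "\<bar>x k (s k) ?j\<bar> = \<alpha>" unfolding signal_patch[OF k j] using y_sq(4)[OF k] params_pos by (simp add: abs_mult)
  ultimately have "\<bar>c\<bar> * \<alpha> \<le> \<epsilon>" by (simp add: abs_mult)
  moreover have "Xa t k p j = pert k c p j" if "p < P" "j < d" for p j
  proof -
    have "Xa t k p j - x k p j = c * (if p = s k then x k p j else 0)" using c that by blast
    then show ?thesis by (auto simp: pert_def algebra_simps split: if_splits)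
  qed
  ultimately show ?thesis by blast
qed

text \<open>A choice is needed: the maximizer is not unique where the margin does not depend on the
  perturbation, as on unlearnable samples.\<close>

definition "cpar t k = (SOME c. \<bar>c\<bar> * \<alpha> \<le> \<epsilon> \<and> (\<forall>p<P. \<forall>j<d. Xa t k p j = pert k c p j))"

lemma cpar: "k < N \<Longrightarrow> \<bar>cpar t k\<bar> * \<alpha> \<le> \<epsilon>" "k < N \<Longrightarrow> p < P \<Longrightarrow> j < d \<Longrightarrow> Xa t k p j = pert k (cpar t k) p j"
  using someI_ex[OF Xa_ex[of k t]] unfolding cpar_def by blast+

lemma inner_Xa: "k < N \<Longrightarrow> p < P \<Longrightarrow> inner_d d v (Xa t k p) = (if p = s k then 1 + cpar t k else 1) * inner_d d v (x k p)"
  unfolding inner_pert[symmetric] by (intro inner_d_cong) (auto simp: cpar(2))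

lemma W_step:
  assumes "r < m" "j < d"
  shows "W (Suc t) r j = W t r j + ieta A / real N *
     (\<Sum>k<N. psi (F k t) * y k * (\<Sum>p<P. 3 * (inner_d d (W t r) (Xa t k p))\<^sup>2 * Xa t k p j))"
proof -
  have "W (Suc t) r j = W t r j - ieta A / real N * (\<Sum>k<N. grad_AT A (W t) k (Xa t k) r j)"
    using traj assms unfolding AT_traj_def by blast
  also have "(\<Sum>k<N. grad_AT A (W t) k (Xa t k) r j) =
     - (\<Sum>k<N. psi (F k t) * y k * (\<Sum>p<P. 3 * (inner_d d (W t r) (Xa t k p))\<^sup>2 * Xa t k p j))"
    unfolding grad_AT_def act'_sum F_def by (simp add: sum_negf)
  finally show ?thesis by simp
qed

lemma Xa_noise: "k < N \<Longrightarrow> q \<in> Q k \<Longrightarrow> j < d \<Longrightarrow> Xa t k q j = x k q j"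
  using cpar(2)[of k q j t] by (auto simp: Q_def pert_def)

lemma Xa_signal: "k < N \<Longrightarrow> j < d \<Longrightarrow> Xa t k (s k) j = (1 + cpar t k) * x k (s k) j"
  using cpar(2)[of k "s k" j t] s_lt by (simp add: pert_def)

text \<open>The update contains no projection, so the constraint has to reproduce itself: an
  unlearnable signal enters the gradient through its squared inner product with the filter, which is
  0 by induction, and all other patches vanish in this coordinate.\<close>

lemma W_last: "r < m \<Longrightarrow> W t r (d - 1) = 0"
proof (induction t)
  case 0
  then show ?case using traj data d_ge_2 unfolding AT_traj_def data_ok_def by simp
next
  case (Suc t)
  have "(\<Sum>p<P. 3 * (inner_d d (W t r) (Xa t k p))\<^sup>2 * Xa t k p (d - 1)) = 0" if k: "k < N" for k
  proof -
    have "(\<Sum>q\<in>Q k. 3 * (inner_d d (W t r) (Xa t k q))\<^sup>2 * Xa t k q (d - 1)) = 0"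
      using Xa_noise[OF k] noise_patch[OF k] d_ge_2 by (intro sum.neutral) auto
    moreover have "inner_d d (W t r) (Xa t k (s k)) * Xa t k (s k) (d - 1) = 0"
    proof (cases "k \<in> SU")
      case True
      then show ?thesis using inner_Xa[OF k s_lt[OF k], where v = "W t r" and t = t] inner_signal[OF k] Suc by simp
    next
      case False
      then have "x k (s k) (d - 1) = 0" using signal_patch[OF k d_ge_2(3)] d_ge_2 by simp
      then show ?thesis using Xa_signal[OF k d_ge_2(3)] by simp
    qed
    ultimately show ?thesis unfolding sum_patches[OF k] by (auto simp: power2_eq_square)
  qed
  then show ?case unfolding W_step[OF Suc.prems d_ge_2(3)] using Suc by simp
qed

lemma f_pert: "k < N \<Longrightarrow> y k * f_of A (W t) (pert k c) =
    (if k \<in> SL then (\<alpha> * (1 + c)) ^ 3 * (\<Sum>r<m. w r t ^ 3) else 0) + (\<Sum>r<m. \<Sum>q\<in>Q k. z r (k, q) t ^ 3)"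
proof -
  assume k: "k < N"
  have sig: "y k * inner_d d (W t r) (pert k c (s k)) ^ 3 = (if k \<in> SL then (\<alpha> * (1 + c)) ^ 3 * w r t ^ 3 else 0)"
    if "r < m" for r
  proof -
    have "y k * y k ^ 3 = 1" using y_sq[OF k] by simp
    then show ?thesis
      unfolding inner_pert inner_signal[OF k] using k W_last[OF that]
      by (auto simp: SL_def w_def power_mult_distrib mult_ac)
  qed
  have noi: "y k * inner_d d (W t r) (pert k c q) ^ 3 = z r (k, q) t ^ 3" if "q \<in> Q k" for r q
    using that y_sq[OF k] unfolding inner_pert by (auto simp: z_def power_mult_distrib Q_def)
  have "y k * f_of A (W t) (pert k c) = (\<Sum>r<m. \<Sum>p<P. y k * inner_d d (W t r) (pert k c p) ^ 3)"
    by (simp add: fnet_cube sum_distrib_left)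
  also have "\<dots> = (\<Sum>r<m. (if k \<in> SL then (\<alpha> * (1 + c)) ^ 3 * w r t ^ 3 else 0) + (\<Sum>q\<in>Q k. z r (k, q) t ^ 3))"
    unfolding sum_patches[OF k] using sig noi by (intro sum.cong) auto
  finally show ?thesis by (simp add: sum.distrib sum_distrib_left)
qed

lemma F_pert: "k < N \<Longrightarrow> F k t = y k * f_of A (W t) (pert k (cpar t k))"
  unfolding F_def using cpar(2) by (auto intro!: arg_cong2[where f = "(*)"] fnet_cong)

lemma g_eq: "k \<in> SL \<Longrightarrow> g k t = \<alpha> * (1 + cpar t k)"
proof -
  assume "k \<in> SL"
  then have k: "k < N" "k \<notin> SU" by (auto simp: SL_def)
  have "g k t = y k * ((1 + cpar t k) * (\<alpha> * y k))"
    unfolding g_def Xa_signal[OF k(1) params_pos(3)] signal_patch[OF k(1) params_pos(3)] using k by simp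
  also have "\<dots> = (y k * y k) * (\<alpha> * (1 + cpar t k))" by simp
  finally show ?thesis using y_sq[OF k(1)] by simp
qed

lemma F_SL: "k \<in> SL \<Longrightarrow> F k t = g k t ^ 3 * (\<Sum>r<m. w r t ^ 3) + (\<Sum>r<m. \<Sum>q\<in>Q k. z r (k, q) t ^ 3)"
  using F_pert[of k t] f_pert[of k t "cpar t k"] g_eq[of k t] by (auto simp: SL_def)

lemma F_SU: "k \<in> SU \<Longrightarrow> F k t = (\<Sum>r<m. \<Sum>q\<in>Q k. z r (k, q) t ^ 3)"
  using F_pert[of k t] f_pert[of k t "cpar t k"] params_pos(10) by (auto simp: SL_def)

lemma g_bounds: "k \<in> SL \<Longrightarrow> \<alpha> - \<epsilon> \<le> g k t \<and> g k t \<le> \<alpha> + \<epsilon>"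
proof -
  assume k: "k \<in> SL"
  then have "\<bar>cpar t k * \<alpha>\<bar> \<le> \<epsilon>" using cpar(1)[of k t] params_pos by (auto simp: SL_def abs_mult)
  moreover have "g k t = \<alpha> + cpar t k * \<alpha>" unfolding g_eq[OF k] by (simp add: algebra_simps)
  ultimately show ?thesis by linarith
qed

text \<open>Optimality of the attack is tested against the two extreme perturbations
  \<open>c = \<epsilon> / \<alpha>\<close> and \<open>c = - \<epsilon> / \<alpha>\<close>; the
  converse bound follows from \<open>g_bounds\<close> and the sign of the sum of cubes.\<close>

lemma g_min:
  assumes k: "k \<in> SL"
  shows "g k t ^ 3 * (\<Sum>r<m. w r t ^ 3) = min ((\<alpha> - \<epsilon>) ^ 3 * (\<Sum>r<m. w r t ^ 3)) ((\<alpha> + \<epsilon>) ^ 3 * (\<Sum>r<m. w r t ^ 3))"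
proof -
  let ?S = "\<Sum>r<m. w r t ^ 3"
  have kN: "k < N" using k by (simp add: SL_def)
  have le: "g k t ^ 3 * ?S \<le> (\<alpha> * (1 + c)) ^ 3 * ?S" if c: "\<bar>c\<bar> * \<alpha> \<le> \<epsilon>" for c
  proof -
    have "logistic (y k * f_of A (W t) (pert k c)) \<le> logistic (F k t)"
      using adv[OF kN, of t] pert_feasible[OF kN c] unfolding is_adv_def F_def by blast
    then show ?thesis unfolding logistic_le_iff F_SL[OF k] f_pert[OF kN] using k by simp
  qed
  have "\<alpha> * (1 + \<epsilon> / \<alpha>) = \<alpha> + \<epsilon>" "\<alpha> * (1 + (- \<epsilon> / \<alpha>)) = \<alpha> - \<epsilon>" "\<bar>\<epsilon> / \<alpha>\<bar> * \<alpha> \<le> \<epsilon>" "\<bar>- \<epsilon> / \<alpha>\<bar> * \<alpha> \<le> \<epsilon>"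
    using params_pos by (auto simp: field_simps)
  then have up: "g k t ^ 3 * ?S \<le> (\<alpha> + \<epsilon>) ^ 3 * ?S" and dn: "g k t ^ 3 * ?S \<le> (\<alpha> - \<epsilon>) ^ 3 * ?S"
    using le[of "\<epsilon> / \<alpha>"] le[of "- \<epsilon> / \<alpha>"] by simp_all
  have gc: "(\<alpha> - \<epsilon>) ^ 3 \<le> g k t ^ 3" "g k t ^ 3 \<le> (\<alpha> + \<epsilon>) ^ 3"
    using g_bounds[OF k, of t] by (auto intro!: cube_mono)
  show ?thesis
  proof (cases "?S \<ge> 0")
    case True
    then show ?thesis using mult_right_mono[OF gc(1) True] up dn by linarith
  next
    case False
    then have "(\<alpha> + \<epsilon>) ^ 3 * ?S \<le> g k t ^ 3 * ?S" using gc(2) by (intro mult_right_mono_neg) auto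
    then show ?thesis using up dn by linarith
  qed
qed

text \<open>Only learnable signal patches have a nonzero first coordinate; their label occurs to the
  fourth power and disappears.\<close>

lemma w_step: "r < m \<Longrightarrow> w r (Suc t) = w r t + 3 * ieta A / real N * (\<Sum>k\<in>SL. psi (F k t) * g k t ^ 3) * (w r t)\<^sup>2"
proof -
  assume r: "r < m"
  let ?h = "\<lambda>k. psi (F k t) * y k * (\<Sum>p<P. 3 * (inner_d d (W t r) (Xa t k p))\<^sup>2 * Xa t k p 0)"
  have inner0: "(\<Sum>p<P. 3 * (inner_d d (W t r) (Xa t k p))\<^sup>2 * Xa t k p 0)
      = 3 * (inner_d d (W t r) (Xa t k (s k)))\<^sup>2 * Xa t k (s k) 0" if k: "k < N" for k
  proof -
    have "(\<Sum>q\<in>Q k. 3 * (inner_d d (W t r) (Xa t k q))\<^sup>2 * Xa t k q 0) = 0"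
      using Xa_noise[OF k] noise_patch[OF k] params_pos by (intro sum.neutral) auto
    then show ?thesis unfolding sum_patches[OF k] by simp
  qed
  have SLh: "?h k = 3 * (w r t)\<^sup>2 * (psi (F k t) * g k t ^ 3)" if k: "k \<in> SL" for k
  proof -
    have kN: "k < N" "k \<notin> SU" using k by (auto simp: SL_def)
    have X0: "Xa t k (s k) 0 = y k * g k t" using y_sq(1)[OF kN(1)] by (simp add: g_def flip: mult.assoc)
    have in0: "inner_d d (W t r) (Xa t k (s k)) = y k * (g k t * w r t)"
      unfolding inner_Xa[OF kN(1) s_lt[OF kN(1)]] inner_signal[OF kN(1)] g_eq[OF k] using kN by (simp add: w_def)
    have "?h k = (y k * y k) * (y k)\<^sup>2 * (3 * (w r t)\<^sup>2 * (psi (F k t) * g k t ^ 3))"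
      unfolding inner0[OF kN(1)] in0 X0 by (simp add: power2_eq_square power3_eq_cube)
    then show ?thesis using y_sq[OF kN(1)] by simp
  qed
  have SUh: "?h k = 0" if k: "k \<in> SU" for k
  proof -
    have kN: "k < N" using k params_pos(10) by auto
    have "x k (s k) 0 = 0" using signal_patch[OF kN params_pos(3)] k d_ge_2 by simp
    then show ?thesis unfolding inner0[OF kN] using Xa_signal[OF kN params_pos(3)] by simp
  qed
  have "(\<Sum>k<N. ?h k) = (\<Sum>k\<in>SL. ?h k)"
    using SUh by (intro sum.mono_neutral_right) (auto simp: SL_def)
  also have "\<dots> = 3 * (w r t)\<^sup>2 * (\<Sum>k\<in>SL. psi (F k t) * g k t ^ 3)"
    using SLh by (simp add: sum_distrib_left)
  finally show ?thesis unfolding w_def W_step[OF r params_pos(3)] by simp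
qed

lemma inner_noise_signal: "i < N \<Longrightarrow> q \<in> Q i \<Longrightarrow> k < N \<Longrightarrow> inner_d d (x i q) (x k (s k)) = 0"
  using inner_signal[of k "x i q"] noise_patch[of i q] by auto

text \<open>Signal patches are orthogonal to all noise patches, so the attack influences this
  recursion only through the factors \<open>psi\<close>.\<close>

lemma z_step:
  assumes r: "r < m" and i: "i < N" "q \<in> Q i"
  shows "z r (i, q) (Suc t) = z r (i, q) t
     + prm.a * (\<Sum>j\<in>Sigma {..<N} Q. K (i, q) j * psi (F (fst j) t) * (z r j t)\<^sup>2)"
proof -
  let ?v = "x i q"
  have "inner_d d (W (Suc t) r) ?v = inner_d d (\<lambda>j. W t r j + ieta A / real N *
     (\<Sum>k<N. psi (F k t) * y k * (\<Sum>p<P. 3 * (inner_d d (W t r) (Xa t k p))\<^sup>2 * Xa t k p j))) ?v"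
    using W_step[OF r] by (intro inner_d_cong) auto
  also have "\<dots> = inner_d d (W t r) ?v + ieta A / real N *
     (\<Sum>k<N. psi (F k t) * y k * (\<Sum>p<P. 3 * (inner_d d (W t r) (Xa t k p))\<^sup>2 * inner_d d (Xa t k p) ?v))"
    by (rule inner_d_add_sum)
  finally have "z r (i, q) (Suc t) = z r (i, q) t + ieta A / real N *
     (\<Sum>k<N. y i * (psi (F k t) * y k * (\<Sum>p<P. 3 * (inner_d d (W t r) (Xa t k p))\<^sup>2 * inner_d d (Xa t k p) ?v)))"
    by (simp add: z_def algebra_simps sum_distrib_left)
  also have "(\<Sum>k<N. y i * (psi (F k t) * y k * (\<Sum>p<P. 3 * (inner_d d (W t r) (Xa t k p))\<^sup>2 * inner_d d (Xa t k p) ?v)))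
     = (\<Sum>k<N. \<Sum>p\<in>Q k. 3 * (isign A)\<^sup>2 * real d * (K (i, q) (k, p) * psi (F k t) * (z r (k, p) t)\<^sup>2))"
  proof (rule sum.cong[OF refl])
    fix k assume "k \<in> {..<N}"
    then have k: "k < N" by simp
    have "inner_d d (Xa t k (s k)) ?v = 0"
      using inner_Xa[OF k s_lt[OF k], of ?v t] inner_noise_signal[OF i k] by (simp add: inner_d_commute)
    moreover have "3 * (inner_d d (W t r) (Xa t k p))\<^sup>2 * inner_d d (Xa t k p) ?v
       = 3 * (z r (k, p) t)\<^sup>2 * inner_d d (x k p) ?v" if p: "p \<in> Q k" for p
    proof -
      have "inner_d d u (Xa t k p) = inner_d d u (x k p)" for u
        using Xa_noise[OF k p] by (intro inner_d_cong) auto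
      then have "inner_d d (W t r) (Xa t k p) = inner_d d (W t r) (x k p)" "inner_d d (Xa t k p) ?v = inner_d d (x k p) ?v"
        by (auto simp: inner_d_commute[of d _ ?v])
      then show ?thesis using y_sq(2)[OF k] by (simp add: z_def power_mult_distrib)
    qed
    then have "(\<Sum>p\<in>Q k. 3 * (inner_d d (W t r) (Xa t k p))\<^sup>2 * inner_d d (Xa t k p) ?v)
       = (\<Sum>p\<in>Q k. 3 * (z r (k, p) t)\<^sup>2 * inner_d d (x k p) ?v)"
      by (rule sum.cong[OF refl])
    ultimately have "(\<Sum>p<P. 3 * (inner_d d (W t r) (Xa t k p))\<^sup>2 * inner_d d (Xa t k p) ?v)
       = (\<Sum>p\<in>Q k. 3 * (z r (k, p) t)\<^sup>2 * inner_d d (x k p) ?v)"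
      unfolding sum_patches[OF k] by simp
    moreover have summand: "y i * (psi (F k t) * y k * (3 * (z r (k, p) t)\<^sup>2 * inner_d d (x k p) ?v))
        = 3 * (isign A)\<^sup>2 * real d * (K (i, q) (k, p) * psi (F k t) * (z r (k, p) t)\<^sup>2)" for p
      using params_pos by (simp add: K_def inner_d_commute[of d "x k p"] field_simps)
    ultimately show "y i * (psi (F k t) * y k * (\<Sum>p<P. 3 * (inner_d d (W t r) (Xa t k p))\<^sup>2 * inner_d d (Xa t k p) ?v))
      = (\<Sum>p\<in>Q k. 3 * (isign A)\<^sup>2 * real d * (K (i, q) (k, p) * psi (F k t) * (z r (k, p) t)\<^sup>2))"
      by (simp only: sum_distrib_left summand)
  qed
  also have "\<dots> = 3 * (isign A)\<^sup>2 * real d * (\<Sum>j\<in>Sigma {..<N} Q. K (i, q) j * psi (F (fst j) t) * (z r j t)\<^sup>2)"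
    by (subst sum.Sigma) (auto simp: Q_def sum_distrib_left case_prod_unfold)
  finally show ?thesis by (simp add: prm.a_def mult_ac)
qed

lemma noise_idx: "q \<in> Q k \<longleftrightarrow> q < P \<and> q \<noteq> s k"
  by (auto simp: Q_def)

lemma W_0: "r < m \<Longrightarrow> inner_d d (iW0 A r) v = inner_d d (W 0 r) v"
  using traj unfolding AT_traj_def by (intro inner_d_cong) auto

lemma event_patch:
  assumes "k < N" "q \<in> Q k"
  shows "1/2 * (isign A)\<^sup>2 * real d \<le> inner_d d (x k q) (x k q)"
    "inner_d d (x k q) (x k q) \<le> 3/2 * (isign A)\<^sup>2 * real d"
    "j < d \<Longrightarrow> \<bar>x k q j\<bar> \<le> isign A * sqrt (2 * ln (16 * real d * real N * real P / idelta A))"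
    "r < m \<Longrightarrow> \<bar>inner_d d (W 0 r) (x k q)\<bar> \<le> 2 * isig0 A * isign A * sqrt (real d * ln (16 * real N * real m * real P / idelta A))"
    "1/4 * isig0 A * isign A * sqrt (real d) \<le> Max ((\<lambda>r. y k * inner_d d (iW0 A r) (x k q)) ` {..<m})"
proof -
  have q: "q < P" "q \<noteq> s k" using assms(2) by (auto simp: noise_idx)
  note ev = event[unfolded event_E_def Let_def, THEN conjunct1, rule_format, OF assms(1) q]
  show "1/2 * (isign A)\<^sup>2 * real d \<le> inner_d d (x k q) (x k q)"
    "inner_d d (x k q) (x k q) \<le> 3/2 * (isign A)\<^sup>2 * real d"
    "1/4 * isig0 A * isign A * sqrt (real d) \<le> Max ((\<lambda>r. y k * inner_d d (iW0 A r) (x k q)) ` {..<m})"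
    using ev by blast+
  show "\<bar>x k q j\<bar> \<le> isign A * sqrt (2 * ln (16 * real d * real N * real P / idelta A))" if "j < d"
    using ev that by blast
  show "\<bar>inner_d d (W 0 r) (x k q)\<bar> \<le> 2 * isig0 A * isign A * sqrt (real d * ln (16 * real N * real m * real P / idelta A))"
    if "r < m"
    unfolding W_0[OF that, symmetric] using ev that by blast
qed

lemma event_cross:
  assumes "k < N" "q \<in> Q k" "k' < N" "q' \<in> Q k'" "(k, q) \<noteq> (k', q')"
  shows "\<bar>inner_d d (x k q) (x k' q')\<bar> \<le> 2 * (isign A)\<^sup>2 * sqrt (real d * ln (16 * (real N)\<^sup>2 * (real P)\<^sup>2 / idelta A))"
  using event assms unfolding event_E_def Let_def noise_idx by blast

lemma inner_e1: "r < m \<Longrightarrow> inner_d d (iW0 A r) (\<lambda>j. if j = 0 then 1 else 0) = w r 0"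
  using inner_d_unit[of 0 d "W 0 r" 1] params_pos(3) by (simp add: W_0 w_def)

lemma event_init:
  "r < m \<Longrightarrow> \<bar>w r 0\<bar> \<le> isig0 A * sqrt (2 * ln (16 * real m / idelta A))"
  "1/2 * isig0 A \<le> Max ((\<lambda>r. w r 0) ` {..<m})"
proof -
  show "\<bar>w r 0\<bar> \<le> isig0 A * sqrt (2 * ln (16 * real m / idelta A))" if "r < m"
    using event that inner_e1[OF that] unfolding event_E_def Let_def by metis
  have "(\<lambda>r. inner_d d (iW0 A r) (\<lambda>j. if j = 0 then 1 else 0)) ` {..<m} = (\<lambda>r. w r 0) ` {..<m}"
    using inner_e1 by (intro image_cong) auto
  then show "1/2 * isig0 A \<le> Max ((\<lambda>r. w r 0) ` {..<m})"
    using event unfolding event_E_def Let_def by metis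
qed

lemma le_Max_ex: "m > 0 \<Longrightarrow> c \<le> Max (h ` {..<m}) \<Longrightarrow> \<exists>r<m. c \<le> h r" for c :: real and m :: nat
proof -
  assume m: "m > 0" and c: "c \<le> Max (h ` {..<m})"
  have "h ` {..<m} \<noteq> {}" using m by auto
  then have "Max (h ` {..<m}) \<in> h ` {..<m}" by (intro Max_in) auto
  then show ?thesis using c by auto
qed

lemma SU_nonempty: "SU \<noteq> {}"
proof
  assume "SU = {}"
  then have "p_un A = 0" by simp
  moreover have "C / real N > 0" using prm.C_pos params_pos by simp
  ultimately show False using params_pos(11) by linarith
qed

lemma card_SL: "real (card SL) = real N - real (card SU)"
proof -
  have "finite SU" using params_pos(10) finite_subset by blast
  then have "card SL = N - card SU" "card SU \<le> N"
    unfolding SL_def using params_pos(10) card_Diff_subset[of SU "{..<N}"] card_mono[OF _ params_pos(10)] by auto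
  then show ?thesis by simp
qed

sublocale dyn: at_dynamics N m P T prm.l \<alpha> \<epsilon> "ieta A" "isig0 A" prm.a prm.\<theta> prm.\<iota> prm.\<rho> prm.\<omega> SL SU Q K w z g F
proof
  show "P \<le> 2 * m" using prm.P_le_m by linarith
  show "0 < N" "0 < m" "0 < \<alpha>" "0 \<le> \<epsilon>" "0 < ieta A" "0 < isig0 A" using params_pos by auto
  show "0 < T" using prm.T_ge1 by simp
  show "1000 \<le> m" using prm.m_ge by linarith
  show "SL \<union> SU = {..<N}" "SL \<inter> SU = {}" using params_pos(10) by (auto simp: SL_def)
  show "real N / 2 \<le> real (card SL)"
    using prm.pu_half params_pos(1) unfolding card_SL by (simp add: field_simps)
  show "\<And>k. k < N \<Longrightarrow> Q k \<subseteq> {..<P}" by (auto simp: Q_def)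
  show "\<exists>r<m. isig0 A / 2 \<le> w r 0" using le_Max_ex[OF params_pos(4) event_init(2)] by simp
  fix r k q k' q' t
  show "\<bar>w r 0\<bar> \<le> prm.\<omega>" if "r < m"
  proof -
    have "isig0 A * sqrt (2 * ln (16 * real m / idelta A)) \<le> prm.\<omega>"
      unfolding prm.\<omega>_def using prm.logs_le(3) params_pos by (intro mult_left_mono real_sqrt_le_mono) auto
    then show ?thesis using event_init(1)[OF that] by linarith
  qed
  show "\<bar>z r (k, q) 0\<bar> \<le> prm.\<iota>" if "r < m" "k < N" "q \<in> Q k"
  proof -
    have "\<bar>z r (k, q) 0\<bar> = \<bar>inner_d d (W 0 r) (x k q)\<bar>" using y_sq(4)[OF that(2)] by (simp add: z_def abs_mult)
    also have "\<dots> \<le> 2 * isig0 A * isign A * sqrt (real d * ln (16 * real N * real m * real P / idelta A))"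
      by (rule event_patch(4)[OF that(2,3,1)])
    also have "\<dots> \<le> prm.\<iota>"
      unfolding prm.\<iota>_def using prm.logs_le(1) params_pos by (intro mult_left_mono real_sqrt_le_mono) auto
    finally show ?thesis .
  qed
  show "\<exists>r<m. \<exists>k\<in>SU. \<exists>q\<in>Q k. prm.\<rho> \<le> z r (k, q) 0"
  proof -
    obtain k where k: "k \<in> SU" using SU_nonempty by auto
    then have kN: "k < N" using params_pos(10) by auto
    have "P \<ge> 2" using prm.cond_P by simp
    \<comment> \<open>As \<open>P \<ge> 2\<close>, both 0 and 1 are patch indices, and at least one
      is not the signal patch.\<close>
    then have q: "(if s k = 0 then 1 else 0) \<in> Q k" by (auto simp: Q_def)
    let ?q = "if s k = 0 then 1 else 0 :: nat"
    have "\<exists>r<m. prm.\<rho> \<le> y k * inner_d d (iW0 A r) (x k ?q)"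
      unfolding prm.\<rho>_def by (rule le_Max_ex[OF params_pos(4) event_patch(5)[OF kN q]])
    then obtain r where r: "r < m" "prm.\<rho> \<le> y k * inner_d d (iW0 A r) (x k ?q)" by blast
    then have "prm.\<rho> \<le> z r (k, ?q) 0" using W_0[OF r(1)] by (simp add: z_def)
    then show ?thesis using r k q by blast
  qed
  show "1 / 2 \<le> K (k, q) (k, q) \<and> K (k, q) (k, q) \<le> 3 / 2" if "k < N" "q \<in> Q k"
    using event_patch(1,2)[OF that] y_sq(1)[OF that(1)] params_pos by (simp add: K_def field_simps)
  show "\<bar>K (k, q) (k', q')\<bar> \<le> prm.\<theta> / 2"
    if "k < N" "q \<in> Q k" "k' < N" "q' \<in> Q k'" "(k, q) \<noteq> (k', q')"
  proof -
    have "\<bar>inner_d d (x k q) (x k' q')\<bar> \<le> 2 * (isign A)\<^sup>2 * sqrt (real d * (2 * prm.l))"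
      using event_cross[OF that] prm.logs_le(2) params_pos
      by (elim order_trans, intro mult_left_mono real_sqrt_le_mono) auto
    then have "\<bar>inner_d d (x k q) (x k' q')\<bar> / ((isign A)\<^sup>2 * real d)
       \<le> 2 * (isign A)\<^sup>2 * sqrt (real d * (2 * prm.l)) / ((isign A)\<^sup>2 * real d)"
      by (intro divide_right_mono) auto
    also have "\<dots> = 2 * (sqrt (2 * prm.l) * (sqrt (real d) / real d))"
      using params_pos by (simp add: real_sqrt_mult)
    also have "sqrt (real d) / real d = 1 / sqrt (real d)"
      using params_pos by (simp add: field_simps)
    also have "2 * (sqrt (2 * prm.l) * (1 / sqrt (real d))) = prm.\<theta> / 2"
      by (simp add: prm.\<theta>_def real_sqrt_divide)
    finally show ?thesis using y_sq(4) that by (simp add: K_def abs_mult)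
  qed
qed (fact prm.l_ge prm.exp_l prm.\<epsilon>_le prm.a_facts prm.\<theta>_le prm.\<iota>_le prm.\<iota>_\<rho> prm.step_le prm.\<omega>_le
      prm.horizon_noise prm.horizon_signal g_bounds g_min F_SL F_SU w_step z_step)+

section \<open>Training loss and test error at the horizon\<close>

lemma train_loss: "rob_train_loss A W Xa \<le> 1 / prm.l + 3 / real m"
proof -
  have finSU: "finite SU" using params_pos(10) finite_subset by blast
  have SUl: "logistic (F k T) \<le> 3" if "k \<in> SU" for k
  proof -
    have "logistic (F k T) \<le> exp (- F k T)"
      using ln_add_one_self_le_self[of "exp (- F k T)"] by (simp add: logistic_def)
    also have "\<dots> \<le> exp 1" using dyn.SU_margin[OF that] by simp
    finally show ?thesis using exp_le by linarith
  qed
  have "(\<Sum>k<N. logistic (F k T)) = (\<Sum>k\<in>SL. logistic (F k T)) + (\<Sum>k\<in>SU. logistic (F k T))"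
    unfolding SL_def using params_pos(10) by (intro sum.subset_diff) auto
  also have "\<dots> \<le> real (card SL) * (1 / prm.l) + real (card SU) * 3"
    using SUl dyn.SL_loss by (intro add_mono sum_bounded_above) auto
  also have "\<dots> \<le> real N * (1 / prm.l) + real (card SU) * 3"
    using prm.l_ge by (intro add_right_mono mult_right_mono) (auto simp: card_SL)
  finally have "rob_train_loss A W Xa \<le> (real N * (1 / prm.l) + real (card SU) * 3) / real N"
    unfolding rob_train_loss_def F_def by (intro divide_right_mono) auto
  also have "\<dots> = 1 / prm.l + p_un A * 3" using params_pos(1) by (simp add: add_divide_distrib)
  \<comment> \<open>Unlearnable samples may keep a loss of order 1; only their small share makes the
    average vanish.\<close>
  also have "\<dots> \<le> 1 / prm.l + 1 / real m * 3" using prm.pu_le(2) by (intro add_left_mono mult_right_mono) auto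
  finally show ?thesis by simp
qed

text \<open>Deterministic part of the test error. Half of the budget erases the test noise, the
  other half plants the memorized patch with the sign opposite to the test label.\<close>

lemma attack_succeeds:
  assumes yy: "yy = 1 \<or> yy = (-1::real)" and ss: "ss < P"
    and G: "\<And>i. i \<in> {..<P} \<times> {1..<d - 1} \<Longrightarrow> \<bar>G i\<bar> \<le> \<epsilon> / 2"
  shows "rob_fail A (W T) yy (test_X \<alpha> d ss yy G)"
proof -
  obtain k q where kq: "k \<in> SU" "q \<in> Q k" and big: "(\<Sum>r<m. z r (k, q) T ^ 3) \<ge> 1 / (1024 * (real m)\<^sup>2)"
    using dyn.memorized_patch by blast
  have kN: "k < N" using kq params_pos(10) by auto
  let ?b = "isign A * sqrt (2 * ln (16 * real d * real N * real P / idelta A))"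
  define \<mu> where "\<mu> = \<epsilon> / (2 * ?b)"
  have \<mu>: "\<mu> > 0" "\<mu> ^ 3 * (1 / (1024 * (real m)\<^sup>2)) > 12 * prm.l"
    using prm.attack_budget unfolding \<mu>_def by auto
  have b0: "?b > 0" using prm.X_ge(3) params_pos by simp
  define p0 where "p0 = (if ss = 0 then 1 else 0 :: nat)"
  have p0: "p0 < P" "p0 \<noteq> ss" using prm.cond_P by (auto simp: p0_def)
  let ?X = "test_X \<alpha> d ss yy G"
  \<comment> \<open>The signal patch is left untouched; every other patch is set to zero, except
    \<open>p0\<close>, which receives the rescaled training patch.\<close>
  define \<Delta> where "\<Delta> p j = (if p = ss then 0 else (if p = p0 then - yy * \<mu> * y k * x k q j else 0) - ?X p j)" for p j
  have "\<bar>\<Delta> p j\<bar> \<le> \<epsilon>" if "p < P" "j < d" for p j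
  proof -
    have "\<bar>?X p j\<bar> \<le> \<epsilon> / 2" if "p \<noteq> ss"
      using G[of "(p, j)"] that \<open>p < P\<close> params_pos(9) by (auto simp: test_X_def)
    moreover have "\<bar>- yy * \<mu> * y k * x k q j\<bar> \<le> \<epsilon> / 2"
    proof -
      have "\<bar>- yy * \<mu> * y k * x k q j\<bar> = \<mu> * \<bar>x k q j\<bar>"
        using yy \<mu> y_sq(4)[OF kN] by (auto simp: abs_mult)
      also have "\<dots> \<le> \<mu> * ?b" using event_patch(3)[OF kN kq(2) that(2)] \<mu> by (intro mult_left_mono) auto
      also have "\<dots> = \<epsilon> / 2" using less_imp_neq[OF b0] unfolding \<mu>_def by (simp only: times_divide_eq_left nonzero_mult_divide_mult_cancel_right2 mult.commute[of \<epsilon>]) simp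
      finally show ?thesis .
    qed
    ultimately show ?thesis using params_pos(9) unfolding \<Delta>_def by (auto split: if_splits)
  qed
  moreover have "yy * f_of A (W T) (\<lambda>p j. ?X p j + \<Delta> p j) < 0"
  proof -
    have sig: "inner_d d v (\<lambda>j. ?X ss j + \<Delta> ss j) = \<alpha> * yy * v 0" for v
    proof -
      have "inner_d d v (\<lambda>j. ?X ss j + \<Delta> ss j) = inner_d d v (\<lambda>j. (\<alpha> * yy) * (if j = 0 then 1 else 0))"
        by (intro inner_d_cong) (auto simp: test_X_def \<Delta>_def)
      then show ?thesis using inner_d_unit[of 0 d v "\<alpha> * yy"] params_pos by simp
    qed
    have att: "inner_d d v (\<lambda>j. ?X p0 j + \<Delta> p0 j) = - yy * \<mu> * y k * inner_d d v (x k q)" for v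
      using p0 inner_d_scale[of d v "- yy * \<mu> * y k" "x k q"] by (simp add: \<Delta>_def)
    have oth: "inner_d d v (\<lambda>j. ?X p j + \<Delta> p j) = 0" if "p \<noteq> ss" "p \<noteq> p0" for v p
      using that by (simp add: \<Delta>_def inner_d_def)
    have yy2: "yy * yy ^ 3 = 1" using yy by auto
    have patches: "(\<Sum>p<P. yy * inner_d d (W T r) (\<lambda>j. ?X p j + \<Delta> p j) ^ 3) = \<alpha> ^ 3 * w r T ^ 3 - \<mu> ^ 3 * z r (k, q) T ^ 3" for r
    proof -
      let ?h = "\<lambda>p. yy * inner_d d (W T r) (\<lambda>j. ?X p j + \<Delta> p j) ^ 3"
      have "(\<Sum>p<P. ?h p) = (\<Sum>p\<in>{ss, p0}. ?h p)"
        using p0 ss oth by (intro sum.mono_neutral_right) auto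
      also have "\<dots> = ?h ss + ?h p0" using p0 by simp
      also have "?h ss = (yy * yy ^ 3) * (\<alpha> ^ 3 * w r T ^ 3)"
        unfolding sig by (simp add: w_def power_mult_distrib)
      also have "?h p0 = - (yy * yy ^ 3) * (\<mu> ^ 3 * z r (k, q) T ^ 3)"
        unfolding att by (simp add: z_def power_mult_distrib)
      finally show ?thesis unfolding yy2 by simp
    qed
    have "yy * f_of A (W T) (\<lambda>p j. ?X p j + \<Delta> p j) = (\<Sum>r<m. \<Sum>p<P. yy * inner_d d (W T r) (\<lambda>j. ?X p j + \<Delta> p j) ^ 3)"
      by (simp add: fnet_cube sum_distrib_left)
    also have "\<dots> = \<alpha> ^ 3 * dyn.S T - \<mu> ^ 3 * (\<Sum>r<m. z r (k, q) T ^ 3)"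
      unfolding patches by (simp add: sum_subtractf sum_distrib_left dyn.S_def)
    also have "\<dots> \<le> 12 * prm.l - \<mu> ^ 3 * (1 / (1024 * (real m)\<^sup>2))"
      using dyn.signal_upper big \<mu> by (intro diff_mono mult_left_mono) auto
    also have "\<dots> < 0" using \<mu> by simp
    finally show ?thesis .
  qed
  ultimately show ?thesis unfolding rob_fail_def by blast
qed

text \<open>\<open>\<epsilon> / \<sigma>n\<close> is at least \<open>v\<close>, which exceeds both
  32 and \<open>ln d\<close>, so the exponent \<open>v^2 / 16\<close> is at least
  \<open>2 ln d\<close>. This beats the union over at most \<open>C d\<close> coordinates.\<close>

lemma noise_bounded_prob: "real P * real d * (sqrt 2 * exp (- (\<epsilon> / 2)\<^sup>2 / (4 * (isign A)\<^sup>2))) \<le> 2 * C / real d"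
proof -
  define v where "v = C * real m * prm.X"
  have X1: "prm.X \<ge> 10" "prm.X \<ge> ln (real d)" using prm.X_ge prm.l_ge by auto
  have "32 * 1 * 1 \<le> C * real m * prm.X" "1 * 1 * prm.X \<le> C * real m * prm.X"
    using prm.C_large prm.m_ge X1 by (intro mult_mono; simp)+
  then have v: "v \<ge> 32" "v \<ge> ln (real d)" using X1 unfolding v_def by linarith+
  have "isign A * v \<le> \<epsilon>" using prm.\<epsilon>_ge by (simp add: v_def mult_ac)
  then have "(isign A * v)\<^sup>2 \<le> \<epsilon>\<^sup>2" using params_pos v by (intro power_mono) auto
  then have "v\<^sup>2 \<le> \<epsilon>\<^sup>2 / (isign A)\<^sup>2" using params_pos by (simp add: power_mult_distrib field_simps)
  moreover have "32 * ln (real d) \<le> v\<^sup>2"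
    unfolding power2_eq_square using v prm.d_ge by (intro mult_mono) auto
  ultimately have "2 * ln (real d) \<le> (\<epsilon> / 2)\<^sup>2 / (4 * (isign A)\<^sup>2)"
    by (simp add: power_divide)
  then have "exp (- (\<epsilon> / 2)\<^sup>2 / (4 * (isign A)\<^sup>2)) \<le> exp (- (2 * ln (real d)))" by simp
  also have "\<dots> = 1 / (real d * real d)"
    unfolding exp_minus mult_2 exp_add using params_pos(3) by (simp add: inverse_eq_divide)
  finally have e: "exp (- (\<epsilon> / 2)\<^sup>2 / (4 * (isign A)\<^sup>2)) \<le> 1 / (real d * real d)" .
  have "sqrt 2 \<le> 2" by (intro real_le_lsqrt) auto
  then have "real P * real d * (sqrt 2 * exp (- (\<epsilon> / 2)\<^sup>2 / (4 * (isign A)\<^sup>2))) \<le> C * real d * (2 * (1 / (real d * real d)))"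
    using e prm.cond_P prm.C_pos by (intro mult_mono) auto
  also have "\<dots> = 2 * C / real d" using params_pos(3) by simp
  finally show ?thesis .
qed

text \<open>The attack works for every label and signal position unless some noise coordinate
  exceeds \<open>\<epsilon> / 2\<close>, so failure has probability near 1 rather than only near
  1/2.\<close>

lemma test_error: "rob_test_err A (W T) \<ge> 1 - 2 * C / real d"
proof -
  let ?M = "noise_M P d (isign A)"
  interpret prob_space ?M using params_pos by (intro prob_space_noise_M) auto
  have each: "1 - 2 * C / real d \<le> measure ?M {G \<in> space ?M. rob_fail A (W T) yy (test_X \<alpha> d ss yy G)}"
    if "yy \<in> {1, -1}" "ss < P" for yy ss
  proof -
    let ?B = "{G \<in> space ?M. \<exists>i\<in>{..<P} \<times> {1..<d - 1}. \<bar>G i\<bar> > \<epsilon> / 2}"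
    let ?F = "{G \<in> space ?M. rob_fail A (W T) yy (test_X \<alpha> d ss yy G)}"
    have F: "?F \<in> sets ?M" by (rule rob_fail_measurable) (use params_pos in auto)
    have "space ?M - ?F \<subseteq> ?B"
      using attack_succeeds[of yy ss] that by (force simp: not_less)
    moreover have "?B \<in> sets ?M"
    proof -
      have "?B = (\<Union>i\<in>{..<P} \<times> {1..<d - 1}. {G \<in> space ?M. \<bar>G i\<bar> > \<epsilon> / 2})" by auto
      moreover have "{G \<in> space ?M. \<bar>G i\<bar> > \<epsilon> / 2} \<in> sets ?M" if [measurable]: "i \<in> {..<P} \<times> {1..<d - 1}" for i
        by measurable
      ultimately show ?thesis by (auto intro!: sets.finite_UN)
    qed
    ultimately have "prob (space ?M - ?F) \<le> prob ?B" by (intro finite_measure_mono)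
    also have "\<dots> \<le> 2 * C / real d"
      using noise_tail[of "isign A" "\<epsilon> / 2" P d] noise_bounded_prob params_pos by simp
    finally show ?thesis using prob_compl[OF F] by simp
  qed
  have "2 * real P * (1 - 2 * C / real d) = (\<Sum>yy\<in>{1, -1::real}. \<Sum>ss<P. 1 - 2 * C / real d)"
    by simp
  also have "\<dots> \<le> (\<Sum>yy\<in>{1, -1::real}. \<Sum>ss<P. measure ?M {G \<in> space ?M. rob_fail A (W T) yy (test_X \<alpha> d ss yy G)})"
    using each by (intro sum_mono) auto
  finally have "(1 - 2 * C / real d) * (2 * real P) \<le> (\<Sum>yy\<in>{1, -1::real}. \<Sum>ss<P. measure ?M {G \<in> space ?M. rob_fail A (W T) yy (test_X \<alpha> d ss yy G)})"
    by (simp add: mult_ac)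
  then show ?thesis unfolding rob_test_err_def using params_pos(2) by (subst pos_le_divide_eq) auto
qed

text \<open>Converts the scale \<open>1/m\<close> of the dynamics into a power of the logarithm. The
  real exponent \<open>C\<close> is rounded up to a natural number, which is legitimate as the
  logarithm is at least 1.\<close>

lemma m_polylog: "real m \<le> C * ln (real (T * d * N * m * P) / idelta A) ^ nat \<lceil>C\<rceil>"
proof -
  have l': "prm.l' = ln (real (T * d * N * m * P) / idelta A)" by (simp add: prm.l'_def)
  have lnd: "ln (real d) \<ge> 0" using prm.d_ge by simp
  have "ln (real d) powr C \<le> prm.l' powr C"
    using lnd prm.lnd_le prm.C_pos by (intro powr_mono2) auto
  also have "\<dots> \<le> prm.l' powr real (nat \<lceil>C\<rceil>)"
    using prm.l'_ge prm.l_ge by (intro powr_mono) linarith+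
  also have "\<dots> = prm.l' ^ nat \<lceil>C\<rceil>" using prm.l'_ge prm.l_ge by (intro powr_realpow) linarith
  finally have "C * ln (real d) powr C \<le> C * prm.l' ^ nat \<lceil>C\<rceil>" using prm.C_pos by simp
  then show ?thesis using params_pos(12) unfolding l' by linarith
qed

text \<open>Used with \<open>e = \<alpha>\<close> for the signal and \<open>e = 1\<close> for the
  memorized noise, so that both claims share one constant and one exponent.\<close>

lemma polylog_bound:
  assumes "e > 0" shows "(1 / (8 * C)) / (e * ln (real (T * d * N * m * P) / idelta A) ^ nat \<lceil>C\<rceil>) \<le> 1 / (8 * (e * real m))"
proof -
  let ?L = "ln (real (T * d * N * m * P) / idelta A) ^ nat \<lceil>C\<rceil>"
  have m0: "real m > 0" using params_pos by simp
  have le: "e * real m \<le> e * (C * ?L)" using m_polylog assms by (intro mult_left_mono) auto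
  have "1 / (8 * (e * (C * ?L))) \<le> 1 / (8 * (e * real m))"
  proof (rule divide_left_mono)
    have "0 < e * (C * ?L)" "0 < e * real m"
      using mult_pos_pos[OF assms m0] mult_pos_pos[OF assms less_le_trans[OF m0 m_polylog]] by simp_all
    then show "0 < 8 * (e * (C * ?L)) * (8 * (e * real m))" by (metis mult_pos_pos zero_less_numeral)
  qed (use le in auto)
  then show ?thesis by (simp add: mult_ac)
qed

lemma learned_filter_polylog:
  "\<exists>r<m. W T r 0 \<ge> (1 / (8 * C)) / (\<alpha> * ln (real (T * d * N * m * P) / idelta A) ^ nat \<lceil>C\<rceil>)"
proof -
  obtain r where r: "r < m" "\<alpha> * real m * w r T \<ge> 1" using dyn.learned_filter by blast
  have am: "\<alpha> * real m > 0" using params_pos by simp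
  have "1 / (8 * (\<alpha> * real m)) \<le> 1 / (\<alpha> * real m)" using am by (intro divide_left_mono) auto
  also have "\<dots> \<le> w r T" using r am by (simp add: field_simps)
  finally show ?thesis using r polylog_bound[OF params_pos(5)] by (force simp: w_def)
qed

lemma memorized_patch_polylog:
  "\<exists>i\<in>SU. \<exists>r<m. \<exists>j<P. j \<noteq> s i \<and>
     y i * inner_d d (W T r) (x i j) \<ge> (1 / (8 * C)) / ln (real (T * d * N * m * P) / idelta A) ^ nat \<lceil>C\<rceil>"
proof -
  obtain k q r where *: "k \<in> SU" "q \<in> Q k" "r < m" "z r (k, q) T \<ge> 1 / (8 * real m)"
    using dyn.memorized_patch by blast
  then show ?thesis using polylog_bound[of 1] by (force simp: z_def Q_def)
qed

end

theorem theoremG6: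
  shows "\<exists>C0>0. \<forall>C\<ge>C0.
    (\<exists>c>0. \<exists>k::nat. \<forall>S W Xa.
        params_ok C S \<and> data_ok S \<and> event_E S \<and> AT_traj S W Xa \<longrightarrow>
        (\<exists>r<im S. W (iT S) r 0 \<ge>
            c / (ialpha S * ln (real (iT S * idim S * iN S * im S * iP S) / idelta S) ^ k)) \<and>
        (\<exists>i\<in>iSU S. \<exists>r<im S. \<exists>j<iP S. j \<noteq> iS S i \<and>
            iy S i * inner_d (idim S) (W (iT S) r) (iX S i j) \<ge>
            c / ln (real (iT S * idim S * iN S * im S * iP S) / idelta S) ^ k)) \<and>
    (\<forall>(Ss :: nat \<Rightarrow> at_inst) Ws Xas.
        (\<forall>n. params_ok C (Ss n) \<and> data_ok (Ss n) \<and> event_E (Ss n) \<and> AT_traj (Ss n) (Ws n) (Xas n)) \<and>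
        filterlim (\<lambda>n. idim (Ss n)) at_top sequentially \<longrightarrow>
        (\<lambda>n. rob_train_loss (Ss n) (Ws n) (Xas n)) \<longlonglongrightarrow> 0 \<and>
        (\<forall>e>0. eventually (\<lambda>n. rob_test_err (Ss n) (Ws n (iT (Ss n))) \<ge> 1/2 - e) sequentially))"
proof (rule exI[of _ "10 ^ 6 :: real"], intro conjI allI impI, goal_cases)
  case 1
  then show ?case by simp
next
  case (2 C)
  have C: "C > 0" using 2 by (rule less_le_trans[rotated]) simp
  have run: "at_run C S W Xa" if "params_ok C S \<and> data_ok S \<and> event_E S \<and> AT_traj S W Xa" for S W Xa
    using that 2 by (intro at_run.intro) auto
  show ?case
  \<comment> \<open>Constant and exponent depend on \<open>C\<close> alone, hence are uniform over
    all instances.\<close>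
  proof (rule exI[of _ "1 / (8 * C)"], rule conjI, goal_cases)
    case 1
    show ?case using C by simp
  next
    case 2
    show ?case by (rule exI[of _ "nat \<lceil>C\<rceil>"]) (use run in \<open>blast intro: at_run.learned_filter_polylog at_run.memorized_patch_polylog\<close>)
  qed
next
  case (3 C Ss Ws Xas)
  have run: "at_run C (Ss n) (Ws n) (Xas n)" for n using 3 by (intro at_run.intro) auto
  have dlim: "filterlim (\<lambda>n. real (idim (Ss n))) at_top sequentially"
    using 3 by (intro filterlim_compose[OF filterlim_real_sequentially]) auto
  then have ll: "filterlim (\<lambda>n. ln (ln (real (idim (Ss n))))) at_top sequentially"
    by (intro filterlim_compose[OF ln_at_top] dlim)
  \<comment> \<open>The loss is at most \<open>1 / l + 3 / m\<close>, and both \<open>l\<close> and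
    \<open>m\<close> are at least \<open>ln (ln d)\<close>.\<close>
  have "(\<lambda>n. 4 / ln (ln (real (idim (Ss n))))) \<longlonglongrightarrow> 0"
    by (intro tendsto_divide_0[OF tendsto_const] filterlim_at_top_imp_at_infinity ll)
  moreover have "\<forall>\<^sub>F n in sequentially. norm (rob_train_loss (Ss n) (Ws n) (Xas n)) \<le> 4 / ln (ln (real (idim (Ss n))))"
    using filterlim_at_top_dense[THEN iffD1, OF ll, rule_format, of 0]
  proof eventually_elim
    case (elim n)
    interpret at_run C "Ss n" "Ws n" "Xas n" by (rule run)
    have "rob_train_loss (Ss n) (Ws n) (Xas n) \<ge> 0"
      unfolding rob_train_loss_def logistic_def by (intro divide_nonneg_nonneg sum_nonneg ln_ge_zero) auto
    moreover have "1 / prm.l \<le> 1 / ln (ln (real d))" "3 / real m \<le> 3 / ln (ln (real d))"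
      using prm.ln_ln_d_le elim prm.l_ge params_pos(4) by (auto intro!: divide_left_mono mult_pos_pos)
    ultimately show ?case using train_loss by simp
  qed
  ultimately show ?case by (rule Lim_null_comparison[rotated])
next
  case (4 C Ss Ws Xas e)
  have run: "at_run C (Ss n) (Ws n) (Xas n)" for n using 4 by (intro at_run.intro) auto
  have dlim: "filterlim (\<lambda>n. real (idim (Ss n))) at_top sequentially"
    using 4 by (intro filterlim_compose[OF filterlim_real_sequentially]) auto
  have "(\<lambda>n. 1 - 2 * C / real (idim (Ss n))) \<longlonglongrightarrow> 1 - 0"
    by (intro tendsto_diff tendsto_const tendsto_divide_0[OF tendsto_const] filterlim_at_top_imp_at_infinity dlim)
  then have "\<forall>\<^sub>F n in sequentially. 1 / 2 - e < 1 - 2 * C / real (idim (Ss n))"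
    using 4 by (intro order_tendstoD(1)) auto
  then show ?case
  proof eventually_elim
    case (elim n)
    then show ?case using at_run.test_error[OF run, of n] by simp
  qed
qed

end
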